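(* Let $M$ be a $C^{2,1}$ manifold endowed with a time dependent Lipschitz spray $H^\mu(t,x,v)$, and for $t_0\in\mathbb{R}$ and $v\in TM$ let $\gamma_{(t_0,v)}(t)$ be the solution of $$\frac{dx^\mu}{dt}=v^\mu,\qquad\frac{dv^\mu}{dt}=H^\mu(t,x,v)$$ with initial condition $v\in TM$ at time $t_0$. The solution $\gamma_{(t_0,v)}(t)$ is locally Lipschitz in $(t,t_0,v)$ and $\gamma_{(t_0,v)}(\cdot)$ is $C^{2,1}_{loc}$. Let $(\hat t,\hat p)\in\mathbb{R}\times M$; then for every $\epsilon>0$ there is an open neighborhood $C$ of $\hat p$ such that for every $p_1,p_2\in C$ and $t_1,t_2\in(\hat t-\epsilon,\hat t+\epsilon)$, $t_1<t_2$, there is one and only one solution starting from $p_1$ at time $t_1$ and reaching $p_2$ at time $t_2$ entirely contained in $C$.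
   Context: $C^{k,1}$ means $C^{k,1}_{loc}$. $M$ is an $n$-dimensional paracompact connected $C^{2,1}$ manifold. Each chart $x^\mu$ on $U\subset M$ induces a chart $(x^\mu,v^\mu)$ on the tangent bundle over $U$; Lipschitz conditions are understood in such charts. A time dependent Lipschitz spray assigns to each chart functions $H^\mu(t,x,v)$, defined for $t\in\mathbb{R}$ and $(x,v)$ in the tangent bundle over $U$, locally Lipschitz in $(t,x,v)$, with $H^\mu(t,x,sv)=s^2H^\mu(t,x,v)$ for every $s>0$, transforming at each $t$ under a change of chart $\tilde x(x)$ (with $\tilde v^\mu=\frac{\partial\tilde x^\mu}{\partial x^\nu}v^\nu$) as $\tilde H^\mu(t,\tilde x,\tilde v)=\frac{\partial^2\tilde x^\mu}{\partial x^\alpha\partial x^\beta}v^\alpha v^\beta+\frac{\partial\tilde x^\mu}{\partial x^\nu}H^\nu(t,x,v)$. Solutions may be constant. *)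

theory Defs
  imports "HOL-Analysis.Analysis"
begin

section \<open>Maps of class \<open>C\<^sup>k\<^sup>,\<^sup>1\<close>\<close>

definition locally_lipschitz_on :: "'a::metric_space set \<Rightarrow> ('a \<Rightarrow> 'b::metric_space) \<Rightarrow> bool" where
  "locally_lipschitz_on S f \<longleftrightarrow>
     (\<forall>x\<in>S. \<exists>r>0. \<exists>L. L-lipschitz_on (ball x r \<inter> S) f)"

definition dir_deriv :: "'a \<Rightarrow> ('a::euclidean_space \<Rightarrow> 'b::euclidean_space) \<Rightarrow> 'a \<Rightarrow> 'b" where
  "dir_deriv b f x = frechet_derivative f (at x) b"

text \<open>Only used for open \<open>S\<close>: \<open>f\<close> and its partial derivatives of order less than \<open>k\<close> are
  differentiable, and those of order \<open>k\<close> are locally Lipschitz.\<close>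

primrec ck1_on :: "nat \<Rightarrow> 'a set \<Rightarrow> ('a::euclidean_space \<Rightarrow> 'b::euclidean_space) \<Rightarrow> bool" where
  "ck1_on 0 S f \<longleftrightarrow> locally_lipschitz_on S f"
| "ck1_on (Suc k) S f \<longleftrightarrow>
     (\<forall>x\<in>S. f differentiable (at x)) \<and> (\<forall>b\<in>Basis. ck1_on k S (dir_deriv b f))"

text \<open>The vector \<open>\<Sum>\<^bsub>\<alpha>,\<beta>\<^esub> (\<partial>\<^sub>\<alpha>\<partial>\<^sub>\<beta> f)(x) v\<^sup>\<alpha> v\<^sup>\<beta>\<close>.\<close>

definition second_deriv_form :: "(real^'n \<Rightarrow> real^'n) \<Rightarrow> real^'n \<Rightarrow> real^'n \<Rightarrow> real^'n" where
  "second_deriv_form f x v =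
     (\<Sum>\<alpha>\<in>UNIV. \<Sum>\<beta>\<in>UNIV.
        (v $ \<alpha> * v $ \<beta>) *\<^sub>R dir_deriv (axis \<alpha> 1) (dir_deriv (axis \<beta> 1) f) x)"

section \<open>\<open>C\<^sup>2\<^sup>,\<^sup>1\<close> manifolds\<close>

text \<open>The manifold is the whole type \<open>'m\<close>, and its dimension is \<open>CARD('n)\<close>. The values of a chart
  map outside the domain of the chart are irrelevant.\<close>

type_synonym ('m, 'n) chart = "'m set \<times> ('m \<Rightarrow> real^'n)"

abbreviation cdom :: "('m, 'n) chart \<Rightarrow> 'm set" where "cdom \<equiv> fst"
abbreviation cmap :: "('m, 'n) chart \<Rightarrow> 'm \<Rightarrow> real^'n" where "cmap \<equiv> snd"

definition is_chart :: "('m::topological_space, 'n::finite) chart \<Rightarrow> bool" where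
  "is_chart c \<longleftrightarrow> open (cdom c) \<and> open (cmap c ` cdom c) \<and>
     homeomorphism (cdom c) (cmap c ` cdom c) (cmap c) (inv_into (cdom c) (cmap c))"

text \<open>The change of chart from \<open>c\<close> to \<open>d\<close>, meaningful on \<open>cmap c ` (cdom c \<inter> cdom d)\<close>.\<close>

definition transition :: "('m, 'n::finite) chart \<Rightarrow> ('m, 'n) chart \<Rightarrow> real^'n \<Rightarrow> real^'n" where
  "transition c d = cmap d \<circ> inv_into (cdom c) (cmap c)"

definition c21_compatible :: "('m, 'n::finite) chart \<Rightarrow> ('m, 'n) chart \<Rightarrow> bool" where
  "c21_compatible c d \<longleftrightarrow>
     ck1_on 2 (cmap c ` (cdom c \<inter> cdom d)) (transition c d) \<and>
     ck1_on 2 (cmap d ` (cdom c \<inter> cdom d)) (transition d c)"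

definition c21_structure :: "('m::topological_space, 'n::finite) chart set \<Rightarrow> bool" where
  "c21_structure A \<longleftrightarrow>
     (\<forall>c\<in>A. is_chart c) \<and> (\<Union>c\<in>A. cdom c) = UNIV \<and> (\<forall>c\<in>A. \<forall>d\<in>A. c21_compatible c d) \<and>
     (\<forall>c. is_chart c \<and> (\<forall>d\<in>A. c21_compatible c d) \<longrightarrow> c \<in> A)"

definition paracompact_type :: "'m::topological_space itself \<Rightarrow> bool" where
  "paracompact_type _ \<longleftrightarrow>
     (\<forall>\<U> :: 'm set set. (\<forall>U\<in>\<U>. open U) \<and> \<Union>\<U> = UNIV \<longrightarrow>
        (\<exists>\<V>. (\<forall>V\<in>\<V>. open V \<and> (\<exists>U\<in>\<U>. V \<subseteq> U)) \<and> \<Union>\<V> = UNIV \<and> locally_finite_in euclidean \<V>))"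

definition c21_manifold :: "('m::t2_space, 'n::finite) chart set \<Rightarrow> bool" where
  "c21_manifold A \<longleftrightarrow>
     c21_structure A \<and> paracompact_type TYPE('m) \<and> connected (UNIV :: 'm set)"

section \<open>The tangent bundle\<close>

text \<open>A tangent vector is a point together with the family of its components in all the charts
  around the point, related by the Jacobians of the changes of chart; components with respect to
  other charts are set to \<open>0\<close>.\<close>

type_synonym ('m, 'n) tangent = "'m \<times> (('m, 'n) chart \<Rightarrow> real^'n)"

abbreviation base :: "('m, 'n) tangent \<Rightarrow> 'm" where "base \<equiv> fst"
abbreviation vcomp :: "('m, 'n) tangent \<Rightarrow> ('m, 'n) chart \<Rightarrow> real^'n" where "vcomp \<equiv> snd"

definition tangent_bundle :: "('m, 'n::finite) chart set \<Rightarrow> ('m, 'n) tangent set" where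
  "tangent_bundle A = {\<xi>.
     (\<forall>c\<in>A. \<forall>d\<in>A. base \<xi> \<in> cdom c \<inter> cdom d \<longrightarrow>
        vcomp \<xi> d = frechet_derivative (transition c d) (at (cmap c (base \<xi>))) (vcomp \<xi> c)) \<and>
     (\<forall>c. \<not> (c \<in> A \<and> base \<xi> \<in> cdom c) \<longrightarrow> vcomp \<xi> c = 0)}"

text \<open>The chart \<open>(x\<^sup>\<mu>, v\<^sup>\<mu>)\<close> of the tangent bundle induced by \<open>c\<close>; its domain is
  \<open>{\<xi> \<in> tangent_bundle A. base \<xi> \<in> cdom c}\<close>.\<close>

definition tchart :: "('m, 'n) chart \<Rightarrow> ('m, 'n) tangent \<Rightarrow> (real^'n) \<times> (real^'n)" where
  "tchart c \<xi> = (cmap c (base \<xi>), vcomp \<xi> c)"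

section \<open>Time dependent sprays and their solutions\<close>

type_synonym ('m, 'n) spray = "('m, 'n) chart \<Rightarrow> real \<Rightarrow> real^'n \<Rightarrow> real^'n \<Rightarrow> real^'n"

definition lipschitz_spray :: "('m, 'n::finite) chart set \<Rightarrow> ('m, 'n) spray \<Rightarrow> bool" where
  "lipschitz_spray A H \<longleftrightarrow>
     (\<forall>c\<in>A. locally_lipschitz_on (UNIV \<times> (cmap c ` cdom c) \<times> UNIV) (\<lambda>(t, x, v). H c t x v)) \<and>
     (\<forall>c\<in>A. \<forall>t. \<forall>x \<in> cmap c ` cdom c. \<forall>v. \<forall>s>0. H c t x (s *\<^sub>R v) = s\<^sup>2 *\<^sub>R H c t x v) \<and>
     (\<forall>c\<in>A. \<forall>d\<in>A. \<forall>t. \<forall>x \<in> cmap c ` (cdom c \<inter> cdom d). \<forall>v.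
        H d t (transition c d x) (frechet_derivative (transition c d) (at x) v) =
          second_deriv_form (transition c d) x v +
          frechet_derivative (transition c d) (at x) (H c t x v))"

text \<open>A solution of the first order system is a curve in the tangent bundle. Continuity of the
  projected curve is required because the chart maps are arbitrary outside the chart domains.
  At the end points of \<open>I\<close> the derivatives are one-sided.\<close>

definition spray_solution ::
  "('m::topological_space, 'n::finite) chart set \<Rightarrow> ('m, 'n) spray \<Rightarrow> real set \<Rightarrow>
    (real \<Rightarrow> ('m, 'n) tangent) \<Rightarrow> bool" where
  "spray_solution A H I \<Gamma> \<longleftrightarrow>
     is_interval I \<and> \<Gamma> ` I \<subseteq> tangent_bundle A \<and> continuous_on I (\<lambda>t. base (\<Gamma> t)) \<and>
     (\<forall>c\<in>A. \<forall>t\<in>I. base (\<Gamma> t) \<in> cdom c \<longrightarrow>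
        ((\<lambda>s. cmap c (base (\<Gamma> s))) has_vector_derivative vcomp (\<Gamma> t) c) (at t within I) \<and>
        ((\<lambda>s. vcomp (\<Gamma> s) c) has_vector_derivative
           H c t (cmap c (base (\<Gamma> t))) (vcomp (\<Gamma> t) c)) (at t within I))"

text \<open>\<open>\<Gamma>\<close> on \<open>J\<close> is the unique maximal solution with value \<open>\<xi>\<close> at time \<open>t0\<close>.\<close>

definition maximal_solution ::
  "('m::topological_space, 'n::finite) chart set \<Rightarrow> ('m, 'n) spray \<Rightarrow> real \<Rightarrow> ('m, 'n) tangent \<Rightarrow>
    real set \<Rightarrow> (real \<Rightarrow> ('m, 'n) tangent) \<Rightarrow> bool" where
  "maximal_solution A H t0 \<xi> J \<Gamma> \<longleftrightarrow>
     open J \<and> t0 \<in> J \<and> \<Gamma> t0 = \<xi> \<and> spray_solution A H J \<Gamma> \<and>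
     (\<forall>I \<Delta>. t0 \<in> I \<and> \<Delta> t0 = \<xi> \<and> spray_solution A H I \<Delta> \<longrightarrow>
        I \<subseteq> J \<and> (\<forall>t\<in>I. \<Delta> t = \<Gamma> t))"

text \<open>The map \<open>(t, t0, \<xi>) \<mapsto> \<gamma> t0 \<xi> t\<close>, defined for \<open>t \<in> J t0 \<xi>\<close>, has an open domain in
  \<open>\<real> \<times> \<real> \<times> TM\<close> and is locally Lipschitz into \<open>TM\<close>, in the induced charts of the tangent bundle.
  In particular its projection to the manifold is locally Lipschitz.\<close>

definition locally_lipschitz_flow ::
  "('m, 'n::finite) chart set \<Rightarrow> (real \<Rightarrow> ('m, 'n) tangent \<Rightarrow> real set) \<Rightarrow>
    (real \<Rightarrow> ('m, 'n) tangent \<Rightarrow> real \<Rightarrow> ('m, 'n) tangent) \<Rightarrow> bool" where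
  "locally_lipschitz_flow A J \<gamma> \<longleftrightarrow>
     (\<forall>t0. \<forall>\<xi> \<in> tangent_bundle A. \<forall>t \<in> J t0 \<xi>. \<forall>c\<in>A. \<forall>d\<in>A.
        base \<xi> \<in> cdom c \<and> base (\<gamma> t0 \<xi> t) \<in> cdom d \<longrightarrow>
        (\<exists>r>0. \<exists>L. let N = {(s, s0, \<eta>). \<eta> \<in> tangent_bundle A \<and> base \<eta> \<in> cdom c \<and>
                             dist (s, s0, tchart c \<eta>) (t, t0, tchart c \<xi>) < r} in
           (\<forall>(s, s0, \<eta>) \<in> N. s \<in> J s0 \<eta> \<and> base (\<gamma> s0 \<eta> s) \<in> cdom d) \<and>
           (\<forall>(s, s0, \<eta>) \<in> N. \<forall>(s', s0', \<eta>') \<in> N.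
              dist (tchart d (\<gamma> s0 \<eta> s)) (tchart d (\<gamma> s0' \<eta>' s'))
                \<le> L * dist (s, s0, tchart c \<eta>) (s', s0', tchart c \<eta>'))))"

definition c21_curve ::
  "('m::topological_space, 'n::finite) chart set \<Rightarrow> real set \<Rightarrow> (real \<Rightarrow> 'm) \<Rightarrow> bool" where
  "c21_curve A J x \<longleftrightarrow>
     continuous_on J x \<and> (\<forall>c\<in>A. ck1_on 2 {t \<in> J. x t \<in> cdom c} (\<lambda>t. cmap c (x t)))"

definition joining_solution ::
  "('m::topological_space, 'n::finite) chart set \<Rightarrow> ('m, 'n) spray \<Rightarrow> 'm set \<Rightarrow>
    real \<Rightarrow> 'm \<Rightarrow> real \<Rightarrow> 'm \<Rightarrow> (real \<Rightarrow> ('m, 'n) tangent) \<Rightarrow> bool" where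
  "joining_solution A H C t1 p1 t2 p2 \<Gamma> \<longleftrightarrow>
     spray_solution A H {t1..t2} \<Gamma> \<and> base (\<Gamma> t1) = p1 \<and> base (\<Gamma> t2) = p2 \<and>
     (\<forall>t\<in>{t1..t2}. base (\<Gamma> t) \<in> C)"

end

theory Submission
  imports Defs
begin

text \<open>In a chart the equations are a first order system \<open>y' = f(t, y)\<close> in the coordinates
  \<open>y = (x, v)\<close> of the tangent bundle, with \<open>f\<close> locally Lipschitz. Picard's contraction
  (\<open>lipschitz_flow_of_ode\<close>) solves it near every initial condition, for a time that is
  uniform near the initial condition, and the solution is Lipschitz in the time, the initial
  time and the initial value together. The transformation law of the spray says exactly that
  solving the equations in one chart around a point is the same as solving them in all
  charts (\<open>solves_at_of_one_chart\<close>), so the local solutions live on the manifold.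
  Two solutions that agree once agree as long as both exist, because the set of times of agreement
  is open and closed; here closedness uses that the manifold is Hausdorff. Hence the union
  of all solutions with a given initial condition is a solution, and it is maximal. That the
  flow is locally Lipschitz at a time \<open>t\<close> of its domain is again a property
  that holds at the initial time and is transported along the orbit, by composing with the
  local flow around each point of the orbit (\<open>flow_lipschitz_propagates\<close>); a
  connectedness argument along the domain finishes the proof.

  For the convex neighborhoods the velocity needed to join two nearby points in a short time
  is large, and smallness can only come from homogeneity. Parametrize a solution on
  \<open>{t1..t2}\<close> by \<open>s = (t - t1) / (t2 - t1)\<close>: as the spray is homogeneous of degree two, the curve
  \<open>X s = x t\<close> solves \<open>X'' = H(t1 + s (t2 - t1), X, X')\<close> on the unit interval, whatever the
  length of \<open>{t1..t2}\<close>. Homogeneity also upgrades the Lipschitz bound near the zero section, uniform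
  over the compact time interval, to
  \<open>\<bar>H(t, x, v) - H(t, x', v')\<bar> \<le> K (\<rho>\<^sup>2 \<bar>x - x'\<bar> + \<rho> \<bar>v - v'\<bar>)\<close> for all velocities of norm at most \<open>\<rho>\<close>, so
  that the right-hand side is a small perturbation of \<open>0\<close> as soon as the velocities are small.
  In a coordinate ball of small radius \<open>r\<close> the boundary value problem is then solved by
  a contraction among curves with velocity of size \<open>r\<close> (\<open>solution_exists\<close>). The solution stays in
  the ball because the squared distance to the center is a convex function along it
  (\<open>solves_in_ball\<close>). Conversely every solution that is confined to the ball has velocity
  of size \<open>r\<close>: at the maximal speed it would otherwise run out of the ball before
  the quadratic acceleration could turn it (\<open>velocity_le\<close>). Hence the smallness that makes
  the contraction work applies to all competitors, which gives uniqueness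
  (\<open>solution_unique\<close>).\<close>

section \<open>Estimates for curves and fixed points on an interval\<close>

lemma has_vector_derivative_pair_iff:
  "((\<lambda>s. (f s, g s)) has_vector_derivative (f', g')) (at t within I) \<longleftrightarrow>
     (f has_vector_derivative f') (at t within I) \<and> (g has_vector_derivative g') (at t within I)"
proof
  assume *: "((\<lambda>s. (f s, g s)) has_vector_derivative (f', g')) (at t within I)"
  show "(f has_vector_derivative f') (at t within I) \<and> (g has_vector_derivative g') (at t within I)"
    using bounded_linear.has_vector_derivative[OF bounded_linear_fst *]
      bounded_linear.has_vector_derivative[OF bounded_linear_snd *] by simp
qed (intro has_vector_derivative_Pair; elim conjE)

lemma eventually_within_ball:
  fixes f :: "real \<Rightarrow> 'b::topological_space"
  assumes "continuous (at t within I) f" "open U" "f t \<in> U"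
  obtains e where "e > 0" "\<And>s. s \<in> I \<Longrightarrow> s \<in> ball t e \<Longrightarrow> f s \<in> U"
proof -
  have "\<forall>\<^sub>F s in at t within I. f s \<in> U"
    using assms topological_tendstoD unfolding continuous_within by blast
  then obtain e where e: "e > 0" "\<And>s. s \<in> I \<Longrightarrow> s \<noteq> t \<Longrightarrow> dist s t < e \<Longrightarrow> f s \<in> U"
    unfolding eventually_at by blast
  show ?thesis
  proof (rule that[OF e(1)])
    fix s assume "s \<in> I" "s \<in> ball t e"
    then show "f s \<in> U" using e(2)[of s] assms(3) by (cases "s = t") (auto simp: dist_commute)
  qed
qed

lemma vector_derivative_bound:
  fixes f :: "real \<Rightarrow> 'a::real_normed_vector"
  assumes "convex S" and "\<And>s. s \<in> S \<Longrightarrow> (f has_vector_derivative f' s) (at s within S)"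
    and "\<And>s. s \<in> S \<Longrightarrow> norm (f' s) \<le> B" and "x \<in> S" "y \<in> S"
  shows "norm (f x - f y) \<le> B * \<bar>x - y\<bar>"
proof -
  have "norm (f x - f y) \<le> B * norm (x - y)"
  proof (rule differentiable_bound[OF assms(1) assms(2)[unfolded has_vector_derivative_def] _ assms(4,5)])
    fix s assume s: "s \<in> S"
    show "onorm (\<lambda>h. h *\<^sub>R f' s) \<le> B"
    proof (rule onorm_le)
      fix h :: real
      show "norm (h *\<^sub>R f' s) \<le> B * norm h"
        using mult_left_mono[OF assms(3)[OF s], of "\<bar>h\<bar>"] by (simp add: mult.commute)
    qed
  qed
  then show ?thesis by simp
qed

text \<open>The best bound is the norm at a maximum, and if every bound \<open>D\<close> can be improved to \<open>c + D / 2\<close>, then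
  the best one is at most \<open>2 c\<close>. On time intervals short compared to the inverse of
  the Lipschitz constant this takes the place of Gronwall's inequality: with \<open>c = 0\<close> it
  gives uniqueness, and with \<open>c > 0\<close> Lipschitz dependence on data.\<close>

lemma halving_bound:
  fixes w :: "real \<Rightarrow> 'a::real_normed_vector"
  assumes "continuous_on {a..b} w"
    and step: "\<And>D. (\<And>s. s \<in> {a..b} \<Longrightarrow> norm (w s) \<le> D)
                \<Longrightarrow> (\<And>s. s \<in> {a..b} \<Longrightarrow> norm (w s) \<le> c + D / 2)"
    and "s \<in> {a..b}"
  shows "norm (w s) \<le> 2 * c"
proof -
  have "continuous_on {a..b} (\<lambda>s. norm (w s))"
    by (intro continuous_intros assms)
  moreover have "{a..b} \<noteq> {}" using assms(3) by auto
  ultimately obtain x where x: "x \<in> {a..b}" "\<And>s. s \<in> {a..b} \<Longrightarrow> norm (w s) \<le> norm (w x)"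
    using continuous_attains_sup[of "{a..b}" "\<lambda>s. norm (w s)"] by (auto simp: Ball_def)
  have "norm (w x) \<le> c + norm (w x) / 2"
    using step[OF x(2) x(1)] .
  with x(2)[OF assms(3)] show ?thesis by linarith
qed

text \<open>Banach's theorem in the space of continuous curves on \<open>{a..b}\<close> with values in \<open>B\<close>. Curves are
  functions on the whole line of which only the values on \<open>{a..b}\<close> matter, so \<open>\<Phi>\<close> can be
  an integral operator written without any reference to a function space.\<close>

lemma fixed_point_on_interval:
  fixes \<Phi> :: "(real \<Rightarrow> 'a::banach) \<Rightarrow> real \<Rightarrow> 'a"
  assumes "a \<le> b" "closed B" "B \<noteq> {}"
    and maps: "\<And>u. continuous_on {a..b} u \<Longrightarrow> u ` {a..b} \<subseteq> B \<Longrightarrow>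
                 continuous_on {a..b} (\<Phi> u) \<and> \<Phi> u ` {a..b} \<subseteq> B"
    and contr: "\<And>u v D s. continuous_on {a..b} u \<Longrightarrow> u ` {a..b} \<subseteq> B \<Longrightarrow>
                 continuous_on {a..b} v \<Longrightarrow> v ` {a..b} \<subseteq> B \<Longrightarrow>
                 (\<And>s. s \<in> {a..b} \<Longrightarrow> norm (u s - v s) \<le> D) \<Longrightarrow> s \<in> {a..b} \<Longrightarrow>
                 norm (\<Phi> u s - \<Phi> v s) \<le> D / 2"
  obtains u where "continuous_on {a..b} u" "u ` {a..b} \<subseteq> B" "\<And>s. s \<in> {a..b} \<Longrightarrow> \<Phi> u s = u s"
proof -
  \<comment> \<open>Extending curves by constants outside \<open>{a..b}\<close> embeds them into the complete space of
    bounded continuous functions on the line.\<close>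
  define cl where "cl s = max a (min b s)" for s :: real
  have cl: "cl s \<in> {a..b}" for s using assms(1) by (auto simp: cl_def)
  have clid: "cl s = s" if "s \<in> {a..b}" for s using that by (auto simp: cl_def)
  have ccl: "continuous_on UNIV cl" unfolding cl_def by (intro continuous_intros)
  define T where "T w = Bcontfun (\<lambda>s. \<Phi> (apply_bcontfun w) (cl s))" for w
  define S where "S = PiC UNIV (\<lambda>_::real. B)"
  have S: "w \<in> S \<longleftrightarrow> (\<forall>s. apply_bcontfun w s \<in> B)" for w
    by (auto simp: S_def mem_PiC_iff)
  have cw: "continuous_on {a..b} (apply_bcontfun w)" for w :: "real \<Rightarrow>\<^sub>C 'a"
    using apply_bcontfun[of w] by (auto simp: bcontfun_def intro: continuous_on_subset)
  have bc: "(\<lambda>s. g (cl s)) \<in> bcontfun" if "continuous_on {a..b} g" for g :: "real \<Rightarrow> 'a"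
  proof -
    have "continuous_on UNIV (\<lambda>s. g (cl s))"
      by (rule continuous_on_compose2[OF that ccl]) (use cl in auto)
    moreover have "bounded (range (\<lambda>s. g (cl s)))"
      by (rule bounded_subset[OF compact_imp_bounded[OF compact_continuous_image[OF that]]])
        (use cl in auto)
    ultimately show ?thesis by (simp add: bcontfun_def)
  qed
  have T: "apply_bcontfun (T w) s = \<Phi> (apply_bcontfun w) (cl s)" if "w \<in> S" for w s
    unfolding T_def
    by (subst Bcontfun_inverse[OF bc]) (use maps[OF cw] that in \<open>auto simp: S\<close>)
  have "\<exists>!w. w \<in> S \<and> T w = w"
  proof (rule Banach_fix[where c = "1/2"])
    show "complete S" unfolding S_def complete_eq_closed by (intro closed_PiC assms)
    obtain y where y: "y \<in> B" using assms(3) by auto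
    have "(\<lambda>s::real. y) \<in> bcontfun" by (rule const_bcontfun)
    then have "Bcontfun (\<lambda>s. y) \<in> S" by (simp add: S Bcontfun_inverse y)
    then show "S \<noteq> {}" by auto
    show "T ` S \<subseteq> S"
    proof safe
      fix w assume w: "w \<in> S"
      have "\<Phi> (apply_bcontfun w) ` {a..b} \<subseteq> B"
        using maps[OF cw, of w] w by (auto simp: S)
      then show "T w \<in> S" using cl by (subst S) (auto simp: T[OF w])
    qed
    fix v w assume vw: "v \<in> S" "w \<in> S"
    show "dist (T v) (T w) \<le> 1 / 2 * dist v w"
    proof (rule dist_bound)
      fix s
      have "norm (\<Phi> (apply_bcontfun v) (cl s) - \<Phi> (apply_bcontfun w) (cl s)) \<le> dist v w / 2"
        by (rule contr) (use vw cw cl in \<open>auto simp: S dist_bounded simp flip: dist_norm\<close>)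
      then show "dist (apply_bcontfun (T v) s) (apply_bcontfun (T w) s) \<le> 1 / 2 * dist v w"
        by (simp add: T vw dist_norm)
    qed
  qed auto
  then obtain w where w: "w \<in> S" "T w = w" by blast
  show ?thesis
  proof (rule that)
    show "continuous_on {a..b} (apply_bcontfun w)" by (rule cw)
    show "apply_bcontfun w ` {a..b} \<subseteq> B" using w by (auto simp: S)
    show "\<Phi> (apply_bcontfun w) s = apply_bcontfun w s" if "s \<in> {a..b}" for s
      using T[OF w(1), of s] w(2) clid[OF that] by simp
  qed
qed

lemma norm_integral_diff_le:
  fixes g :: "real \<Rightarrow> 'a::banach"
  assumes "continuous_on {a..b} g" "\<And>s. s \<in> {a..b} \<Longrightarrow> norm (g s) \<le> M"
    and "x \<in> {a..b}" "y \<in> {a..b}"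
  shows "norm (integral {a..x} g - integral {a..y} g) \<le> M * \<bar>x - y\<bar>"
  by (rule vector_derivative_bound[where S = "{a..b}" and f' = g])
    (use assms in \<open>auto intro: integral_has_vector_derivative\<close>)

section \<open>Local flows of Lipschitz differential equations\<close>

text \<open>The Picard operator based at the initial time \<open>s0\<close> contracts by a factor of one half on a
  time interval whose length \<open>2 d\<close> depends only on the bound and the Lipschitz constant of \<open>f\<close>. One
  interval therefore serves all initial data near \<open>(t0, y0)\<close>. Changing the initial data
  changes the operator by at most a multiple of the change, and by the contraction its fixed
  point too.\<close>

lemma lipschitz_flow_of_ode:
  fixes f :: "real \<Rightarrow> 'a::banach \<Rightarrow> 'a"
  assumes "r > 0" and lip: "K-lipschitz_on (ball t0 r \<times> ball y0 r) (\<lambda>(t, y). f t y)"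
  obtains d L \<phi> where "0 < d" "0 \<le> L"
    "\<And>s s0 y. s \<in> ball t0 d \<Longrightarrow> s0 \<in> ball t0 d \<Longrightarrow> y \<in> ball y0 d \<Longrightarrow>
       \<phi> s s0 y \<in> ball y0 r \<and> ((\<lambda>s. \<phi> s s0 y) has_vector_derivative f s (\<phi> s s0 y)) (at s)"
    "\<And>s0 y. s0 \<in> ball t0 d \<Longrightarrow> y \<in> ball y0 d \<Longrightarrow> \<phi> s0 s0 y = y"
    "\<And>s s' s0 s0' y y'. s \<in> ball t0 d \<Longrightarrow> s' \<in> ball t0 d \<Longrightarrow> s0 \<in> ball t0 d \<Longrightarrow> s0' \<in> ball t0 d \<Longrightarrow>
       y \<in> ball y0 d \<Longrightarrow> y' \<in> ball y0 d \<Longrightarrow>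
       dist (\<phi> s s0 y) (\<phi> s' s0' y') \<le> L * dist (s, s0, y) (s', s0', y')"
proof -
  have K: "0 \<le> K" using lip by (rule lipschitz_on_nonneg)
  \<comment> \<open>\<open>M\<close> bounds \<open>f\<close>. With \<open>d\<close> as below, a solution moves by at most \<open>r / 4\<close> in a time \<open>2 d\<close>, and two
    curves at distance \<open>D\<close> are mapped to curves at distance at most \<open>K D \<cdot> 2 d \<le> D / 2\<close>.\<close>
  define M where "M = norm (f t0 y0) + K * (2 * r)"
  have M: "0 \<le> M" using K assms(1) by (simp add: M_def)
  define d where "d = min (r / 4) (min (r / (8 * (M + 1))) (1 / (8 * (K + 1))))"
  have d: "d > 0" using K M assms(1) by (simp add: d_def)
  have dr: "d \<le> r / 4" unfolding d_def by (rule min.cobounded1)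
  have "M * d \<le> M * (r / (8 * (M + 1)))" using M by (intro mult_left_mono) (auto simp: d_def)
  also have "\<dots> \<le> r / 8" using M assms(1) by (simp add: field_simps)
  finally have Md: "M * d \<le> r / 8" .
  have "K * d \<le> K * (1 / (8 * (K + 1)))" using K by (intro mult_left_mono) (auto simp: d_def)
  also have "\<dots> \<le> 1 / 8" using K by (simp add: field_simps)
  finally have Kd: "K * d \<le> 1 / 8" .
  define a b where "a = t0 - d" and "b = t0 + d"
  have ab: "a \<le> b" "b - a = 2 * d" using d by (auto simp: a_def b_def)
  have mem: "s \<in> ball t0 r" if "s \<in> {a..b}" for s
    using that d dr assms(1) by (auto simp: a_def b_def dist_real_def)
  have inI: "s \<in> {a..b}" if "s \<in> ball t0 d" for s
    using that by (auto simp: a_def b_def dist_real_def)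
  define B where "B = cball y0 (r / 2)"
  have Br: "y \<in> ball y0 r" if "y \<in> B" for y using that assms(1) by (auto simp: B_def)
  have fl: "norm (f s y - f s y') \<le> K * norm (y - y')" if "s \<in> {a..b}" "y \<in> B" "y' \<in> B" for s y y'
    using lipschitz_onD[OF lip, of "(s, y)" "(s, y')"] mem[OF that(1)] Br that(2,3)
    by (auto simp: dist_Pair_Pair dist_norm)
  have fM: "norm (f s y) \<le> M" if "s \<in> {a..b}" "y \<in> B" for s y
  proof -
    have "dist (s, y) (t0, y0) \<le> dist s t0 + dist y y0"
      unfolding dist_Pair_Pair by (rule sqrt_sum_squares_le_sum) auto
    also have "\<dots> \<le> 2 * r" using mem[OF that(1)] Br[OF that(2)] by (simp add: dist_commute)
    finally have "K * dist (s, y) (t0, y0) \<le> K * (2 * r)" using K by (rule mult_left_mono)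
    moreover have "dist (f s y) (f t0 y0) \<le> K * dist (s, y) (t0, y0)"
      using lipschitz_onD[OF lip, of "(s, y)" "(t0, y0)"] mem[OF that(1)] Br[OF that(2)] assms(1) by auto
    moreover have "norm (f s y) \<le> norm (f t0 y0) + dist (f s y) (f t0 y0)"
      by (simp add: dist_norm norm_triangle_sub)
    ultimately show ?thesis by (simp add: M_def)
  qed
  have cont: "continuous_on {a..b} (\<lambda>s. f s (u s))"
    if "continuous_on {a..b} u" "u ` {a..b} \<subseteq> B" for u
  proof -
    have "continuous_on {a..b} (\<lambda>s. (\<lambda>(t, y). f t y) (s, u s))"
      by (rule continuous_on_compose2[OF lipschitz_on_continuous_on[OF lip]])
        (use that mem Br in \<open>auto intro!: continuous_intros\<close>)
    then show ?thesis by simp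
  qed
  \<comment> \<open>The integral from \<open>s0\<close> to \<open>s\<close> is a difference of integrals from \<open>a\<close>, so that no sign
    has to be distinguished.\<close>
  define \<Phi> where "\<Phi> s0 y u s =
    y + (integral {a..s} (\<lambda>\<sigma>. f \<sigma> (u \<sigma>)) - integral {a..s0} (\<lambda>\<sigma>. f \<sigma> (u \<sigma>)))" for s0 y u s
  have deriv: "(\<Phi> s0 y u has_vector_derivative f s (u s)) (at s within {a..b})"
    if "continuous_on {a..b} u" "u ` {a..b} \<subseteq> B" "s \<in> {a..b}" for s0 y u s
    unfolding \<Phi>_def
    by (auto intro!: derivative_eq_intros integral_has_vector_derivative cont that)
  have diff: "norm ((\<Phi> s0 y u s - \<Phi> s0 y v s)) \<le> D / 2"
    if u: "continuous_on {a..b} u" "u ` {a..b} \<subseteq> B" and v: "continuous_on {a..b} v" "v ` {a..b} \<subseteq> B"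
      and D: "\<And>s. s \<in> {a..b} \<Longrightarrow> norm (u s - v s) \<le> D" and s: "s \<in> {a..b}" "s0 \<in> {a..b}" for u v D s s0 y
  proof -
    define g where "g = (\<lambda>s. f s (u s) - f s (v s))"
    have g: "continuous_on {a..b} g" unfolding g_def by (intro continuous_intros cont u v)
    have gD: "norm (g s) \<le> K * D" if "s \<in> {a..b}" for s
    proof -
      have "norm (g s) \<le> K * norm (u s - v s)"
        unfolding g_def by (rule fl) (use that u v in auto)
      also have "\<dots> \<le> K * D" using D[OF that] K by (rule mult_left_mono)
      finally show ?thesis .
    qed
    have ig: "integral {a..x} g = integral {a..x} (\<lambda>s. f s (u s)) - integral {a..x} (\<lambda>s. f s (v s))"
      if "x \<in> {a..b}" for x
      unfolding g_def
      by (intro integral_diff integrable_continuous_interval continuous_on_subset[OF cont[OF u]]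
           continuous_on_subset[OF cont[OF v]]) (use that in auto)
    have "D \<ge> 0" using D[OF s(1)] norm_ge_zero order_trans by blast
    have "\<Phi> s0 y u s - \<Phi> s0 y v s = integral {a..s} g - integral {a..s0} g"
      unfolding \<Phi>_def ig[OF s(1)] ig[OF s(2)] by (simp add: algebra_simps)
    also have "norm \<dots> \<le> K * D * \<bar>s - s0\<bar>" by (rule norm_integral_diff_le[OF g gD s])
    also have "\<dots> \<le> K * D * (2 * d)"
      using K \<open>D \<ge> 0\<close> s ab by (intro mult_left_mono) auto
    also have "\<dots> = 2 * D * (K * d)" by simp
    also have "\<dots> \<le> 2 * D * (1 / 8)" using Kd \<open>D \<ge> 0\<close> by (intro mult_left_mono) auto
    also have "\<dots> \<le> D / 2" using \<open>D \<ge> 0\<close> by simp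
    finally show ?thesis .
  qed
  have "\<exists>u. continuous_on {a..b} u \<and> u ` {a..b} \<subseteq> B \<and> (\<forall>s\<in>{a..b}. \<Phi> s0 y u s = u s)"
    if "s0 \<in> ball t0 d" "y \<in> ball y0 d" for s0 y
  proof (rule fixed_point_on_interval[where \<Phi> = "\<Phi> s0 y" and a = a and b = b and B = B])
    show "a \<le> b" "closed B" "B \<noteq> {}" using ab assms(1) by (auto simp: B_def)
    fix u :: "real \<Rightarrow> 'a" assume u: "continuous_on {a..b} u" "u ` {a..b} \<subseteq> B"
    have "continuous_on {a..b} (\<Phi> s0 y u)"
      using deriv[OF u] has_vector_derivative_continuous continuous_on_eq_continuous_within by blast
    moreover have "\<Phi> s0 y u s \<in> B" if s: "s \<in> {a..b}" for s
    proof -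
      have "norm (\<Phi> s0 y u s - y) \<le> M * \<bar>s - s0\<bar>"
        unfolding \<Phi>_def add_diff_cancel_left'
        by (rule norm_integral_diff_le[OF cont[OF u]])
          (use fM u s inI \<open>s0 \<in> ball t0 d\<close> in \<open>auto simp: image_subset_iff\<close>)
      also have "\<dots> \<le> M * (2 * d)"
        using M s inI[OF \<open>s0 \<in> ball t0 d\<close>] ab by (intro mult_left_mono) auto
      also have "\<dots> \<le> r / 4" using Md by simp
      finally have "dist (\<Phi> s0 y u s) y \<le> r / 4" by (simp add: dist_norm)
      moreover have "dist y y0 \<le> r / 4" using \<open>y \<in> ball y0 d\<close> dr by (simp add: dist_commute)
      ultimately show ?thesis using dist_triangle[of "\<Phi> s0 y u s" y0 y]
        by (simp add: B_def dist_commute)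
    qed
    ultimately show "continuous_on {a..b} (\<Phi> s0 y u) \<and> \<Phi> s0 y u ` {a..b} \<subseteq> B" by auto
  next
    fix u v :: "real \<Rightarrow> 'a" and D s
    assume "continuous_on {a..b} u" "u ` {a..b} \<subseteq> B" "continuous_on {a..b} v" "v ` {a..b} \<subseteq> B"
      "\<And>s. s \<in> {a..b} \<Longrightarrow> norm (u s - v s) \<le> D" "s \<in> {a..b}"
    then show "norm (\<Phi> s0 y u s - \<Phi> s0 y v s) \<le> D / 2" by (rule diff[OF _ _ _ _ _ _ inI[OF that(1)]])
  qed blast
  then obtain u where u_ex: "\<And>s0 y. s0 \<in> ball t0 d \<Longrightarrow> y \<in> ball y0 d \<Longrightarrow>
      continuous_on {a..b} (u s0 y) \<and> u s0 y ` {a..b} \<subseteq> B \<and> (\<forall>s\<in>{a..b}. \<Phi> s0 y (u s0 y) s = u s0 y s)"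
    by metis
  then have u: "continuous_on {a..b} (u s0 y)" "u s0 y ` {a..b} \<subseteq> B"
      and fp: "\<And>s. s \<in> {a..b} \<Longrightarrow> \<Phi> s0 y (u s0 y) s = u s0 y s"
    if "s0 \<in> ball t0 d" "y \<in> ball y0 d" for s0 y
    using that by auto
  define \<phi> where "\<phi> s s0 y = u s0 y s" for s s0 y
  have ud: "(u s0 y has_vector_derivative f s (u s0 y s)) (at s within {a..b})"
    if "s \<in> {a..b}" "s0 \<in> ball t0 d" "y \<in> ball y0 d" for s s0 y
  proof (rule has_vector_derivative_transform)
    show "(\<Phi> s0 y (u s0 y) has_vector_derivative f s (u s0 y s)) (at s within {a..b})"
      by (rule deriv[OF u[OF that(2,3)] that(1)])
  qed (use that fp in auto)
  define L where "L = 2 + 3 * M"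
  show ?thesis
  proof
    show "0 < d" "0 \<le> L" using d M by (auto simp: L_def)
    fix s s0 y assume s: "s \<in> ball t0 d" and y: "s0 \<in> ball t0 d" "y \<in> ball y0 d"
    have "(u s0 y has_vector_derivative f s (u s0 y s)) (at s)"
    proof -
      have int: "s \<in> interior {a..b}"
        using s unfolding a_def b_def mem_ball dist_real_def interior_atLeastAtMost_real by (simp add: abs_less_iff)
      from ud[OF inI[OF s] y] show ?thesis unfolding at_within_interior[OF int] .
    qed
    then show "\<phi> s s0 y \<in> ball y0 r \<and> ((\<lambda>s. \<phi> s s0 y) has_vector_derivative f s (\<phi> s s0 y)) (at s)"
      unfolding \<phi>_def using Br[OF subsetD[OF u(2)[OF y] imageI[OF inI[OF s]]]] by (rule conjI[rotated])
  next
    fix s0 y assume y: "s0 \<in> ball t0 d" "y \<in> ball y0 d"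
    show "\<phi> s0 s0 y = y"
    proof -
      have "\<Phi> s0 y (u s0 y) s0 = y" by (simp add: \<Phi>_def)
      then show ?thesis unfolding \<phi>_def fp[OF y inI[OF y(1)]] .
    qed
  next
    fix s s' s0 s0' y y'
    assume s: "s \<in> ball t0 d" "s' \<in> ball t0 d" and s0: "s0 \<in> ball t0 d" and s0': "s0' \<in> ball t0 d"
      and y: "y \<in> ball y0 d" and y': "y' \<in> ball y0 d"
    let ?u = "u s0 y" and ?v = "u s0' y'"
    note u1 = u[OF s0 y] and u2 = u[OF s0' y']
    have shift: "norm (\<Phi> s0 y ?v \<sigma> - \<Phi> s0' y' ?v \<sigma>) \<le> norm (y - y') + M * \<bar>s0 - s0'\<bar>" for \<sigma>
    proof -
      have "\<Phi> s0 y ?v \<sigma> - \<Phi> s0' y' ?v \<sigma> =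
          (y - y') - (integral {a..s0} (\<lambda>\<sigma>. f \<sigma> (?v \<sigma>)) - integral {a..s0'} (\<lambda>\<sigma>. f \<sigma> (?v \<sigma>)))"
        by (simp add: \<Phi>_def)
      moreover have "norm (integral {a..s0} (\<lambda>\<sigma>. f \<sigma> (?v \<sigma>)) - integral {a..s0'} (\<lambda>\<sigma>. f \<sigma> (?v \<sigma>)))
          \<le> M * \<bar>s0 - s0'\<bar>"
        by (rule norm_integral_diff_le[OF cont[OF u2]])
          (use fM u2 inI s0 s0' in \<open>auto simp: image_subset_iff\<close>)
      ultimately show ?thesis
        using norm_triangle_ineq4[of "y - y'"
            "integral {a..s0} (\<lambda>\<sigma>. f \<sigma> (?v \<sigma>)) - integral {a..s0'} (\<lambda>\<sigma>. f \<sigma> (?v \<sigma>))"] by simp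
    qed
    have close: "norm (?u s' - ?v s') \<le> 2 * (norm (y - y') + M * \<bar>s0 - s0'\<bar>)"
    proof (rule halving_bound[where a = a and b = b and w = "\<lambda>s. ?u s - ?v s"])
      show "continuous_on {a..b} (\<lambda>s. ?u s - ?v s)" by (intro continuous_intros u1 u2)
      show "s' \<in> {a..b}" using inI s by blast
      fix D \<sigma> assume D: "\<And>\<sigma>. \<sigma> \<in> {a..b} \<Longrightarrow> norm (?u \<sigma> - ?v \<sigma>) \<le> D" and \<sigma>: "\<sigma> \<in> {a..b}"
      have "?u \<sigma> - ?v \<sigma> = (\<Phi> s0 y ?u \<sigma> - \<Phi> s0 y ?v \<sigma>) + (\<Phi> s0 y ?v \<sigma> - \<Phi> s0' y' ?v \<sigma>)"
        using fp[OF s0 y \<sigma>] fp[OF s0' y' \<sigma>] by simp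
      moreover have "norm (\<Phi> s0 y ?u \<sigma> - \<Phi> s0 y ?v \<sigma>) \<le> D / 2"
        by (rule diff[OF u1 u2 D \<sigma> inI[OF s0]])
      ultimately show "norm (?u \<sigma> - ?v \<sigma>) \<le> (norm (y - y') + M * \<bar>s0 - s0'\<bar>) + D / 2"
        using shift[of \<sigma>] norm_triangle_ineq[of "\<Phi> s0 y ?u \<sigma> - \<Phi> s0 y ?v \<sigma>" "\<Phi> s0 y ?v \<sigma> - \<Phi> s0' y' ?v \<sigma>"]
        by simp
    qed
    have "norm (?u s - ?u s') \<le> M * \<bar>s - s'\<bar>"
    proof (rule vector_derivative_bound[where S = "{a..b}", OF _ ud[OF _ s0 y]])
      show "norm (f \<sigma> (?u \<sigma>)) \<le> M" if "\<sigma> \<in> {a..b}" for \<sigma>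
        by (rule fM[OF that]) (use u1(2) that in blast)
    qed (use inI s in auto)
    then have "norm (?u s - ?v s') \<le> M * \<bar>s - s'\<bar> + 2 * (norm (y - y') + M * \<bar>s0 - s0'\<bar>)"
      using close norm_triangle_ineq[of "?u s - ?u s'" "?u s' - ?v s'"] by simp
    also have "\<dots> \<le> M * dist (s, s0, y) (s', s0', y') + 2 * (dist (s, s0, y) (s', s0', y') + M * dist (s, s0, y) (s', s0', y'))"
    proof -
      have "\<bar>s - s'\<bar> \<le> dist (s, s0, y) (s', s0', y')"
        using dist_fst_le[of "(s, s0, y)" "(s', s0', y')"] by (simp add: dist_real_def)
      moreover have le: "dist (s0, y) (s0', y') \<le> dist (s, s0, y) (s', s0', y')"
        using dist_snd_le[of "(s, s0, y)" "(s', s0', y')"] by simp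
      moreover have "\<bar>s0 - s0'\<bar> \<le> dist (s, s0, y) (s', s0', y')"
        using dist_fst_le[of "(s0, y)" "(s0', y')"] le by (simp add: dist_real_def)
      moreover have "norm (y - y') \<le> dist (s, s0, y) (s', s0', y')"
        using dist_snd_le[of "(s0, y)" "(s0', y')"] le by (simp add: dist_norm)
      ultimately show ?thesis using M by (intro add_mono mult_left_mono) auto
    qed
    also have "\<dots> = L * dist (s, s0, y) (s', s0', y')" by (simp add: L_def algebra_simps)
    finally show "dist (\<phi> s s0 y) (\<phi> s' s0' y') \<le> L * dist (s, s0, y) (s', s0', y')"
      by (simp add: \<phi>_def dist_norm)
  qed
qed

text \<open>The difference of the two solutions starts at \<open>0\<close> and its derivative is at most \<open>K\<close> times
  its norm, so over a time at most \<open>1 / (2 K)\<close> every bound for it can be halved.\<close>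

lemma ode_solutions_agree_nearby:
  fixes u v :: "real \<Rightarrow> 'a::real_normed_vector"
  assumes I: "is_interval I" and x: "x \<in> I" and y: "y \<in> I" and eq: "u x = v x"
    and u: "\<And>s. s \<in> I \<Longrightarrow> (u has_vector_derivative f s (u s)) (at s within I)"
    and v: "\<And>s. s \<in> I \<Longrightarrow> (v has_vector_derivative f s (v s)) (at s within I)"
    and lip: "\<And>s. s \<in> I \<Longrightarrow> norm (f s (u s) - f s (v s)) \<le> K * norm (u s - v s)"
    and K: "0 \<le> K" "K * \<bar>y - x\<bar> \<le> 1 / 2"
  shows "u y = v y"
proof -
  define a b where "a = min x y" and "b = max x y"
  have sub: "{a..b} \<subseteq> I"
  proof -
    have "{a..b} = closed_segment x y" unfolding closed_segment_eq_real_ivl a_def b_def by simp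
    then show ?thesis using closed_segment_subset[OF x y is_interval_convex[OF I]] by simp
  qed
  have ab: "x \<in> {a..b}" "y \<in> {a..b}" by (auto simp: a_def b_def)
  have d: "((\<lambda>s. u s - v s) has_vector_derivative f s (u s) - f s (v s)) (at s within {a..b})"
    if "s \<in> {a..b}" for s
  proof -
    have s: "s \<in> I" using sub that by blast
    show ?thesis
      by (rule has_vector_derivative_within_subset[OF has_vector_derivative_diff[OF u[OF s] v[OF s]] sub])
  qed
  have "norm (u y - v y) \<le> 2 * 0"
  proof (rule halving_bound[where a = a and b = b and w = "\<lambda>s. u s - v s", OF _ _ ab(2)])
    show "continuous_on {a..b} (\<lambda>s. u s - v s)"
      using d has_vector_derivative_continuous continuous_on_eq_continuous_within by blast
    fix D s assume D: "\<And>s. s \<in> {a..b} \<Longrightarrow> norm (u s - v s) \<le> D" and s: "s \<in> {a..b}"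
    have D0: "0 \<le> D" using D[OF s] norm_ge_zero order_trans by blast
    have "norm ((u s - v s) - (u x - v x)) \<le> K * D * \<bar>s - x\<bar>"
    proof (rule vector_derivative_bound[of "{a..b}", OF _ d _ s ab(1)])
      fix s assume s: "s \<in> {a..b}"
      have "norm (f s (u s) - f s (v s)) \<le> K * norm (u s - v s)" using lip sub s by blast
      also have "\<dots> \<le> K * D" by (rule mult_left_mono[OF D[OF s] K(1)])
      finally show "norm (f s (u s) - f s (v s)) \<le> K * D" .
    qed auto
    also have "\<dots> \<le> K * D * \<bar>y - x\<bar>"
      using s K(1) D0 by (intro mult_left_mono) (auto simp: a_def b_def min_def max_def split: if_splits)
    also have "\<dots> = D * (K * \<bar>y - x\<bar>)" by simp
    also have "\<dots> \<le> D * (1 / 2)" using K(2) D0 by (rule mult_left_mono)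
    finally show "norm (u s - v s) \<le> 0 + D / 2" using eq by simp
  qed
  then show ?thesis by simp
qed

section \<open>A boundary value problem with quadratically small right-hand side\<close>

lemma nondecreasing_within:
  fixes g :: "real \<Rightarrow> real"
  assumes "\<And>s. s \<in> {a..b} \<Longrightarrow> (g has_vector_derivative g' s) (at s within {a..b})"
    and "\<And>s. s \<in> {x..y} \<Longrightarrow> g' s \<ge> 0" and "a \<le> x" "x \<le> y" "y \<le> b"
  shows "g x \<le> g y"
proof -
  have "\<exists>s\<in>{x..y}. g y - g x = (\<lambda>h. h *\<^sub>R g' s) (y - x)"
  proof (rule mvt_very_simple[OF \<open>x \<le> y\<close>])
    show "(g has_derivative (\<lambda>h. h *\<^sub>R g' s)) (at s within {x..y})" if "x \<le> s" "s \<le> y" for s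
      using has_vector_derivative_within_subset[OF assms(1), of s "{x..y}"] that assms(3-5)
      by (auto simp: has_vector_derivative_def)
  qed
  then obtain s where s: "s \<in> {x..y}" "g y - g x = (y - x) * g' s" by auto
  have "0 \<le> (y - x) * g' s"
    using assms(2)[OF s(1)] assms(4) by (intro mult_nonneg_nonneg) auto
  with s(2) show ?thesis by linarith
qed

text \<open>At any interior time the derivative has a sign, and as it is monotone it keeps this sign
  all the way to one of the end points. With one-sided derivatives at the end points,
  this applies directly to curves that solve an equation on a closed interval.\<close>

lemma convex_le_max_endpoints:
  fixes g :: "real \<Rightarrow> real"
  assumes g: "\<And>s. s \<in> {a..b} \<Longrightarrow> (g has_vector_derivative g' s) (at s within {a..b})"
    and g': "\<And>s. s \<in> {a..b} \<Longrightarrow> (g' has_vector_derivative g'' s) (at s within {a..b})"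
    and "\<And>s. s \<in> {a..b} \<Longrightarrow> g'' s \<ge> 0" and s: "s \<in> {a..b}"
  shows "g s \<le> max (g a) (g b)"
proof -
  have mono: "g' x \<le> g' y" if "a \<le> x" "x \<le> y" "y \<le> b" for x y
    by (rule nondecreasing_within[of a b g', OF g']) (use assms(3) that in auto)
  show ?thesis
  proof (cases "g' s \<ge> 0")
    case True
    have "g s \<le> g b"
      by (rule nondecreasing_within[of a b g, OF g]) (use s mono[of s] True in \<open>auto intro: order_trans\<close>)
    then show ?thesis by simp
  next
    case False
    have "- g a \<le> - g s"
    proof (rule nondecreasing_within[of a b "\<lambda>s. - g s" "\<lambda>s. - g' s"])
      show "((\<lambda>s. - g s) has_vector_derivative - g' \<sigma>) (at \<sigma> within {a..b})" if "\<sigma> \<in> {a..b}" for \<sigma>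
        using g[OF that] by (rule has_vector_derivative_minus)
      show "0 \<le> - g' \<sigma>" if "\<sigma> \<in> {a..s}" for \<sigma>
        using mono[of \<sigma> s] that s False by auto
    qed (use s in auto)
    then show ?thesis by simp
  qed
qed

text \<open>A curve that returns to its starting point has mean velocity \<open>0\<close>, so the velocity at a time
  \<open>s\<close> is the mean of its differences to the velocities at other times. The mean
  is hidden in the increment of \<open>z \<sigma> - \<sigma> w s\<close> over the unit interval.\<close>

lemma velocity_bound_of_equal_endpoints:
  fixes z :: "real \<Rightarrow> 'a::real_normed_vector"
  assumes z: "\<And>s. s \<in> {0..1} \<Longrightarrow> (z has_vector_derivative w s) (at s within {0..1})"
    and w: "\<And>s. s \<in> {0..1} \<Longrightarrow> (w has_vector_derivative k s) (at s within {0..1})"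
    and k: "\<And>s. s \<in> {0..1} \<Longrightarrow> norm (k s) \<le> M" and "z 0 = z 1" and s: "s \<in> {0..1}"
  shows "norm (w s) \<le> M"
proof -
  have M: "0 \<le> M" using k[OF s] norm_ge_zero order_trans by blast
  have *: "norm (w \<sigma> - w s) \<le> M" if "\<sigma> \<in> {0..1}" for \<sigma>
  proof -
    have "norm (w \<sigma> - w s) \<le> M * \<bar>\<sigma> - s\<bar>"
      by (rule vector_derivative_bound[of "{0..1}", OF _ w k]) (use that s in auto)
    also have "\<dots> \<le> M * 1" using M s that by (intro mult_left_mono) auto
    finally show ?thesis by simp
  qed
  have "norm ((z 1 - 1 *\<^sub>R w s) - (z 0 - 0 *\<^sub>R w s)) \<le> M * \<bar>1 - 0\<bar>"
  proof (rule vector_derivative_bound[of "{0..1}" "\<lambda>\<sigma>. z \<sigma> - \<sigma> *\<^sub>R w s" "\<lambda>\<sigma>. w \<sigma> - w s"])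
    fix \<sigma> :: real assume "\<sigma> \<in> {0..1}"
    then show "((\<lambda>\<sigma>. z \<sigma> - \<sigma> *\<^sub>R w s) has_vector_derivative w \<sigma> - w s) (at \<sigma> within {0..1})"
      by (auto intro!: derivative_eq_intros z)
  qed (use * in auto)
  with \<open>z 0 = z 1\<close> show ?thesis by simp
qed

lemma norm_integral_from_0_le:
  fixes g :: "real \<Rightarrow> 'a::banach"
  assumes "continuous_on {0..1} g" "\<And>s. s \<in> {0..1} \<Longrightarrow> norm (g s) \<le> M" and s: "s \<in> {0..1}"
  shows "norm (integral {0..s} g) \<le> M"
proof -
  have M: "0 \<le> M" using assms(2)[OF s] norm_ge_zero order_trans by blast
  have "norm (integral {0..s} g - integral {0..0} g) \<le> M * \<bar>s - 0\<bar>"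
    by (rule norm_integral_diff_le[OF assms(1,2)]) (use s in auto)
  also have "\<dots> \<le> M * 1" using M s by (intro mult_left_mono) auto
  finally show ?thesis by simp
qed

text \<open>The equation \<open>X'' = h(s, X, X')\<close> on the unit interval, where \<open>h\<close> obeys the estimate of a function that is
  Lipschitz and homogeneous of degree two in the velocity. Boundary points lie in the ball of
  radius \<open>r\<close>; the curves of the fixed point argument need room up to radius \<open>5 r\<close>.
  The number \<open>144\<close> is twice \<open>8\<^sup>2 + 8\<close>: solutions in the ball have velocity at most \<open>8 r\<close>, and for such velocities \<open>h\<close>
  has Lipschitz constant at most \<open>K (8\<^sup>2 r\<^sup>2 + 8 r) \<le> 1 / 2\<close>.\<close>

locale quadratic_second_order_ode =
  fixes h :: "real \<Rightarrow> 'a::euclidean_space \<Rightarrow> 'a \<Rightarrow> 'a" and z :: 'a and r K :: real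
  assumes r: "0 < r" and K: "1 \<le> K" and small: "144 * K * r \<le> 1"
    and cont: "continuous_on ({0..1} \<times> ball z (5 * r) \<times> UNIV) (\<lambda>(s, x, v). h s x v)"
    and zero: "\<And>s x. s \<in> {0..1} \<Longrightarrow> x \<in> ball z (5 * r) \<Longrightarrow> h s x 0 = 0"
    and quad: "\<And>s x x' v v' \<rho>. s \<in> {0..1} \<Longrightarrow> x \<in> ball z (5 * r) \<Longrightarrow> x' \<in> ball z (5 * r) \<Longrightarrow>
      norm v \<le> \<rho> \<Longrightarrow> norm v' \<le> \<rho> \<Longrightarrow>
      norm (h s x v - h s x' v') \<le> K * (\<rho>\<^sup>2 * norm (x - x') + \<rho> * norm (v - v'))"
begin

definition solves :: "(real \<Rightarrow> 'a) \<Rightarrow> (real \<Rightarrow> 'a) \<Rightarrow> bool" where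
  "solves X W \<longleftrightarrow> (\<forall>s\<in>{0..1}. (X has_vector_derivative W s) (at s within {0..1}) \<and>
     (W has_vector_derivative h s (X s) (W s)) (at s within {0..1}))"

lemma r_le_1: "r \<le> 1"
proof -
  have "1 * r \<le> K * r" using K r by (intro mult_right_mono) auto
  then show ?thesis using small r by linarith
qed

lemma acceleration_le:
  assumes "s \<in> {0..1}" "x \<in> ball z (5 * r)" "norm v \<le> \<rho>"
  shows "norm (h s x v) \<le> K * \<rho>\<^sup>2"
proof -
  have \<rho>: "0 \<le> \<rho>" using assms(3) norm_ge_zero order_trans by blast
  have "norm (h s x v - h s x 0) \<le> K * (\<rho>\<^sup>2 * norm (x - x) + \<rho> * norm (v - 0))"
    by (rule quad) (use assms \<rho> in auto)
  also have "\<dots> \<le> K * (\<rho>\<^sup>2 * 0 + \<rho> * \<rho>)"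
    using K \<rho> assms(3) by (intro mult_left_mono add_mono) auto
  finally show ?thesis using zero[OF assms(1,2)] by (simp add: power2_eq_square)
qed

text \<open>Velocities are measured in units of \<open>r\<close>. The case \<open>q = 4\<close> serves existence and
  \<open>q = 8\<close> serves uniqueness.\<close>

lemma quad_le:
  assumes "s \<in> {0..1}" "x \<in> ball z (5 * r)" "x' \<in> ball z (5 * r)" and q: "0 \<le> q"
    and "norm v \<le> q * r" "norm v' \<le> q * r" "norm (x - x') \<le> D" "norm (v - v') \<le> D"
  shows "norm (h s x v - h s x' v') \<le> (q\<^sup>2 + q) / 144 * D"
proof -
  have D: "0 \<le> D" using assms(7) norm_ge_zero order_trans by blast
  have "norm (h s x v - h s x' v') \<le> K * ((q * r)\<^sup>2 * norm (x - x') + q * r * norm (v - v'))"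
    by (rule quad) (use assms in auto)
  also have "\<dots> \<le> K * ((q * r)\<^sup>2 * D + q * r * D)"
    using K r q assms(7,8) by (intro mult_left_mono add_mono) auto
  also have "\<dots> \<le> K * (q\<^sup>2 * r * D + q * r * D)"
  proof -
    have "r * r \<le> r * 1" using r_le_1 r by (intro mult_left_mono) auto
    then have "(q * r)\<^sup>2 \<le> q\<^sup>2 * r"
      by (auto simp: power_mult_distrib power2_eq_square[of r] intro!: mult_left_mono)
    then have "(q * r)\<^sup>2 * D \<le> q\<^sup>2 * r * D" using D by (rule mult_right_mono)
    then show ?thesis using K by (intro mult_left_mono) auto
  qed
  also have "\<dots> = 144 * K * r * ((q\<^sup>2 + q) / 144 * D)" by (simp add: field_simps)
  also have "\<dots> \<le> (q\<^sup>2 + q) / 144 * D"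
    using mult_right_mono[OF small, of "(q\<^sup>2 + q) / 144 * D"] D q by simp
  finally show ?thesis .
qed

text \<open>The second derivative of the squared distance to \<open>z\<close> is
  \<open>2 (\<bar>W\<bar>\<^sup>2 + (X - z) \<bullet> h(s, X, W))\<close>. As \<open>h\<close> is quadratic in \<open>W\<close> and \<open>X - z\<close> is small, the second
  term cannot outweigh the first one, so the squared distance is convex and largest
  at an end point.\<close>

lemma solves_in_ball:
  assumes sol: "solves X W" and X: "\<And>s. s \<in> {0..1} \<Longrightarrow> X s \<in> ball z (5 * r)"
    and "X 0 \<in> ball z r" "X 1 \<in> ball z r" and s: "s \<in> {0..1}"
  shows "X s \<in> ball z r"
proof -
  note d = sol[unfolded solves_def, rule_format]
  have nonneg: "0 \<le> W s \<bullet> W s + (X s - z) \<bullet> h s (X s) (W s)" if s: "s \<in> {0..1}" for s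
  proof -
    have "norm (X s - z) * norm (h s (X s) (W s)) \<le> 5 * r * (K * (norm (W s))\<^sup>2)"
      using X[OF s] acceleration_le[OF s X[OF s] order_refl] r
      by (intro mult_mono) (auto simp: dist_norm norm_minus_commute)
    also have "\<dots> = 5 * K * r * (norm (W s))\<^sup>2" by simp
    also have "\<dots> \<le> 144 * K * r * (norm (W s))\<^sup>2"
      using r K by (intro mult_right_mono) auto
    also have "\<dots> \<le> (norm (W s))\<^sup>2"
      using mult_right_mono[OF small, of "(norm (W s))\<^sup>2"] by simp
    finally have "norm (X s - z) * norm (h s (X s) (W s)) \<le> W s \<bullet> W s"
      by (simp add: power2_norm_eq_inner)
    then show ?thesis
      using Cauchy_Schwarz_ineq2[of "X s - z" "h s (X s) (W s)"] by linarith
  qed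
  have "(X s - z) \<bullet> (X s - z) \<le> max ((X 0 - z) \<bullet> (X 0 - z)) ((X 1 - z) \<bullet> (X 1 - z))"
  proof (rule convex_le_max_endpoints[where g = "\<lambda>s. (X s - z) \<bullet> (X s - z)"
        and g' = "\<lambda>s. 2 * ((X s - z) \<bullet> W s)"
        and g'' = "\<lambda>s. 2 * (W s \<bullet> W s + (X s - z) \<bullet> h s (X s) (W s))", OF _ _ _ s])
    fix s :: real assume s: "s \<in> {0..1}"
    have X': "((\<lambda>s. X s - z) has_vector_derivative W s) (at s within {0..1})"
      using d[OF s] by (auto intro!: derivative_eq_intros)
    show "((\<lambda>s. (X s - z) \<bullet> (X s - z)) has_vector_derivative 2 * ((X s - z) \<bullet> W s)) (at s within {0..1})"
      by (rule has_vector_derivative_eq_rhs[OF bounded_bilinear.has_vector_derivative[OF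
            bounded_bilinear_inner X' X']]) (simp add: inner_commute)
    have "((\<lambda>s. (X s - z) \<bullet> W s) has_vector_derivative (X s - z) \<bullet> h s (X s) (W s) + W s \<bullet> W s)
        (at s within {0..1})"
      using bounded_bilinear.has_vector_derivative[OF bounded_bilinear_inner X'] d[OF s] by blast
    then have "((\<lambda>s. 2 *\<^sub>R ((X s - z) \<bullet> W s)) has_vector_derivative
        2 *\<^sub>R ((X s - z) \<bullet> h s (X s) (W s) + W s \<bullet> W s)) (at s within {0..1})"
      by (rule bounded_linear.has_vector_derivative[OF bounded_linear_scaleR_right])
    then show "((\<lambda>s. 2 * ((X s - z) \<bullet> W s)) has_vector_derivative
        2 * (W s \<bullet> W s + (X s - z) \<bullet> h s (X s) (W s))) (at s within {0..1})"
      by (simp add: add.commute)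
    show "0 \<le> 2 * (W s \<bullet> W s + (X s - z) \<bullet> h s (X s) (W s))" using nonneg[OF s] by simp
  qed
  moreover have "(X i - z) \<bullet> (X i - z) < r\<^sup>2" if "X i \<in> ball z r" for i
    using that r by (simp add: dist_norm norm_minus_commute abs_less_iff
        flip: power2_norm_eq_inner) (simp add: power_strict_mono)
  ultimately have "(norm (X s - z))\<^sup>2 < r\<^sup>2"
    using assms(3,4) by (smt (verit) power2_norm_eq_inner)
  then show ?thesis using r
    by (simp add: dist_norm norm_minus_commute power2_less_imp_less)
qed

text \<open>The unknown of the fixed point problem is the velocity \<open>w\<close> alone; the position \<open>X w\<close> is its
  integral, starting at \<open>p1\<close>. Subtracting the mean of the integrated acceleration
  \<open>G w\<close> makes the mean of \<open>\<Phi> w\<close> equal to \<open>p2 - p1\<close>, so the curve of a fixed point ends at \<open>p2\<close>.\<close>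

lemma solution_exists:
  assumes p1: "p1 \<in> ball z r" and p2: "p2 \<in> ball z r"
  obtains X W where "solves X W" "X 0 = p1" "X 1 = p2" "\<And>s. s \<in> {0..1} \<Longrightarrow> X s \<in> ball z r"
proof -
  define X where "X w s = p1 + integral {0..s} w" for w :: "real \<Rightarrow> 'a" and s
  define G where "G w s = integral {0..s} (\<lambda>\<sigma>. h \<sigma> (X w \<sigma>) (w \<sigma>))" for w s
  define \<Phi> where "\<Phi> w s = (p2 - p1) + (G w s - integral {0..1} (G w))" for w s
  \<comment> \<open>\<open>p2 - p1\<close> has norm at most \<open>2 r\<close>, and the correction by the acceleration at most \<open>2 r\<close> again.\<close>
  define B :: "'a set" where "B = cball 0 (4 * r)"
  have X': "(X w has_vector_derivative w s) (at s within {0..1})"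
    if "continuous_on {0..1} w" "s \<in> {0..1}" for w s
    unfolding X_def by (auto intro!: derivative_eq_intros integral_has_vector_derivative that)
  have XB: "X w s \<in> ball z (5 * r)" if w: "continuous_on {0..1} w" "w ` {0..1} \<subseteq> B" and s: "s \<in> {0..1}" for w s
  proof -
    have "norm (integral {0..s} w) \<le> 4 * r"
      by (rule norm_integral_from_0_le[OF w(1) _ s]) (use w(2) in \<open>auto simp: B_def image_subset_iff\<close>)
    then have "dist (X w s) p1 \<le> 4 * r" by (simp add: X_def dist_norm)
    then show ?thesis using p1 dist_triangle[of z "X w s" p1] by (simp add: dist_commute)
  qed
  have contX: "continuous_on {0..1} (X w)" if "continuous_on {0..1} w" for w
    using X'[OF that] has_vector_derivative_continuous continuous_on_eq_continuous_within by blast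
  have conth: "continuous_on {0..1} (\<lambda>\<sigma>. h \<sigma> (X w \<sigma>) (w \<sigma>))"
    if w: "continuous_on {0..1} w" "w ` {0..1} \<subseteq> B" for w
  proof -
    have "continuous_on {0..1} (\<lambda>\<sigma>. (\<lambda>(s, x, v). h s x v) (\<sigma>, X w \<sigma>, w \<sigma>))"
      by (rule continuous_on_compose2[OF cont])
        (use XB[OF w] contX[OF w(1)] w(1) in \<open>auto intro!: continuous_intros\<close>)
    then show ?thesis by simp
  qed
  have G': "(G w has_vector_derivative h s (X w s) (w s)) (at s within {0..1})"
    if w: "continuous_on {0..1} w" "w ` {0..1} \<subseteq> B" and s: "s \<in> {0..1}" for w s
    unfolding G_def by (rule integral_has_vector_derivative[OF conth[OF w] s])
  have contG: "continuous_on {0..1} (G w)"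
    if w: "continuous_on {0..1} w" "w ` {0..1} \<subseteq> B" for w
    using G'[OF w] has_vector_derivative_continuous continuous_on_eq_continuous_within by blast
  have int: "w integrable_on {0..s}" if "continuous_on {0..1} w" "s \<in> {0..1}" for w :: "real \<Rightarrow> 'a" and s
    by (intro integrable_continuous_interval continuous_on_subset[OF that(1)]) (use that in auto)
  have "\<exists>w. continuous_on {0..1} w \<and> w ` {0..1} \<subseteq> B \<and> (\<forall>s\<in>{0..1}. \<Phi> w s = w s)"
  proof (rule fixed_point_on_interval[where \<Phi> = \<Phi> and a = 0 and b = 1 and B = B])
    show "(0::real) \<le> 1" "closed B" "B \<noteq> {}" using r by (auto simp: B_def)
    fix w :: "real \<Rightarrow> 'a" assume w: "continuous_on {0..1} w" "w ` {0..1} \<subseteq> B"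
    have hb: "norm (h s (X w s) (w s)) \<le> K * (4 * r)\<^sup>2" if s: "s \<in> {0..1}" for s
      by (rule acceleration_le[OF s XB[OF w s]]) (use w(2) s in \<open>auto simp: B_def image_subset_iff\<close>)
    have Gb: "norm (G w s) \<le> K * (4 * r)\<^sup>2" if "s \<in> {0..1}" for s
      unfolding G_def by (rule norm_integral_from_0_le[OF conth[OF w] hb that])
    have "norm (integral {0..1} (G w)) \<le> K * (4 * r)\<^sup>2"
      by (rule norm_integral_from_0_le[OF contG[OF w] Gb]) auto
    moreover have "K * (4 * r)\<^sup>2 \<le> r"
    proof -
      have "K * (4 * r)\<^sup>2 = 16 * K * r * r" by (simp add: power2_eq_square)
      also have "\<dots> \<le> 144 * K * r * r" using K r by (intro mult_right_mono) auto
      also have "\<dots> \<le> r" using mult_right_mono[OF small, of r] r by simp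
      finally show ?thesis .
    qed
    moreover have "norm (p2 - p1) \<le> 2 * r"
      using p1 p2 dist_triangle[of p2 p1 z] by (simp add: dist_norm norm_minus_commute)
    ultimately have "norm (\<Phi> w s) \<le> 4 * r" if "s \<in> {0..1}" for s
      using Gb[OF that] norm_triangle_ineq[of "p2 - p1" "G w s - integral {0..1} (G w)"]
        norm_triangle_ineq4[of "G w s" "integral {0..1} (G w)"]
      unfolding \<Phi>_def by linarith
    moreover have "continuous_on {0..1} (\<Phi> w)"
      unfolding \<Phi>_def by (intro continuous_intros contG w)
    ultimately show "continuous_on {0..1} (\<Phi> w) \<and> \<Phi> w ` {0..1} \<subseteq> B"
      by (auto simp: B_def)
  next
    fix u v :: "real \<Rightarrow> 'a" and D s
    assume u: "continuous_on {0..1} u" "u ` {0..1} \<subseteq> B" and v: "continuous_on {0..1} v" "v ` {0..1} \<subseteq> B"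
      and D: "\<And>s. s \<in> {0..1} \<Longrightarrow> norm (u s - v s) \<le> D" and s: "s \<in> {0..1::real}"
    have Xd: "norm (X u s - X v s) \<le> D" if s: "s \<in> {0..1}" for s
    proof -
      have "X u s - X v s = integral {0..s} (\<lambda>s. u s - v s)"
        unfolding X_def by (subst integral_diff) (use int u v s in auto)
      also have "norm \<dots> \<le> D"
        by (rule norm_integral_from_0_le[OF _ D s]) (intro continuous_intros u v)
      finally show ?thesis .
    qed
    have hd: "norm (h s (X u s) (u s) - h s (X v s) (v s)) \<le> D / 4" if s: "s \<in> {0..1}" for s
    proof -
      have "norm (u s) \<le> 4 * r" "norm (v s) \<le> 4 * r"
        using u(2) v(2) s by (auto simp: B_def image_subset_iff)
      moreover have "D \<ge> 0" using D[OF s] norm_ge_zero order_trans by blast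
      ultimately show ?thesis
        using quad_le[OF s XB[OF u s] XB[OF v s], of 4 "u s" "v s" D] Xd[OF s] D[OF s] by simp
    qed
    have Gd: "norm (G u s - G v s) \<le> D / 4" if s: "s \<in> {0..1}" for s
    proof -
      have "G u s - G v s = integral {0..s} (\<lambda>s. h s (X u s) (u s) - h s (X v s) (v s))"
        unfolding G_def by (subst integral_diff) (use int conth u v s in auto)
      also have "norm \<dots> \<le> D / 4"
        by (rule norm_integral_from_0_le[OF _ hd s]) (intro continuous_intros conth u v)
      finally show ?thesis .
    qed
    have "norm (integral {0..1} (\<lambda>s. G u s - G v s)) \<le> D / 4"
      by (rule norm_integral_from_0_le[OF _ Gd]) (auto intro!: continuous_intros contG u v)
    moreover have "integral {0..1} (\<lambda>s. G u s - G v s) = integral {0..1} (G u) - integral {0..1} (G v)"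
      by (intro integral_diff int contG u v) auto
    moreover have "\<Phi> u s - \<Phi> v s = (G u s - G v s) - (integral {0..1} (G u) - integral {0..1} (G v))"
      by (simp add: \<Phi>_def)
    ultimately show "norm (\<Phi> u s - \<Phi> v s) \<le> D / 2"
      using Gd[OF s] norm_triangle_ineq4[of "G u s - G v s" "integral {0..1} (G u) - integral {0..1} (G v)"]
      by simp
  qed blast
  then obtain w where w: "continuous_on {0..1} w" "w ` {0..1} \<subseteq> B"
    and fp: "\<And>s. s \<in> {0..1} \<Longrightarrow> \<Phi> w s = w s" by blast
  have w': "(w has_vector_derivative h s (X w s) (w s)) (at s within {0..1})" if s: "s \<in> {0..1}" for s
  proof (rule has_vector_derivative_transform)
    show "(\<Phi> w has_vector_derivative h s (X w s) (w s)) (at s within {0..1})"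
      unfolding \<Phi>_def by (auto intro!: derivative_eq_intros G' w s)
  qed (use s fp in auto)
  have sol: "solves (X w) w"
    unfolding solves_def using X'[OF w(1)] w' by blast
  have X0: "X w 0 = p1" by (simp add: X_def)
  have "integral {0..1} w = integral {0..1} (\<Phi> w)"
    by (rule integral_cong) (use fp in auto)
  also have "\<dots> = integral {0..1} (\<lambda>s::real. (p2 - p1) - integral {0..1} (G w)) + integral {0..1} (G w)"
  proof (subst integral_add[symmetric])
    show "G w integrable_on {0..1}" by (intro int contG w) auto
    show "integral {0..1} (\<Phi> w) = integral {0..1} (\<lambda>s. (p2 - p1) - integral {0..1} (G w) + G w s)"
      by (rule integral_cong) (simp add: \<Phi>_def)
  qed auto
  also have "\<dots> = p2 - p1" by simp
  finally have X1: "X w 1 = p2" by (simp add: X_def)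
  have "X w s \<in> ball z r" if "s \<in> {0..1}" for s
    by (rule solves_in_ball[OF sol XB[OF w] _ _ that]) (use X0 X1 p1 p2 in auto)
  then show ?thesis using that[OF sol X0 X1] by blast
qed

text \<open>Let \<open>m\<close> be the maximal speed, attained at the time \<open>x\<close>. The acceleration is at most \<open>K m\<^sup>2\<close>, so for
  a time \<open>l \<le> 1 / (2 K m)\<close> around \<open>x\<close> the velocity differs by at most \<open>m / 2\<close> from its value at \<open>x\<close>, and the
  curve advances by at least \<open>l m / 2\<close>. In a ball of radius \<open>r\<close> this forces \<open>l m < 4 r\<close>.
  If \<open>l\<close> is \<open>1 / (2 K m)\<close> this contradicts the smallness of \<open>r\<close>, and if \<open>l\<close> is \<open>1 / 2\<close> it contradicts
  \<open>m > 8 r\<close>.\<close>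

lemma velocity_le:
  assumes sol: "solves X W" and X: "\<And>s. s \<in> {0..1} \<Longrightarrow> X s \<in> ball z r" and s: "s \<in> {0..1}"
  shows "norm (W s) \<le> 8 * r"
proof (rule ccontr)
  assume "\<not> norm (W s) \<le> 8 * r"
  note d = sol[unfolded solves_def, rule_format]
  have "continuous_on {0..1} W"
    using d has_vector_derivative_continuous continuous_on_eq_continuous_within by blast
  then have "continuous_on {0..1} (\<lambda>s. norm (W s))" by (intro continuous_intros)
  then obtain x where x: "x \<in> {0..1}" "\<And>s. s \<in> {0..1} \<Longrightarrow> norm (W s) \<le> norm (W x)"
    using continuous_attains_sup[of "{0..1::real}" "\<lambda>s. norm (W s)"] by (auto simp: Ball_def)
  define m where "m = norm (W x)"
  have m: "m > 8 * r" using x(2)[OF s] \<open>\<not> norm (W s) \<le> 8 * r\<close> by (simp add: m_def)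
  have m0: "m > 0" using m r by linarith
  define l where "l = min (1/2) (1 / (2 * K * m))"
  have l: "l > 0" "l \<le> 1/2" using K m0 by (auto simp: l_def)
  \<comment> \<open>One of the two directions leaves room for a time \<open>l \<le> 1 / 2\<close> inside the unit interval.\<close>
  define y where "y = (if x \<le> 1/2 then x + l else x - l)"
  have y: "y \<in> {0..1}" "\<bar>y - x\<bar> = l" using x(1) l by (auto simp: y_def)
  define S where "S = closed_segment x y"
  have S: "convex S" "x \<in> S" "y \<in> S" by (auto simp: S_def)
  have S01: "\<sigma> \<in> {0..1}" "\<bar>\<sigma> - x\<bar> \<le> l" if "\<sigma> \<in> S" for \<sigma>
    using that x(1) y by (auto simp: S_def closed_segment_eq_real_ivl split: if_splits)
  have Wd: "norm (W \<sigma> - W x) \<le> m / 2" if "\<sigma> \<in> S" for \<sigma>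
  proof -
    have "norm (W \<sigma> - W x) \<le> K * m\<^sup>2 * \<bar>\<sigma> - x\<bar>"
    proof (rule vector_derivative_bound[of "{0..1}"])
      fix s :: real assume s: "s \<in> {0..1}"
      show "(W has_vector_derivative h s (X s) (W s)) (at s within {0..1})" using d[OF s] by blast
      show "norm (h s (X s) (W s)) \<le> K * m\<^sup>2"
        by (rule acceleration_le[OF s]) (use X[OF s] x(2)[OF s] r in \<open>auto simp: m_def\<close>)
    qed (use S01[OF that] x in auto)
    also have "\<dots> \<le> K * m\<^sup>2 * (1 / (2 * K * m))"
      using S01(2)[OF that] K by (intro mult_left_mono) (auto simp: l_def)
    also have "\<dots> = m / 2" using K m0 by (simp add: power2_eq_square)
    finally show ?thesis .
  qed
  have "norm ((X y - y *\<^sub>R W x) - (X x - x *\<^sub>R W x)) \<le> m / 2 * \<bar>y - x\<bar>"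
  proof (rule vector_derivative_bound[OF S(1) _ _ S(3,2), where f' = "\<lambda>s. W s - W x"])
    fix s assume s: "s \<in> S"
    have "(X has_vector_derivative W s) (at s within S)"
      by (rule has_vector_derivative_within_subset) (use d[of s] S01 s in auto)
    then show "((\<lambda>s. X s - s *\<^sub>R W x) has_vector_derivative W s - W x) (at s within S)"
      by (auto intro!: derivative_eq_intros)
  qed (use Wd in auto)
  moreover have "(X y - y *\<^sub>R W x) - (X x - x *\<^sub>R W x) = (X y - X x) - (y - x) *\<^sub>R W x"
    by (simp add: algebra_simps)
  moreover have "norm ((y - x) *\<^sub>R W x) = l * m" using y(2) by (simp add: m_def)
  moreover have "norm (X y - X x) < 2 * r"
    using X[OF y(1)] X[OF x(1)] dist_triangle[of "X y" "X x" z] by (simp add: dist_norm norm_minus_commute)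
  ultimately have "norm ((X y - X x) - (y - x) *\<^sub>R W x) \<le> m / 2 * l"
    "norm ((y - x) *\<^sub>R W x) = l * m" "norm (X y - X x) < 2 * r"
    using y(2) by simp_all
  then have "l * m < 2 * r + m / 2 * l"
    using norm_triangle_sub[of "(y - x) *\<^sub>R W x" "X y - X x"]
      norm_minus_commute[of "(y - x) *\<^sub>R W x" "X y - X x"] by linarith
  then have lm: "l * m < 4 * r" by (simp add: field_simps)
  show False
  proof (cases "l = 1/2")
    case True
    have "1/2 * m < 4 * r" using lm unfolding True .
    then show ?thesis using m by linarith
  next
    case False
    then have "l = 1 / (2 * K * m)" by (auto simp: l_def min_def split: if_splits)
    then have "1 / (2 * K) < 4 * r" using lm m0 by simp
    then have "1 < 8 * K * r" using K by (simp add: field_simps)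
    moreover have "8 * K * r \<le> 144 * K * r" using K r by (intro mult_right_mono) auto
    ultimately show ?thesis using small by linarith
  qed
qed

text \<open>Two solutions in the ball have velocities of norm at most \<open>8 r\<close>, so if their
  velocities differ by at most \<open>D\<close> then so do their positions and their accelerations differ by
  at most \<open>D / 2\<close>. As the difference of the solutions vanishes at both ends, the same bound
  \<open>D / 2\<close> holds for the velocities.\<close>

lemma solution_unique:
  assumes X: "solves X W" "\<And>s. s \<in> {0..1} \<Longrightarrow> X s \<in> ball z r"
    and Y: "solves Y V" "\<And>s. s \<in> {0..1} \<Longrightarrow> Y s \<in> ball z r"
    and ends: "X 0 = Y 0" "X 1 = Y 1" and s: "s \<in> {0..1}"
  shows "X s = Y s" "W s = V s"
proof -
  note dX = X(1)[unfolded solves_def, rule_format] and dY = Y(1)[unfolded solves_def, rule_format]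
  have d1: "((\<lambda>s. X s - Y s) has_vector_derivative W s - V s) (at s within {0..1})" if "s \<in> {0..1}" for s
    using dX[OF that] dY[OF that] by (auto intro!: derivative_intros)
  have d2: "((\<lambda>s. W s - V s) has_vector_derivative h s (X s) (W s) - h s (Y s) (V s)) (at s within {0..1})"
    if "s \<in> {0..1}" for s
    using dX[OF that] dY[OF that] by (auto intro!: derivative_intros)
  have XY: "norm (X s - Y s) \<le> D" if D: "\<And>s. s \<in> {0..1} \<Longrightarrow> norm (W s - V s) \<le> D" and s: "s \<in> {0..1}" for D s
  proof -
    have "D \<ge> 0" using D[OF s] norm_ge_zero order_trans by blast
    have "norm ((X s - Y s) - (X 0 - Y 0)) \<le> D * \<bar>s - 0\<bar>"
      by (rule vector_derivative_bound[of "{0..1}", OF _ d1 D]) (use s in auto)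
    also have "\<dots> \<le> D * 1" using s \<open>D \<ge> 0\<close> by (intro mult_left_mono) auto
    finally show ?thesis using ends by simp
  qed
  have W0: "norm (W s - V s) \<le> 2 * 0" if s: "s \<in> {0..1}" for s
  proof (rule halving_bound[where a = 0 and b = 1 and w = "\<lambda>s. W s - V s", OF _ _ s])
    show "continuous_on {0..1} (\<lambda>s. W s - V s)"
      using d2 has_vector_derivative_continuous continuous_on_eq_continuous_within by blast
    fix D s assume D: "\<And>s. s \<in> {0..1::real} \<Longrightarrow> norm (W s - V s) \<le> D" and s: "s \<in> {0..1::real}"
    have "norm (W s - V s) \<le> D / 2"
    proof (rule velocity_bound_of_equal_endpoints[OF d1 d2 _ _ s])
      fix s :: real assume s: "s \<in> {0..1}"
      show "norm (h s (X s) (W s) - h s (Y s) (V s)) \<le> D / 2"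
        using quad_le[OF s, of "X s" "Y s" 8 "W s" "V s" D] X(2)[OF s] Y(2)[OF s] r
          velocity_le[OF X s] velocity_le[OF Y s] XY[OF D s] D[OF s] by simp
    qed (use ends in auto)
    then show "norm (W s - V s) \<le> 0 + D / 2" by simp
  qed
  from W0[OF s] show "W s = V s" by simp
  have "norm (X s - Y s) \<le> 0" by (rule XY[OF _ s]) (use W0 in auto)
  then show "X s = Y s" by simp
qed

end

section \<open>Locally Lipschitz maps and maps of class \<open>C\<^sup>k\<^sup>,\<^sup>1\<close>\<close>

lemma locally_lipschitz_on_cong:
  "(\<And>x. x \<in> S \<Longrightarrow> f x = g x) \<Longrightarrow> locally_lipschitz_on S f \<longleftrightarrow> locally_lipschitz_on S g"
  unfolding locally_lipschitz_on_def lipschitz_on_def by simp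

lemma has_derivative_cong_open:
  assumes "open S" "x \<in> S" "\<And>x. x \<in> S \<Longrightarrow> f x = g x"
  shows "(f has_derivative D) (at x) \<longleftrightarrow> (g has_derivative D) (at x)"
  using has_derivative_transform_within_open[OF _ assms(1,2)] assms(3) by metis

lemma dir_deriv_cong_open:
  assumes "open S" "x \<in> S" "\<And>x. x \<in> S \<Longrightarrow> f x = g x"
  shows "dir_deriv b f x = dir_deriv b g x"
  unfolding dir_deriv_def frechet_derivative_def
  using has_derivative_cong_open[of S x f g, OF assms] by presburger

lemma ck1_on_cong_open:
  assumes "open S"
  shows "(\<And>x. x \<in> S \<Longrightarrow> f x = g x) \<Longrightarrow> ck1_on k S f \<longleftrightarrow> ck1_on k S g"
proof (induction k arbitrary: f g)
  case 0
  then show ?case using locally_lipschitz_on_cong[of S f g] by simp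
next
  case (Suc k)
  have "f differentiable (at x) \<longleftrightarrow> g differentiable (at x)" if "x \<in> S" for x
    using has_derivative_cong_open[of S x f g, OF assms that Suc.prems] by (simp add: differentiable_def)
  moreover have "ck1_on k S (dir_deriv b f) \<longleftrightarrow> ck1_on k S (dir_deriv b g)" for b
    by (rule Suc.IH) (rule dir_deriv_cong_open[OF assms _ Suc.prems])
  ultimately show ?case by auto
qed

lemma frechet_derivative_basis_sum:
  assumes "f differentiable (at x)"
  shows "frechet_derivative f (at x) v = (\<Sum>b\<in>Basis. (v \<bullet> b) *\<^sub>R dir_deriv b f x)"
proof -
  have lin: "linear (frechet_derivative f (at x))"
    using assms frechet_derivative_works has_derivative_linear by blast
  have "frechet_derivative f (at x) v = frechet_derivative f (at x) (\<Sum>b\<in>Basis. (v \<bullet> b) *\<^sub>R b)"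
    by (simp add: euclidean_representation)
  also have "\<dots> = (\<Sum>b\<in>Basis. (v \<bullet> b) *\<^sub>R dir_deriv b f x)"
    by (simp add: linear_sum[OF lin] linear_cmul[OF lin] dir_deriv_def)
  finally show ?thesis .
qed

text \<open>Locally Lipschitz partial derivatives are locally bounded, and near a point there are only
  finitely many of them to bound. By the mean value theorem a bounded derivative on a ball gives a
  Lipschitz constant there.\<close>

lemma locally_lipschitz_on_of_dir_derivs:
  assumes "open S" and diff: "\<And>x. x \<in> S \<Longrightarrow> f differentiable (at x)"
    and lip: "\<And>b. b \<in> Basis \<Longrightarrow> locally_lipschitz_on S (dir_deriv b f)"
  shows "locally_lipschitz_on S f"
  unfolding locally_lipschitz_on_def
proof
  fix x assume x: "x \<in> S"
  have "\<exists>r>0. \<exists>M. \<forall>y\<in>ball x r \<inter> S. norm (dir_deriv b f y) \<le> M" if b: "b \<in> Basis" for b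
  proof -
    obtain r L where r: "r > 0" and L: "L-lipschitz_on (ball x r \<inter> S) (dir_deriv b f)"
      using lip[OF b] x by (auto simp: locally_lipschitz_on_def)
    have "norm (dir_deriv b f y) \<le> norm (dir_deriv b f x) + L * r" if y: "y \<in> ball x r \<inter> S" for y
    proof -
      have "norm (dir_deriv b f y - dir_deriv b f x) \<le> L * norm (y - x)"
        by (rule lipschitz_on_normD[OF L y]) (use x r in auto)
      also have "\<dots> \<le> L * r"
        using y lipschitz_on_nonneg[OF L]
        by (intro mult_left_mono) (auto simp: dist_norm norm_minus_commute)
      finally show ?thesis using norm_triangle_sub[of "dir_deriv b f y" "dir_deriv b f x"] by simp
    qed
    then show ?thesis using r by blast
  qed
  then obtain r M where r: "\<And>b. b \<in> Basis \<Longrightarrow> r b > 0"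
    and M: "\<And>b y. b \<in> Basis \<Longrightarrow> y \<in> ball x (r b) \<inter> S \<Longrightarrow> norm (dir_deriv b f y) \<le> M b"
    by metis
  obtain e where e: "e > 0" "ball x e \<subseteq> S" using assms(1) x open_contains_ball by blast
  define \<rho> where "\<rho> = Min (insert e (r ` Basis))"
  have \<rho>: "\<rho> > 0" using e(1) r by (auto simp: \<rho>_def)
  have \<rho>_le: "\<rho> \<le> e" "\<And>b. b \<in> Basis \<Longrightarrow> \<rho> \<le> r b"
    unfolding \<rho>_def by (intro Min_le; simp)+
  have "(\<Sum>b\<in>Basis. M b)-lipschitz_on (ball x \<rho> \<inter> S) f"
  proof (rule bounded_derivative_imp_lipschitz)
    have sub: "ball x \<rho> \<inter> S = ball x \<rho>" using \<rho>_le(1) e(2) by auto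
    show "convex (ball x \<rho> \<inter> S)" unfolding sub by simp
    have "norm (dir_deriv b f x) \<le> M b" if "b \<in> Basis" for b
      using M[OF that, of x] r[OF that] x by simp
    then have "0 \<le> M b" if "b \<in> Basis" for b using that norm_ge_zero order_trans by blast
    then show "0 \<le> (\<Sum>b\<in>Basis. M b)" by (intro sum_nonneg)
    fix y assume y: "y \<in> ball x \<rho> \<inter> S"
    show "(f has_derivative frechet_derivative f (at y)) (at y within ball x \<rho> \<inter> S)"
      using diff[of y] y frechet_derivative_works has_derivative_at_withinI by blast
    show "onorm (frechet_derivative f (at y)) \<le> (\<Sum>b\<in>Basis. M b)"
    proof (rule onorm_le)
      fix v
      have "norm (frechet_derivative f (at y) v) \<le> (\<Sum>b\<in>Basis. norm ((v \<bullet> b) *\<^sub>R dir_deriv b f y))"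
        unfolding frechet_derivative_basis_sum[OF diff[OF IntD2[OF y]]] by (rule norm_sum)
      also have "\<dots> \<le> (\<Sum>b\<in>Basis. norm v * M b)"
      proof (rule sum_mono)
        fix b :: 'a assume b: "b \<in> Basis"
        have "y \<in> ball x (r b) \<inter> S" using y \<rho>_le(2)[OF b] by auto
        then show "norm ((v \<bullet> b) *\<^sub>R dir_deriv b f y) \<le> norm v * M b"
          using M[OF b] b by (auto intro!: mult_mono simp: Basis_le_norm)
      qed
      finally show "norm (frechet_derivative f (at y) v) \<le> (\<Sum>b\<in>Basis. M b) * norm v"
        by (simp add: sum_distrib_left mult.commute)
    qed
  qed
  then show "\<exists>r>0. \<exists>L. L-lipschitz_on (ball x r \<inter> S) f" using \<rho> by blast
qed

lemma ck1_on_Suc_imp_locally_lipschitz: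
  assumes "open S" "ck1_on (Suc k) S f"
  shows "locally_lipschitz_on S f"
  using assms(2)
proof (induction k arbitrary: f)
  case 0
  show ?case by (rule locally_lipschitz_on_of_dir_derivs[OF assms(1)]) (use 0 in auto)
next
  case (Suc k)
  show ?case
  proof (rule locally_lipschitz_on_of_dir_derivs[OF assms(1)])
    show "f differentiable (at x)" if "x \<in> S" for x using Suc.prems that by simp
    show "locally_lipschitz_on S (dir_deriv b f)" if "b \<in> Basis" for b
      by (rule Suc.IH) (use Suc.prems that in simp)
  qed
qed

lemma locally_lipschitz_onI:
  assumes "\<And>x. x \<in> S \<Longrightarrow> \<exists>r>0. \<exists>L. L-lipschitz_on (ball x r \<inter> S) f"
  shows "locally_lipschitz_on S f"
  using assms by (simp add: locally_lipschitz_on_def)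

lemma lipschitz_imp_locally_lipschitz:
  assumes "L-lipschitz_on S f"
  shows "locally_lipschitz_on S f"
  by (rule locally_lipschitz_onI) (blast intro: lipschitz_on_subset[OF assms] zero_less_one)

lemma locally_lipschitz_on_compose:
  assumes f: "locally_lipschitz_on S f" and g: "locally_lipschitz_on T g" and "f ` S \<subseteq> T"
  shows "locally_lipschitz_on S (\<lambda>x. g (f x))"
proof (rule locally_lipschitz_onI)
  fix x assume x: "x \<in> S"
  obtain r L where r: "r > 0" and L: "L-lipschitz_on (ball x r \<inter> S) f"
    using f x by (auto simp: locally_lipschitz_on_def)
  obtain r' L' where r': "r' > 0" and L': "L'-lipschitz_on (ball (f x) r' \<inter> T) g"
    using g x assms(3) unfolding locally_lipschitz_on_def by blast
  have L0: "L \<ge> 0" by (rule lipschitz_on_nonneg[OF L])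
  define d where "d = min r (r' / (L + 1))"
  have d: "d > 0" using r r' L0 by (simp add: d_def)
  have "f ` (ball x d \<inter> S) \<subseteq> ball (f x) r' \<inter> T"
  proof safe
    fix y assume y: "y \<in> ball x d" "y \<in> S"
    have "dist (f x) (f y) \<le> L * dist x y"
      by (rule lipschitz_onD[OF L]) (use x y r in \<open>auto simp: d_def\<close>)
    also have "\<dots> \<le> (L + 1) * dist x y" by (intro mult_right_mono) auto
    also have "\<dots> < (L + 1) * (r' / (L + 1))"
      using y L0 by (intro mult_strict_left_mono) (auto simp: d_def)
    finally show "f y \<in> ball (f x) r'" using L0 by simp
    show "f y \<in> T" using y assms(3) by blast
  qed
  then have "(L' * L)-lipschitz_on (ball x d \<inter> S) (\<lambda>x. g (f x))"
    by (intro lipschitz_on_compose2[OF lipschitz_on_subset[OF L]] lipschitz_on_subset[OF L'])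
      (auto simp: d_def)
  then show "\<exists>r>0. \<exists>L. L-lipschitz_on (ball x r \<inter> S) (\<lambda>x. g (f x))" using d by blast
qed

lemma locally_lipschitz_on_Pair:
  assumes f: "locally_lipschitz_on S f" and g: "locally_lipschitz_on S g"
  shows "locally_lipschitz_on S (\<lambda>x. (f x, g x))"
proof (rule locally_lipschitz_onI)
  fix x assume x: "x \<in> S"
  obtain r L where r: "r > 0" and L: "L-lipschitz_on (ball x r \<inter> S) f"
    using f x by (auto simp: locally_lipschitz_on_def)
  obtain r' L' where r': "r' > 0" and L': "L'-lipschitz_on (ball x r' \<inter> S) g"
    using g x by (auto simp: locally_lipschitz_on_def)
  have "(sqrt (L\<^sup>2 + L'\<^sup>2))-lipschitz_on (ball x (min r r') \<inter> S) (\<lambda>x. (f x, g x))"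
    by (intro lipschitz_on_Pair lipschitz_on_subset[OF L] lipschitz_on_subset[OF L']) auto
  then show "\<exists>r>0. \<exists>L. L-lipschitz_on (ball x r \<inter> S) (\<lambda>x. (f x, g x))"
    using r r' by (meson min_less_iff_conj)
qed

lemma locally_lipschitz_on_bounded_linear:
  assumes "bounded_linear g" "locally_lipschitz_on S f"
  shows "locally_lipschitz_on S (\<lambda>x. g (f x))"
proof -
  obtain B where B: "B-lipschitz_on UNIV g" by (rule bounded_linear.lipschitz_boundE[OF assms(1)])
  then show ?thesis
    using locally_lipschitz_on_compose[OF assms(2) lipschitz_imp_locally_lipschitz[OF B]] by auto
qed

lemma locally_lipschitz_on_add:
  fixes f g :: "'a::metric_space \<Rightarrow> 'b::real_normed_vector"
  assumes f: "locally_lipschitz_on S f" and g: "locally_lipschitz_on S g"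
  shows "locally_lipschitz_on S (\<lambda>x. f x + g x)"
  using locally_lipschitz_on_bounded_linear[OF bounded_linear_add[OF bounded_linear_fst bounded_linear_snd]
      locally_lipschitz_on_Pair[OF f g]] by simp

text \<open>Multiplication is not globally Lipschitz; its Lipschitz constant on a ball grows with the distance to
  the origin. Together with sums, pairs and compositions this covers the action of a Jacobian
  on a vector.\<close>

lemma locally_lipschitz_on_scaleR_pair:
  "locally_lipschitz_on UNIV (\<lambda>(a, v). a *\<^sub>R v :: 'a::real_normed_vector)"
proof (rule locally_lipschitz_onI)
  fix x :: "real \<times> 'a"
  have "(norm x + 1 + (norm x + 1))-lipschitz_on (ball x 1 \<inter> UNIV) (\<lambda>(a, v). a *\<^sub>R v)"
  proof (rule lipschitz_onI)
    fix p q assume pq: "p \<in> ball x 1 \<inter> UNIV" "q \<in> ball x 1 \<inter> UNIV"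
    have le: "norm p \<le> norm x + 1" if "p \<in> ball x 1" for p
      using that norm_triangle_sub[of p x] by (auto simp: dist_norm norm_minus_commute)
    obtain a u b v where [simp]: "p = (a, u)" "q = (b, v)" by (cases p, cases q)
    have 1: "\<bar>a\<bar> \<le> norm x + 1" using le[of p] pq norm_fst_le[of a u] by auto
    have 2: "norm v \<le> norm x + 1" using le[of q] pq norm_snd_le[of v b] by auto
    have 3: "\<bar>a - b\<bar> \<le> dist p q" using dist_fst_le[of p q] by (simp add: dist_real_def)
    have 4: "norm (u - v) \<le> dist p q" using dist_snd_le[of p q] by (simp add: dist_norm)
    have "a *\<^sub>R u - b *\<^sub>R v = a *\<^sub>R (u - v) + (a - b) *\<^sub>R v" by (simp add: algebra_simps)
    also have "norm \<dots> \<le> \<bar>a\<bar> * norm (u - v) + \<bar>a - b\<bar> * norm v"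
      by (metis norm_triangle_ineq norm_scaleR)
    also have "\<dots> \<le> (norm x + 1) * dist p q + dist p q * (norm x + 1)"
      using 1 2 3 4 by (intro add_mono mult_mono) auto
    finally show "dist (case p of (a, v) \<Rightarrow> a *\<^sub>R v) (case q of (a, v) \<Rightarrow> a *\<^sub>R v)
        \<le> (norm x + 1 + (norm x + 1)) * dist p q"
      by (simp add: dist_norm algebra_simps)
  qed simp
  then show "\<exists>r>0. \<exists>L. L-lipschitz_on (ball x r \<inter> UNIV) (\<lambda>(a, v). a *\<^sub>R v)"
    using zero_less_one by blast
qed

lemma locally_lipschitz_on_scaleR:
  fixes g :: "'a::metric_space \<Rightarrow> 'b::real_normed_vector"
  assumes f: "locally_lipschitz_on S f" and g: "locally_lipschitz_on S g"
  shows "locally_lipschitz_on S (\<lambda>x. f x *\<^sub>R g x)"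
  using locally_lipschitz_on_compose[OF locally_lipschitz_on_Pair[OF f g] locally_lipschitz_on_scaleR_pair]
  by simp

lemma locally_lipschitz_on_const: "locally_lipschitz_on S (\<lambda>_. c)"
  by (rule lipschitz_imp_locally_lipschitz[OF lipschitz_on_constant])

lemma locally_lipschitz_on_ident: "locally_lipschitz_on S (\<lambda>x. x)"
  by (rule lipschitz_imp_locally_lipschitz[OF lipschitz_on_id])

lemma locally_lipschitz_on_sum:
  fixes f :: "'i \<Rightarrow> 'a::metric_space \<Rightarrow> 'b::real_normed_vector"
  assumes "\<And>i. i \<in> I \<Longrightarrow> locally_lipschitz_on S (f i)"
  shows "locally_lipschitz_on S (\<lambda>x. \<Sum>i\<in>I. f i x)"
  using assms
  by (induction I rule: infinite_finite_induct)
    (auto intro!: locally_lipschitz_on_add locally_lipschitz_on_const)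

lemma locally_lipschitz_on_continuous:
  assumes "locally_lipschitz_on S f"
  shows "continuous_on S f"
  unfolding continuous_on_eq_continuous_within
proof
  fix x assume x: "x \<in> S"
  then obtain r L where r: "r > 0" and L: "L-lipschitz_on (ball x r \<inter> S) f"
    using assms by (auto simp: locally_lipschitz_on_def)
  have "continuous (at x within ball x r \<inter> S) f"
    by (rule lipschitz_on_continuous_within[OF L]) (use x r in auto)
  moreover have "at x within ball x r \<inter> S = at x within S"
    by (rule at_within_nhd[where S = "ball x r"]) (use r in auto)
  ultimately show "continuous (at x within S) f" by simp
qed

lemma locally_lipschitz_on_of_continuous_derivative:
  fixes f :: "real \<Rightarrow> 'a::real_normed_vector"
  assumes "open S" and f: "\<And>t. t \<in> S \<Longrightarrow> (f has_vector_derivative f' t) (at t)"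
    and f': "continuous_on S f'"
  shows "locally_lipschitz_on S f"
proof (rule locally_lipschitz_onI)
  fix t assume t: "t \<in> S"
  obtain e where e: "e > 0" "ball t e \<subseteq> S" using assms(1) t open_contains_ball by blast
  have "isCont f' t" using f' assms(1) t continuous_on_eq_continuous_at by blast
  then obtain d where d: "d > 0" "\<And>s. dist s t < d \<Longrightarrow> dist (f' s) (f' t) < 1"
    unfolding continuous_at_eps_delta by (metis dist_commute zero_less_one)
  define r where "r = min e d"
  have "(norm (f' t) + 1)-lipschitz_on (ball t r \<inter> S) f"
  proof (rule lipschitz_onI)
    fix x y assume xy: "x \<in> ball t r \<inter> S" "y \<in> ball t r \<inter> S"
    have "norm (f x - f y) \<le> (norm (f' t) + 1) * \<bar>x - y\<bar>"
    proof (rule vector_derivative_bound[of "ball t r"])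
      fix s assume s: "s \<in> ball t r"
      show "(f has_vector_derivative f' s) (at s within ball t r)"
        by (rule has_vector_derivative_at_within[OF f]) (use s e(2) in \<open>auto simp: r_def\<close>)
      have "dist (f' s) (f' t) < 1" using d(2) s by (simp add: r_def dist_commute)
      then show "norm (f' s) \<le> norm (f' t) + 1"
        using norm_triangle_sub[of "f' s" "f' t"] by (simp add: dist_norm)
    qed (use xy in auto)
    then show "dist (f x) (f y) \<le> (norm (f' t) + 1) * dist x y"
      by (simp add: dist_norm)
  qed simp
  moreover have "r > 0" using e d by (simp add: r_def)
  ultimately show "\<exists>r>0. \<exists>L. L-lipschitz_on (ball t r \<inter> S) f" by blast
qed

lemma ck1_on_SucI_vector_derivative:
  fixes f :: "real \<Rightarrow> 'a::euclidean_space"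
  assumes "open S" and f: "\<And>t. t \<in> S \<Longrightarrow> (f has_vector_derivative f' t) (at t)" and "ck1_on k S f'"
  shows "ck1_on (Suc k) S f"
proof -
  have d: "dir_deriv 1 f t = f' t" if "t \<in> S" for t
    using frechet_derivative_at[OF f[OF that, unfolded has_vector_derivative_def], symmetric]
    by (simp add: dir_deriv_def)
  have "ck1_on k S (dir_deriv 1 f) \<longleftrightarrow> ck1_on k S f'"
    by (rule ck1_on_cong_open[OF assms(1)]) (rule d)
  then have "ck1_on k S (dir_deriv 1 f)" using assms(3) by blast
  moreover have "f differentiable (at t)" if "t \<in> S" for t
    using f[OF that] unfolding has_vector_derivative_def differentiable_def by blast
  ultimately show ?thesis by simp
qed

section \<open>Maps that are Lipschitz in terms of other maps\<close>

text \<open>The map \<open>F\<close>, read as a function of the coordinates \<open>\<kappa>\<close> on \<open>S\<close>, is Lipschitz near \<open>p\<close>, and points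
  of \<open>S\<close> with coordinates close to those of \<open>p\<close> belong to \<open>D\<close>. The points may be tangent vectors together with
  times, which carry no metric of their own: nearness only enters through coordinates.
  Taking \<open>D\<close> to be the region on which \<open>F\<close> is in turn a system of coordinates makes the
  relation transitive, so that changes of chart and compositions of flows are the same operation.\<close>

definition lipschitz_near ::
  "('p \<Rightarrow> 'a::metric_space) \<Rightarrow> 'p set \<Rightarrow> ('p \<Rightarrow> 'b::metric_space) \<Rightarrow> 'p set \<Rightarrow> 'p \<Rightarrow> bool" where
  "lipschitz_near \<kappa> S F D p \<longleftrightarrow>
     (\<exists>r>0. \<exists>L. \<forall>q\<in>S. dist (\<kappa> q) (\<kappa> p) < r \<longrightarrow> q \<in> D \<and>
        (\<forall>q'\<in>S. dist (\<kappa> q') (\<kappa> p) < r \<longrightarrow> dist (F q) (F q') \<le> L * dist (\<kappa> q) (\<kappa> q')))"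

lemma lipschitz_nearI:
  assumes "r > 0" "\<And>q. q \<in> S \<Longrightarrow> dist (\<kappa> q) (\<kappa> p) < r \<Longrightarrow> q \<in> D"
    and "\<And>q q'. q \<in> S \<Longrightarrow> q' \<in> S \<Longrightarrow> dist (\<kappa> q) (\<kappa> p) < r \<Longrightarrow> dist (\<kappa> q') (\<kappa> p) < r \<Longrightarrow>
           dist (F q) (F q') \<le> L * dist (\<kappa> q) (\<kappa> q')"
  shows "lipschitz_near \<kappa> S F D p"
  using assms unfolding lipschitz_near_def by blast

lemma lipschitz_nearE:
  assumes "lipschitz_near \<kappa> S F D p"
  obtains r L where "r > 0" "L \<ge> 0" "\<And>q. q \<in> S \<Longrightarrow> dist (\<kappa> q) (\<kappa> p) < r \<Longrightarrow> q \<in> D"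
    "\<And>q q'. q \<in> S \<Longrightarrow> q' \<in> S \<Longrightarrow> dist (\<kappa> q) (\<kappa> p) < r \<Longrightarrow> dist (\<kappa> q') (\<kappa> p) < r \<Longrightarrow>
           dist (F q) (F q') \<le> L * dist (\<kappa> q) (\<kappa> q')"
proof -
  obtain r L where r: "r > 0" "\<And>q. q \<in> S \<Longrightarrow> dist (\<kappa> q) (\<kappa> p) < r \<Longrightarrow> q \<in> D"
    "\<And>q q'. q \<in> S \<Longrightarrow> q' \<in> S \<Longrightarrow> dist (\<kappa> q) (\<kappa> p) < r \<Longrightarrow> dist (\<kappa> q') (\<kappa> p) < r \<Longrightarrow>
           dist (F q) (F q') \<le> L * dist (\<kappa> q) (\<kappa> q')"
    using assms unfolding lipschitz_near_def by metis
  show ?thesis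
  proof (rule that[OF r(1) _ r(2), where L = "\<bar>L\<bar>"])
    fix q q' assume "q \<in> S" "q' \<in> S" "dist (\<kappa> q) (\<kappa> p) < r" "dist (\<kappa> q') (\<kappa> p) < r"
    then have "dist (F q) (F q') \<le> L * dist (\<kappa> q) (\<kappa> q')" by (rule r(3))
    also have "\<dots> \<le> \<bar>L\<bar> * dist (\<kappa> q) (\<kappa> q')" by (intro mult_right_mono) auto
    finally show "dist (F q) (F q') \<le> \<bar>L\<bar> * dist (\<kappa> q) (\<kappa> q')" .
  qed auto
qed

lemma lipschitz_near_weaken:
  assumes "lipschitz_near \<kappa> S F D p" "\<And>q. q \<in> S \<Longrightarrow> q \<in> D \<Longrightarrow> q \<in> D'"
  shows "lipschitz_near \<kappa> S F D' p"
  using assms unfolding lipschitz_near_def by meson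

lemma lipschitz_near_trans:
  assumes "lipschitz_near \<kappa> S F D p" "lipschitz_near F D G E p" and p: "p \<in> S"
  shows "lipschitz_near \<kappa> S G E p"
proof -
  obtain r L where r: "r > 0" and L: "L \<ge> 0" and D: "\<And>q. q \<in> S \<Longrightarrow> dist (\<kappa> q) (\<kappa> p) < r \<Longrightarrow> q \<in> D"
    and F: "\<And>q q'. q \<in> S \<Longrightarrow> q' \<in> S \<Longrightarrow> dist (\<kappa> q) (\<kappa> p) < r \<Longrightarrow> dist (\<kappa> q') (\<kappa> p) < r \<Longrightarrow>
           dist (F q) (F q') \<le> L * dist (\<kappa> q) (\<kappa> q')"
    using assms(1) by (rule lipschitz_nearE) blast
  obtain r' L' where r': "r' > 0" and L': "L' \<ge> 0" and E: "\<And>q. q \<in> D \<Longrightarrow> dist (F q) (F p) < r' \<Longrightarrow> q \<in> E"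
    and G: "\<And>q q'. q \<in> D \<Longrightarrow> q' \<in> D \<Longrightarrow> dist (F q) (F p) < r' \<Longrightarrow> dist (F q') (F p) < r' \<Longrightarrow>
           dist (G q) (G q') \<le> L' * dist (F q) (F q')"
    using assms(2) by (rule lipschitz_nearE) blast
  define d where "d = min r (r' / (L + 1))"
  have Fp: "dist (F q) (F p) < r'" if q: "q \<in> S" "dist (\<kappa> q) (\<kappa> p) < d" for q
  proof -
    have "dist (F q) (F p) \<le> L * dist (\<kappa> q) (\<kappa> p)"
      by (rule F) (use q p r in \<open>auto simp: d_def\<close>)
    also have "\<dots> \<le> (L + 1) * dist (\<kappa> q) (\<kappa> p)" by (intro mult_right_mono) auto
    also have "\<dots> < (L + 1) * (r' / (L + 1))"
      using q L by (intro mult_strict_left_mono) (auto simp: d_def)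
    finally show ?thesis using L by simp
  qed
  show ?thesis
  proof (rule lipschitz_nearI[where r = d and L = "L' * L"])
    show "d > 0" using r r' L by (simp add: d_def)
    show "q \<in> E" if "q \<in> S" "dist (\<kappa> q) (\<kappa> p) < d" for q
      using E[OF D Fp] that by (simp add: d_def)
    fix q q' assume q: "q \<in> S" "q' \<in> S" "dist (\<kappa> q) (\<kappa> p) < d" "dist (\<kappa> q') (\<kappa> p) < d"
    have "dist (G q) (G q') \<le> L' * dist (F q) (F q')"
      by (rule G[OF D D Fp Fp]) (use q in \<open>auto simp: d_def\<close>)
    also have "\<dots> \<le> L' * (L * dist (\<kappa> q) (\<kappa> q'))"
      by (intro mult_left_mono F L') (use q in \<open>auto simp: d_def\<close>)
    finally show "dist (G q) (G q') \<le> L' * L * dist (\<kappa> q) (\<kappa> q')" by (simp add: mult.assoc)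
  qed
qed

text \<open>A parameter \<open>a\<close> may be added to the coordinates on both sides. This is how the time is
  carried along when only the tangent vector is changed.\<close>

lemma lipschitz_near_Pair:
  assumes "lipschitz_near \<kappa> S F D p"
  shows "lipschitz_near (\<lambda>q. (a q, \<kappa> q)) S (\<lambda>q. (a q, F q)) D p"
proof -
  obtain r L where r: "r > 0" and L: "L \<ge> 0" and D: "\<And>q. q \<in> S \<Longrightarrow> dist (\<kappa> q) (\<kappa> p) < r \<Longrightarrow> q \<in> D"
    and F: "\<And>q q'. q \<in> S \<Longrightarrow> q' \<in> S \<Longrightarrow> dist (\<kappa> q) (\<kappa> p) < r \<Longrightarrow> dist (\<kappa> q') (\<kappa> p) < r \<Longrightarrow>
           dist (F q) (F q') \<le> L * dist (\<kappa> q) (\<kappa> q')"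
    using assms(1) by (rule lipschitz_nearE) blast
  have le: "dist (\<kappa> q) (\<kappa> q') \<le> dist (a q, \<kappa> q) (a q', \<kappa> q')" for q q'
    using dist_snd_le[of "(a q, \<kappa> q)" "(a q', \<kappa> q')"] by simp
  show ?thesis
  proof (rule lipschitz_nearI[OF r, where L = "1 + L"])
    show "q \<in> D" if "q \<in> S" "dist (a q, \<kappa> q) (a p, \<kappa> p) < r" for q
      using D le[of q p] that by force
    fix q q' assume q: "q \<in> S" "q' \<in> S" "dist (a q, \<kappa> q) (a p, \<kappa> p) < r" "dist (a q', \<kappa> q') (a p, \<kappa> p) < r"
    have "dist (a q, F q) (a q', F q') \<le> dist (a q) (a q') + dist (F q) (F q')"
      unfolding dist_Pair_Pair by (rule sqrt_sum_squares_le_sum) auto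
    also have "dist (F q) (F q') \<le> L * dist (\<kappa> q) (\<kappa> q')"
      by (rule F) (use q le[of q p] le[of q' p] in auto)
    also have "\<dots> \<le> L * dist (a q, \<kappa> q) (a q', \<kappa> q')" by (intro mult_left_mono le L)
    also have "dist (a q) (a q') \<le> dist (a q, \<kappa> q) (a q', \<kappa> q')"
      using dist_fst_le[of "(a q, \<kappa> q)" "(a q', \<kappa> q')"] by simp
    finally show "dist (a q, F q) (a q', F q') \<le> (1 + L) * dist (a q, \<kappa> q) (a q', \<kappa> q')"
      by (simp add: algebra_simps)
  qed
qed

lemma lipschitz_near_pullback:
  assumes "lipschitz_near \<kappa> S F D (g p)" and "\<And>q. q \<in> S' \<Longrightarrow> g q \<in> S"
    and le: "\<And>q q'. dist (\<kappa> (g q)) (\<kappa> (g q')) \<le> dist (\<kappa>' q) (\<kappa>' q')"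
  shows "lipschitz_near \<kappa>' S' (\<lambda>q. F (g q)) {q. g q \<in> D} p"
proof -
  obtain r L where r: "r > 0" and L: "L \<ge> 0" and D: "\<And>q. q \<in> S \<Longrightarrow> dist (\<kappa> q) (\<kappa> (g p)) < r \<Longrightarrow> q \<in> D"
    and F: "\<And>q q'. q \<in> S \<Longrightarrow> q' \<in> S \<Longrightarrow> dist (\<kappa> q) (\<kappa> (g p)) < r \<Longrightarrow> dist (\<kappa> q') (\<kappa> (g p)) < r \<Longrightarrow>
           dist (F q) (F q') \<le> L * dist (\<kappa> q) (\<kappa> q')"
    using assms(1) by (rule lipschitz_nearE) blast
  show ?thesis
  proof (rule lipschitz_nearI[OF r, where L = L])
    show "q \<in> {q. g q \<in> D}" if "q \<in> S'" "dist (\<kappa>' q) (\<kappa>' p) < r" for q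
      using D[OF assms(2), of q] le[of q p] that by simp
    fix q q' assume q: "q \<in> S'" "q' \<in> S'" "dist (\<kappa>' q) (\<kappa>' p) < r" "dist (\<kappa>' q') (\<kappa>' p) < r"
    have "dist (F (g q)) (F (g q')) \<le> L * dist (\<kappa> (g q)) (\<kappa> (g q'))"
      by (rule F) (use assms(2) q le[of q p] le[of q' p] in auto)
    also have "\<dots> \<le> L * dist (\<kappa>' q) (\<kappa>' q')" by (intro mult_left_mono le L)
    finally show "dist (F (g q)) (F (g q')) \<le> L * dist (\<kappa>' q) (\<kappa>' q')" .
  qed
qed

section \<open>Charts, Jacobians and tangent vectors\<close>

lemma sum_Basis_cart: "(\<Sum>b\<in>(Basis :: (real^'n) set). f b) = (\<Sum>i\<in>UNIV. f (axis i 1))"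
proof -
  have B: "(Basis :: (real^'n) set) = range (\<lambda>i. axis i 1)" by (auto simp: Basis_vec_def)
  have "inj (\<lambda>i::'n. axis i (1::real))" by (auto simp: inj_on_def axis_eq_axis)
  from sum.reindex[OF this, of f] show ?thesis unfolding B o_def .
qed

lemma frechet_derivative_axis_sum:
  fixes f :: "real^'n \<Rightarrow> real^'n"
  assumes "f differentiable (at x)"
  shows "frechet_derivative f (at x) v = (\<Sum>i\<in>UNIV. (v $ i) *\<^sub>R dir_deriv (axis i 1) f x)"
  unfolding frechet_derivative_basis_sum[OF assms] sum_Basis_cart by (simp add: inner_axis)

lemma ck1_on_2D:
  assumes "ck1_on 2 S f"
  shows "\<And>x. x \<in> S \<Longrightarrow> f differentiable (at x)"
    and "\<And>b. b \<in> Basis \<Longrightarrow> ck1_on (Suc 0) S (dir_deriv b f)"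
  using assms by (simp_all add: numeral_2_eq_2)

lemma axis_Basis: "axis i (1::real) \<in> Basis"
  by (auto simp: Basis_vec_def)

lemma tangent_map_locally_lipschitz:
  fixes T :: "real^'n \<Rightarrow> real^'n"
  assumes "open U" and T: "ck1_on 2 U T"
  shows "locally_lipschitz_on (U \<times> UNIV) (\<lambda>(x, v). (T x, frechet_derivative T (at x) v))"
proof -
  have fst: "locally_lipschitz_on (U \<times> (UNIV :: (real^'n) set)) fst"
    and snd: "locally_lipschitz_on (U \<times> (UNIV :: (real^'n) set)) snd"
    using locally_lipschitz_on_bounded_linear[OF bounded_linear_fst locally_lipschitz_on_ident]
      locally_lipschitz_on_bounded_linear[OF bounded_linear_snd locally_lipschitz_on_ident] by auto
  have 1: "locally_lipschitz_on (U \<times> (UNIV :: (real^'n) set)) (\<lambda>p. g (fst p))"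
    if "locally_lipschitz_on U g" for g :: "real^'n \<Rightarrow> real^'n"
    by (rule locally_lipschitz_on_compose[OF fst that]) auto
  have "locally_lipschitz_on U T"
    using ck1_on_Suc_imp_locally_lipschitz[OF assms(1), of 1 T] T by (simp add: numeral_2_eq_2)
  then have T1: "locally_lipschitz_on (U \<times> (UNIV :: (real^'n) set)) (\<lambda>p. T (fst p))" by (rule 1)
  have "locally_lipschitz_on U (dir_deriv (axis i 1) T)" for i
    by (rule ck1_on_Suc_imp_locally_lipschitz[OF assms(1) ck1_on_2D(2)[OF T axis_Basis]])
  then have d: "locally_lipschitz_on (U \<times> (UNIV :: (real^'n) set)) (\<lambda>p. dir_deriv (axis i 1) T (fst p))" for i
    by (rule 1)
  have v: "locally_lipschitz_on (U \<times> (UNIV :: (real^'n) set)) (\<lambda>p. snd p $ i)" for i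
    by (rule locally_lipschitz_on_bounded_linear[OF bounded_linear_vec_nth snd])
  have "locally_lipschitz_on (U \<times> (UNIV :: (real^'n) set))
      (\<lambda>p. \<Sum>i\<in>UNIV. (snd p $ i) *\<^sub>R dir_deriv (axis i 1) T (fst p))"
    by (rule locally_lipschitz_on_sum) (rule locally_lipschitz_on_scaleR[OF v d])
  then have "locally_lipschitz_on (U \<times> (UNIV :: (real^'n) set))
      (\<lambda>p. (T (fst p), \<Sum>i\<in>UNIV. (snd p $ i) *\<^sub>R dir_deriv (axis i 1) T (fst p)))"
    by (rule locally_lipschitz_on_Pair[OF T1])
  then show ?thesis
    by (rule iffD1[OF locally_lipschitz_on_cong, rotated])
      (auto simp: frechet_derivative_axis_sum ck1_on_2D(1)[OF T])
qed

text \<open>The velocity in the new coordinates is \<open>\<Sum>\<^sub>i v\<^sup>i \<partial>\<^sub>i T(x)\<close>. Differentiating this sum by the product rule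
  produces the quadratic second derivative term of the transformation law of a spray.\<close>

lemma tangent_map_derivatives_along_curve:
  fixes T :: "real^'n \<Rightarrow> real^'n" and x v :: "real \<Rightarrow> real^'n"
  assumes "open U" and T: "ck1_on 2 U T"
    and x: "(x has_vector_derivative v t) (at t within I)"
    and v: "(v has_vector_derivative a) (at t within I)"
    and xU: "x t \<in> U"
  shows "((\<lambda>s. T (x s)) has_vector_derivative frechet_derivative T (at (x t)) (v t)) (at t within I)"
    and "((\<lambda>s. frechet_derivative T (at (x s)) (v s)) has_vector_derivative
           second_deriv_form T (x t) (v t) + frechet_derivative T (at (x t)) a) (at t within I)"
proof -
  have chain: "((\<lambda>s. g (x s)) has_vector_derivative frechet_derivative g (at (x t)) (v t)) (at t within I)"
    if "g differentiable (at (x t))" for g :: "real^'n \<Rightarrow> real^'n"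
  proof -
    have g: "(g has_derivative frechet_derivative g (at (x t))) (at (x t))"
      using that frechet_derivative_works by blast
    have "((\<lambda>s. g (x s)) has_derivative (\<lambda>h. frechet_derivative g (at (x t)) (h *\<^sub>R v t))) (at t within I)"
      using diff_chain_within[of x "\<lambda>h. h *\<^sub>R v t" t I g "frechet_derivative g (at (x t))"]
        x g has_derivative_at_withinI unfolding has_vector_derivative_def o_def by blast
    then show ?thesis
      unfolding has_vector_derivative_def linear_cmul[OF has_derivative_linear[OF g]] .
  qed
  show "((\<lambda>s. T (x s)) has_vector_derivative frechet_derivative T (at (x t)) (v t)) (at t within I)"
    by (rule chain[OF ck1_on_2D(1)[OF T xU]])
  let ?d = "\<lambda>i. dir_deriv (axis i 1) T"
  have d: "?d i differentiable (at (x t))" for i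
    using ck1_on_2D(2)[OF T axis_Basis, of i] xU by simp
  have sum': "((\<lambda>s. \<Sum>i\<in>UNIV. (v s $ i) *\<^sub>R ?d i (x s)) has_vector_derivative
      (\<Sum>i\<in>UNIV. (v t $ i) *\<^sub>R frechet_derivative (?d i) (at (x t)) (v t) + (a $ i) *\<^sub>R ?d i (x t)))
      (at t within I)"
    by (rule has_vector_derivative_sum)
      (rule bounded_bilinear.has_vector_derivative[OF bounded_bilinear_scaleR
          bounded_linear.has_vector_derivative[OF bounded_linear_vec_nth v] chain[OF d]])
  have eq: "(\<Sum>i\<in>UNIV. (v t $ i) *\<^sub>R frechet_derivative (?d i) (at (x t)) (v t) + (a $ i) *\<^sub>R ?d i (x t)) =
      second_deriv_form T (x t) (v t) + frechet_derivative T (at (x t)) a"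
  proof -
    have "(\<Sum>i\<in>UNIV. (v t $ i) *\<^sub>R frechet_derivative (?d i) (at (x t)) (v t)) =
        (\<Sum>i\<in>UNIV. \<Sum>j\<in>UNIV. (v t $ j * v t $ i) *\<^sub>R dir_deriv (axis j 1) (?d i) (x t))"
      by (simp add: frechet_derivative_axis_sum[OF d] scaleR_sum_right mult.commute)
    also have "\<dots> = second_deriv_form T (x t) (v t)"
      unfolding second_deriv_form_def by (rule sum.swap)
    finally show ?thesis
      by (simp add: sum.distrib frechet_derivative_axis_sum[OF ck1_on_2D(1)[OF T xU]])
  qed
  have ev: "\<forall>\<^sub>F s in nhds t. s \<in> I \<longrightarrow>
      frechet_derivative T (at (x s)) (v s) = (\<Sum>i\<in>UNIV. (v s $ i) *\<^sub>R ?d i (x s))"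
  proof -
    have "(x \<longlongrightarrow> x t) (at t within I)"
      using has_vector_derivative_continuous[OF x] by (simp add: continuous_within)
    then have "\<forall>\<^sub>F s in at t within I. x s \<in> U"
      using assms(1) xU by (rule topological_tendstoD)
    then have "\<forall>\<^sub>F s in nhds t. s \<in> I \<longrightarrow> x s \<in> U"
      unfolding eventually_at_filter by eventually_elim (use xU in auto)
    then show ?thesis
      by eventually_elim (auto simp: frechet_derivative_axis_sum ck1_on_2D(1)[OF T])
  qed
  show "((\<lambda>s. frechet_derivative T (at (x s)) (v s)) has_vector_derivative
           second_deriv_form T (x t) (v t) + frechet_derivative T (at (x t)) a) (at t within I)"
    using has_vector_derivative_cong_ev[OF ev] sum'[unfolded eq]
    by (simp add: frechet_derivative_axis_sum[OF ck1_on_2D(1)[OF T xU]])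
qed

locale atlas =
  fixes A :: "('m::t2_space, 'n::finite) chart set"
  assumes atlas: "c21_structure A"
begin

lemma chart_homeomorphism:
  assumes "c \<in> A"
  shows "open (cdom c)" "open (cmap c ` cdom c)"
    "homeomorphism (cdom c) (cmap c ` cdom c) (cmap c) (inv_into (cdom c) (cmap c))"
proof -
  have "is_chart c" using atlas assms unfolding c21_structure_def by blast
  then show "open (cdom c)" "open (cmap c ` cdom c)"
    "homeomorphism (cdom c) (cmap c ` cdom c) (cmap c) (inv_into (cdom c) (cmap c))"
    unfolding is_chart_def by blast+
qed

lemma chart_at:
  obtains c where "c \<in> A" "p \<in> cdom c"
  using atlas unfolding c21_structure_def by blast

lemma inv_chart [simp]:
  assumes "c \<in> A" "p \<in> cdom c"
  shows "inv_into (cdom c) (cmap c) (cmap c p) = p"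
  using homeomorphism_apply1[OF chart_homeomorphism(3)] assms by blast

lemma open_chart_image:
  assumes "c \<in> A" "open U" "U \<subseteq> cdom c"
  shows "open (cmap c ` U)"
proof -
  have "openin (top_of_set (cdom c)) U" using assms by (simp add: open_subset)
  then have "openin (top_of_set (cmap c ` cdom c)) (cmap c ` U)"
    by (rule homeomorphism_imp_open_map[OF chart_homeomorphism(3)[OF assms(1)]])
  then show ?thesis using chart_homeomorphism(2)[OF assms(1)] openin_open_trans by blast
qed

lemma open_overlap:
  assumes "c \<in> A" "d \<in> A"
  shows "open (cmap c ` (cdom c \<inter> cdom d))"
  by (rule open_chart_image[OF assms(1)]) (auto intro!: open_Int chart_homeomorphism(1) assms)

lemma transition_cmap [simp]:
  assumes "c \<in> A" "p \<in> cdom c"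
  shows "transition c d (cmap c p) = cmap d p"
  using assms by (simp add: transition_def)

lemma transition_c21:
  assumes "c \<in> A" "d \<in> A"
  shows "ck1_on 2 (cmap c ` (cdom c \<inter> cdom d)) (transition c d)"
  using atlas assms unfolding c21_structure_def c21_compatible_def by blast

definition jacobian where
  "jacobian c d p = frechet_derivative (transition c d) (at (cmap c p))"

lemma transition_has_derivative:
  assumes "c \<in> A" "d \<in> A" "p \<in> cdom c" "p \<in> cdom d"
  shows "(transition c d has_derivative jacobian c d p) (at (cmap c p))"
  unfolding jacobian_def frechet_derivative_works[symmetric]
  using ck1_on_2D(1)[OF transition_c21[OF assms(1,2)]] assms by blast

text \<open>The chain rule for \<open>transition d e \<circ> transition c d\<close>, which agrees with \<open>transition c e\<close> near the
  point. It makes the components of \<open>tangent_of\<close> below consistent.\<close>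

lemma jacobian_compose:
  assumes A: "c \<in> A" "d \<in> A" "e \<in> A" and p: "p \<in> cdom c" "p \<in> cdom d" "p \<in> cdom e"
  shows "jacobian c e p = jacobian d e p \<circ> jacobian c d p"
proof -
  let ?U = "cmap c ` (cdom c \<inter> cdom d \<inter> cdom e)"
  have "open ?U"
    by (rule open_chart_image[OF A(1)]) (auto intro!: open_Int chart_homeomorphism(1) A)
  moreover have "cmap c p \<in> ?U" using p by blast
  moreover have "(transition d e \<circ> transition c d) x = transition c e x" if "x \<in> ?U" for x
    using that A by auto
  moreover have "(transition d e \<circ> transition c d has_derivative jacobian d e p \<circ> jacobian c d p) (at (cmap c p))"
    by (rule diff_chain_at[OF transition_has_derivative]) (use transition_has_derivative[of d e p] A p in auto)
  ultimately have "(transition c e has_derivative jacobian d e p \<circ> jacobian c d p) (at (cmap c p))"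
    using has_derivative_transform_within_open by blast
  then show ?thesis
    using transition_has_derivative[of c e p] A p has_derivative_unique by blast
qed

lemma jacobian_self:
  assumes "c \<in> A" "p \<in> cdom c"
  shows "jacobian c c p = id"
proof -
  have "(transition c c has_derivative id) (at (cmap c p))"
    by (rule has_derivative_transform_within_open[OF has_derivative_id chart_homeomorphism(2)[OF assms(1)]])
      (use assms in auto)
  then show ?thesis using transition_has_derivative[of c c p] assms has_derivative_unique by blast
qed

definition tangents_over where
  "tangents_over c = {\<xi> \<in> tangent_bundle A. base \<xi> \<in> cdom c}"

lemma vcomp_change:
  assumes "\<xi> \<in> tangent_bundle A" "c \<in> A" "d \<in> A" "base \<xi> \<in> cdom c" "base \<xi> \<in> cdom d"
  shows "vcomp \<xi> d = jacobian c d (base \<xi>) (vcomp \<xi> c)"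
  using assms unfolding tangent_bundle_def jacobian_def by blast

lemma vcomp_eq_0:
  assumes "\<xi> \<in> tangent_bundle A" "\<not> (c \<in> A \<and> base \<xi> \<in> cdom c)"
  shows "vcomp \<xi> c = 0"
  using assms unfolding tangent_bundle_def by blast

lemma tangent_eqI:
  assumes "\<xi> \<in> tangents_over c" "\<eta> \<in> tangents_over c" "c \<in> A" "tchart c \<xi> = tchart c \<eta>"
  shows "\<xi> = \<eta>"
proof (rule prod_eqI)
  have \<xi>: "\<xi> \<in> tangent_bundle A" "base \<xi> \<in> cdom c" and \<eta>: "\<eta> \<in> tangent_bundle A" "base \<eta> \<in> cdom c"
    using assms by (auto simp: tangents_over_def)
  show b: "base \<xi> = base \<eta>"
  proof -
    have "cmap c (base \<xi>) = cmap c (base \<eta>)" using assms(4) by (simp add: tchart_def)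
    then show ?thesis using inv_chart[OF assms(3) \<xi>(2)] inv_chart[OF assms(3) \<eta>(2)] by metis
  qed
  show "vcomp \<xi> = vcomp \<eta>"
  proof
    fix d
    show "vcomp \<xi> d = vcomp \<eta> d"
    proof (cases "d \<in> A \<and> base \<xi> \<in> cdom d")
      case True
      have "vcomp \<xi> c = vcomp \<eta> c" using assms(4) by (simp add: tchart_def)
      moreover have "vcomp \<xi> d = jacobian c d (base \<xi>) (vcomp \<xi> c)"
        by (rule vcomp_change[OF \<xi>(1) assms(3)]) (use True \<xi> in auto)
      moreover have "vcomp \<eta> d = jacobian c d (base \<eta>) (vcomp \<eta> c)"
        by (rule vcomp_change[OF \<eta>(1) assms(3)]) (use True b \<eta> in auto)
      ultimately show ?thesis unfolding b by metis
    next
      case False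
      then show ?thesis using vcomp_eq_0[OF \<xi>(1)] vcomp_eq_0[OF \<eta>(1)] b by metis
    qed
  qed
qed

text \<open>The inverse of the chart \<open>tchart c\<close> of the tangent bundle: the components in the other charts
  around the point are obtained with the Jacobians.\<close>

definition tangent_of where
  "tangent_of c y = (let p = inv_into (cdom c) (cmap c) (fst y) in
     (p, \<lambda>d. if d \<in> A \<and> p \<in> cdom d then jacobian c d p (snd y) else 0))"

lemma tangent_of:
  assumes "c \<in> A" "fst y \<in> cmap c ` cdom c"
  shows "tangent_of c y \<in> tangents_over c" "tchart c (tangent_of c y) = y"
proof -
  obtain p where p: "p \<in> cdom c" "fst y = cmap c p" using assms(2) by auto
  have eq: "tangent_of c y = (p, \<lambda>d. if d \<in> A \<and> p \<in> cdom d then jacobian c d p (snd y) else 0)"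
    using p assms(1) by (simp add: tangent_of_def)
  show "tangent_of c y \<in> tangents_over c"
  proof -
    have "jacobian d e p (jacobian c d p (snd y)) = jacobian c e p (snd y)"
      if "d \<in> A" "e \<in> A" "p \<in> cdom d" "p \<in> cdom e" for d e
      using fun_cong[OF jacobian_compose[OF assms(1) that(1,2) p(1) that(3,4)], of "snd y"] by simp
    with p(1) show ?thesis
      unfolding tangents_over_def tangent_bundle_def eq jacobian_def[symmetric] by simp
  qed
  show "tchart c (tangent_of c y) = y"
    using p assms(1) by (simp add: eq tchart_def jacobian_self prod_eq_iff)
qed

lemma tangent_of_tchart:
  assumes "c \<in> A" "\<xi> \<in> tangents_over c"
  shows "tangent_of c (tchart c \<xi>) = \<xi>"
proof -
  have "fst (tchart c \<xi>) \<in> cmap c ` cdom c" using assms(2) by (auto simp: tangents_over_def tchart_def)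
  from tangent_of[OF assms(1) this] show ?thesis by (intro tangent_eqI[OF _ assms(2,1)])
qed

lemma tchart_change:
  assumes "c \<in> A" "d \<in> A" "\<xi> \<in> tangents_over c" "base \<xi> \<in> cdom d"
  shows "tchart d \<xi> = (\<lambda>(x, v). (transition c d x, frechet_derivative (transition c d) (at x) v)) (tchart c \<xi>)"
proof -
  have \<xi>: "\<xi> \<in> tangent_bundle A" "base \<xi> \<in> cdom c" using assms(3) by (auto simp: tangents_over_def)
  show ?thesis
    using vcomp_change[OF \<xi>(1) assms(1,2) \<xi>(2) assms(4)] transition_cmap[OF assms(1) \<xi>(2)]
    by (simp add: tchart_def jacobian_def)
qed

text \<open>Near \<open>\<xi>\<close> the chart \<open>tchart d\<close> is a function of the chart \<open>tchart c\<close>, and this function is Lipschitz because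
  it only involves first derivatives of a change of chart of class \<open>C\<^sup>2\<^sup>,\<^sup>1\<close>.\<close>

lemma lipschitz_near_chart_change:
  assumes "c \<in> A" "d \<in> A" "\<xi> \<in> tangents_over c" "base \<xi> \<in> cdom d"
  shows "lipschitz_near (tchart c) (tangents_over c) (tchart d) (tangents_over d) \<xi>"
proof -
  let ?U = "cmap c ` (cdom c \<inter> cdom d)"
  let ?\<tau> = "\<lambda>(x, v). (transition c d x, frechet_derivative (transition c d) (at x) v)"
  have in_U: "tchart c \<eta> \<in> ?U \<times> UNIV \<longleftrightarrow> base \<eta> \<in> cdom d" if "\<eta> \<in> tangents_over c" for \<eta>
  proof
    have c: "base \<eta> \<in> cdom c" using that by (simp add: tangents_over_def)
    show "base \<eta> \<in> cdom d" if in_U: "tchart c \<eta> \<in> ?U \<times> UNIV"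
    proof -
      obtain p where p: "p \<in> cdom c" "p \<in> cdom d" "cmap c (base \<eta>) = cmap c p"
        using in_U by (auto simp: tchart_def)
      then have "base \<eta> = p" using inv_chart[OF assms(1) c] inv_chart[OF assms(1) p(1)] by metis
      with p(2) show ?thesis by blast
    qed
    show "tchart c \<eta> \<in> ?U \<times> UNIV" if "base \<eta> \<in> cdom d"
      using c that by (simp add: tchart_def)
  qed
  have \<xi>: "tchart c \<xi> \<in> ?U \<times> UNIV" using in_U assms by blast
  obtain r L where r: "r > 0" and L: "L-lipschitz_on (ball (tchart c \<xi>) r \<inter> ?U \<times> UNIV) ?\<tau>"
    using bspec[OF tangent_map_locally_lipschitz[OF open_overlap[OF assms(1,2)] transition_c21[OF assms(1,2)],
        unfolded locally_lipschitz_on_def] \<xi>]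
    by (elim exE conjE) (rule that)
  have "open (?U \<times> (UNIV :: (real^'n) set))" by (intro open_Times open_overlap assms) auto
  from openE[OF this \<xi>] obtain e where e: "e > 0" "ball (tchart c \<xi>) e \<subseteq> ?U \<times> UNIV" .
  have near: "tchart c \<eta> \<in> ball (tchart c \<xi>) r \<inter> ?U \<times> UNIV" "base \<eta> \<in> cdom d"
    if "\<eta> \<in> tangents_over c" "dist (tchart c \<eta>) (tchart c \<xi>) < min e r" for \<eta>
  proof -
    have "tchart c \<eta> \<in> ball (tchart c \<xi>) e" "tchart c \<eta> \<in> ball (tchart c \<xi>) r"
      unfolding mem_ball using less_le_trans[OF that(2)] by (metis dist_commute min.cobounded1 min.cobounded2)+
    then show *: "tchart c \<eta> \<in> ball (tchart c \<xi>) r \<inter> ?U \<times> UNIV"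
      using subsetD[OF e(2)] by (metis IntI)
    show "base \<eta> \<in> cdom d" using iffD1[OF in_U[OF that(1)] IntD2[OF *]] .
  qed
  show ?thesis
  proof (rule lipschitz_nearI[where r = "min e r" and L = L])
    show "min e r > 0" using e r by simp
    show "\<eta> \<in> tangents_over d" if "\<eta> \<in> tangents_over c" "dist (tchart c \<eta>) (tchart c \<xi>) < min e r" for \<eta>
      using near(2)[OF that] that(1) unfolding tangents_over_def by blast
    fix \<eta> \<zeta> assume *: "\<eta> \<in> tangents_over c" "\<zeta> \<in> tangents_over c"
      "dist (tchart c \<eta>) (tchart c \<xi>) < min e r" "dist (tchart c \<zeta>) (tchart c \<xi>) < min e r"
    show "dist (tchart d \<eta>) (tchart d \<zeta>) \<le> L * dist (tchart c \<eta>) (tchart c \<zeta>)"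
      unfolding tchart_change[OF assms(1,2) *(1) near(2)[OF *(1,3)]]
        tchart_change[OF assms(1,2) *(2) near(2)[OF *(2,4)]]
      by (rule lipschitz_onD[OF L near(1)[OF *(1,3)] near(1)[OF *(2,4)]])
  qed
qed

end

section \<open>Solutions on intervals, gluing and uniqueness\<close>

lemma ball_Times_subset_ball: "ball a (e / 2) \<times> ball b (e / 2) \<subseteq> ball (a, b) e"
proof safe
  fix x y assume "x \<in> ball a (e / 2)" "y \<in> ball b (e / 2)"
  moreover have "dist (a, b) (x, y) \<le> dist a x + dist b y"
    unfolding dist_Pair_Pair by (rule sqrt_sum_squares_le_sum) auto
  ultimately show "(x, y) \<in> ball (a, b) e" unfolding mem_ball by linarith
qed

locale spray_atlas = atlas A for A :: "('m::t2_space, 'n::finite) chart set" +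
  fixes H :: "('m, 'n) spray"
  assumes spray: "lipschitz_spray A H"
begin

lemma spray_lipschitz:
  assumes "c \<in> A"
  shows "locally_lipschitz_on (UNIV \<times> (cmap c ` cdom c) \<times> UNIV) (\<lambda>(t, x, v). H c t x v)"
  using spray assms unfolding lipschitz_spray_def by blast

lemma spray_homogeneous:
  assumes "c \<in> A" "x \<in> cmap c ` cdom c" "s > 0"
  shows "H c t x (s *\<^sub>R v) = s\<^sup>2 *\<^sub>R H c t x v"
  using spray assms unfolding lipschitz_spray_def by blast

lemma spray_transform:
  assumes "c \<in> A" "d \<in> A" "x \<in> cmap c ` (cdom c \<inter> cdom d)"
  shows "H d t (transition c d x) (frechet_derivative (transition c d) (at x) v) =
    second_deriv_form (transition c d) x v + frechet_derivative (transition c d) (at x) (H c t x v)"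
  using spray assms unfolding lipschitz_spray_def by blast

text \<open>Homogeneity only concerns positive factors, but the factor \<open>2\<close> leaves \<open>0\<close> in place and
  multiplies the value by \<open>4\<close>. Hence constant curves are solutions.\<close>

lemma spray_zero:
  assumes "c \<in> A" "x \<in> cmap c ` cdom c"
  shows "H c t x 0 = 0"
proof -
  have "H c t x 0 = 4 *\<^sub>R H c t x 0"
    using spray_homogeneous[OF assms, of 2 t 0] by simp
  then have "3 *\<^sub>R H c t x 0 = 0" by (simp add: algebra_simps scaleR_left_distrib[of 1 3, simplified])
  then show ?thesis by simp
qed

text \<open>The right-hand side of the first order system in the coordinates \<open>y = (x, v)\<close>.\<close>

definition phase_field where
  "phase_field c t y = (snd y, H c t (fst y) (snd y))"

lemma phase_field_locally_lipschitz:
  assumes "c \<in> A"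
  shows "locally_lipschitz_on (UNIV \<times> (cmap c ` cdom c) \<times> UNIV) (\<lambda>(t, y). phase_field c t y)"
proof -
  have "locally_lipschitz_on ((UNIV :: real set) \<times> (cmap c ` cdom c) \<times> (UNIV :: (real^'n) set)) (\<lambda>p. snd (snd p))"
    using locally_lipschitz_on_bounded_linear[OF bounded_linear_snd
        locally_lipschitz_on_bounded_linear[OF bounded_linear_snd locally_lipschitz_on_ident]] .
  from locally_lipschitz_on_Pair[OF this spray_lipschitz[OF assms]]
  show ?thesis by (simp add: phase_field_def case_prod_unfold)
qed

lemma phase_field_lipschitz_near:
  assumes "c \<in> A" "fst y \<in> cmap c ` cdom c"
  obtains r K where "r > 0" "K-lipschitz_on (ball t r \<times> ball y r) (\<lambda>(t, y). phase_field c t y)"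
    "ball y r \<subseteq> (cmap c ` cdom c) \<times> UNIV"
proof -
  have mem: "(t, y) \<in> UNIV \<times> (cmap c ` cdom c) \<times> UNIV" using assms(2) by (simp add: mem_Times_iff)
  from bspec[OF phase_field_locally_lipschitz[OF assms(1), unfolded locally_lipschitz_on_def] mem]
  obtain r K where r: "r > 0" and
    K: "K-lipschitz_on (ball (t, y) r \<inter> UNIV \<times> (cmap c ` cdom c) \<times> UNIV) (\<lambda>(t, y). phase_field c t y)"
    by (elim exE conjE) (rule that)
  have "open ((cmap c ` cdom c) \<times> (UNIV :: (real^'n) set))"
    by (intro open_Times chart_homeomorphism(2)[OF assms(1)] open_UNIV)
  moreover have "y \<in> (cmap c ` cdom c) \<times> UNIV" using assms(2) by (simp add: mem_Times_iff)
  ultimately obtain e where e: "e > 0" "ball y e \<subseteq> (cmap c ` cdom c) \<times> UNIV" by (rule openE)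
  define d where "d = min (r / 2) e"
  have d: "d > 0" "d \<le> r / 2" "d \<le> e" using r e by (auto simp: d_def)
  show ?thesis
  proof (rule that[OF d(1)])
    show sub: "ball y d \<subseteq> (cmap c ` cdom c) \<times> UNIV"
      by (rule subset_trans[OF subset_ball[OF d(3)] e(2)])
    show "K-lipschitz_on (ball t d \<times> ball y d) (\<lambda>(t, y). phase_field c t y)"
    proof (rule lipschitz_on_subset[OF K Int_greatest])
      show "ball t d \<times> ball y d \<subseteq> ball (t, y) r"
        by (rule subset_trans[OF Sigma_mono[OF subset_ball[OF d(2)] subset_ball[OF d(2)]] ball_Times_subset_ball])
      show "ball t d \<times> ball y d \<subseteq> UNIV \<times> (cmap c ` cdom c) \<times> UNIV"
        by (rule Sigma_mono[OF subset_UNIV sub])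
    qed
  qed
qed

text \<open>A solution is a curve on an interval that has this property at each of its times. In this
  pointwise form the property depends only on the germ of the curve at the time,
  relative to the set \<open>I\<close>, so that solutions can be restricted and glued.\<close>

definition solves_at where
  "solves_at I \<Gamma> t \<longleftrightarrow> \<Gamma> t \<in> tangent_bundle A \<and> continuous (at t within I) (\<lambda>s. base (\<Gamma> s)) \<and>
     (\<forall>c\<in>A. base (\<Gamma> t) \<in> cdom c \<longrightarrow>
        ((\<lambda>s. tchart c (\<Gamma> s)) has_vector_derivative phase_field c t (tchart c (\<Gamma> t))) (at t within I))"

lemma spray_solution_iff:
  "spray_solution A H I \<Gamma> \<longleftrightarrow> is_interval I \<and> (\<forall>t\<in>I. solves_at I \<Gamma> t)"
  unfolding spray_solution_def solves_at_def continuous_on_eq_continuous_within image_subset_iff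
    tchart_def phase_field_def has_vector_derivative_pair_iff fst_conv snd_conv
  by blast

lemma solves_at_continuous_tchart:
  assumes "solves_at I \<Gamma> t" "c \<in> A" "base (\<Gamma> t) \<in> cdom c"
  shows "continuous (at t within I) (\<lambda>s. tchart c (\<Gamma> s))"
  using assms has_vector_derivative_continuous unfolding solves_at_def by blast

text \<open>In another chart the coordinates of the curve are the image under the tangent map of the change of
  chart. The derivative of this image is the phase field of the other chart, by the
  transformation law of the spray.\<close>

lemma solves_at_of_one_chart:
  assumes TM: "\<And>s. s \<in> I \<Longrightarrow> \<Gamma> s \<in> tangent_bundle A" and t: "t \<in> I"
    and cont: "continuous (at t within I) (\<lambda>s. base (\<Gamma> s))"
    and c: "c \<in> A" "base (\<Gamma> t) \<in> cdom c"
    and deriv: "((\<lambda>s. tchart c (\<Gamma> s)) has_vector_derivative phase_field c t (tchart c (\<Gamma> t))) (at t within I)"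
  shows "solves_at I \<Gamma> t"
  unfolding solves_at_def
proof (intro conjI ballI impI TM t cont)
  fix d assume d: "d \<in> A" "base (\<Gamma> t) \<in> cdom d"
  let ?T = "transition c d" and ?x = "\<lambda>s. cmap c (base (\<Gamma> s))" and ?v = "\<lambda>s. vcomp (\<Gamma> s) c"
  let ?\<tau> = "\<lambda>s. (?T (?x s), frechet_derivative ?T (at (?x s)) (?v s))"
  obtain e where e: "e > 0" "\<And>s. s \<in> I \<Longrightarrow> s \<in> ball t e \<Longrightarrow> base (\<Gamma> s) \<in> cdom c \<inter> cdom d"
    using eventually_within_ball[OF cont open_Int[OF chart_homeomorphism(1)[OF c(1)] chart_homeomorphism(1)[OF d(1)]]]
      c d by blast
  have eq: "tchart d (\<Gamma> s) = ?\<tau> s" if "s \<in> I" "s \<in> ball t e" for s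
    using tchart_change[OF c(1) d(1), of "\<Gamma> s"] TM[OF that(1)] e(2)[OF that]
    by (simp add: tangents_over_def tchart_def)
  have ev: "\<forall>\<^sub>F s in nhds t. s \<in> I \<longrightarrow> tchart d (\<Gamma> s) = ?\<tau> s"
    unfolding eventually_nhds using eq e(1) by (intro exI[of _ "ball t e"]) auto
  have eqt: "tchart d (\<Gamma> t) = ?\<tau> t" by (rule eq[OF t]) (use e in simp)
  have x: "(?x has_vector_derivative ?v t) (at t within I)"
    and v: "(?v has_vector_derivative H c t (?x t) (?v t)) (at t within I)"
    using deriv unfolding tchart_def phase_field_def has_vector_derivative_pair_iff by auto
  have xU: "?x t \<in> cmap c ` (cdom c \<inter> cdom d)" using c d by blast
  note tm = tangent_map_derivatives_along_curve[OF open_overlap[OF c(1) d(1)] transition_c21[OF c(1) d(1)] x v xU]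
  have "(?\<tau> has_vector_derivative (frechet_derivative ?T (at (?x t)) (?v t),
      second_deriv_form ?T (?x t) (?v t) + frechet_derivative ?T (at (?x t)) (H c t (?x t) (?v t)))) (at t within I)"
    using tm unfolding has_vector_derivative_pair_iff by blast
  then have "(?\<tau> has_vector_derivative phase_field d t (tchart d (\<Gamma> t))) (at t within I)"
    unfolding eqt phase_field_def fst_conv snd_conv spray_transform[OF c(1) d(1) xU] .
  then show "((\<lambda>s. tchart d (\<Gamma> s)) has_vector_derivative phase_field d t (tchart d (\<Gamma> t))) (at t within I)"
    unfolding has_vector_derivative_cong_ev[OF ev eqt] .
qed

lemma solves_at_cong:
  assumes sol: "solves_at I \<Gamma> t" and U: "open U" "t \<in> U" "I \<inter> U = I' \<inter> U" and t: "t \<in> I"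
    and eq: "\<And>s. s \<in> I \<Longrightarrow> s \<in> U \<Longrightarrow> \<Gamma>' s = \<Gamma> s"
  shows "solves_at I' \<Gamma>' t"
proof -
  have at: "at t within I' = at t within I"
    by (rule at_within_nhd[OF U(2,1)]) (use U(3) in blast)
  have evU: "\<forall>\<^sub>F s in nhds t. s \<in> U" using U(1,2) by (rule eventually_nhds_in_open)
  then have ev: "\<forall>\<^sub>F s in nhds t. s \<in> I \<longrightarrow> \<Gamma>' s = \<Gamma> s"
    by eventually_elim (use eq in blast)
  have eqt: "\<Gamma>' t = \<Gamma> t" using eq t U by blast
  have evw: "\<forall>\<^sub>F s in at t within I. base (\<Gamma>' s) = base (\<Gamma> s)"
    unfolding eventually_at_filter using ev by eventually_elim simp
  have "continuous (at t within I) (\<lambda>s. base (\<Gamma>' s))"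
    using sol tendsto_cong[OF evw] unfolding solves_at_def continuous_within eqt by blast
  moreover have "((\<lambda>s. tchart c (\<Gamma>' s)) has_vector_derivative phase_field c t (tchart c (\<Gamma>' t))) (at t within I)"
    if "c \<in> A" "base (\<Gamma>' t) \<in> cdom c" for c
  proof -
    have evc: "\<forall>\<^sub>F s in nhds t. s \<in> I \<longrightarrow> tchart c (\<Gamma>' s) = tchart c (\<Gamma> s)"
      using ev by eventually_elim simp
    have "((\<lambda>s. tchart c (\<Gamma> s)) has_vector_derivative phase_field c t (tchart c (\<Gamma> t))) (at t within I)"
      using sol that unfolding solves_at_def eqt by blast
    then show ?thesis
      unfolding has_vector_derivative_cong_ev[OF evc arg_cong[OF eqt]] unfolding eqt .
  qed
  moreover have "\<Gamma>' t \<in> tangent_bundle A" using sol eqt unfolding solves_at_def by simp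
  ultimately show ?thesis unfolding solves_at_def at by blast
qed

lemma solves_at_Un:
  assumes "solves_at I \<Gamma> t" "solves_at I' \<Gamma> t"
  shows "solves_at (I \<union> I') \<Gamma> t"
proof -
  have "(f has_vector_derivative f') (at t within I \<union> I')"
    if "(f has_vector_derivative f') (at t within I)" "(f has_vector_derivative f') (at t within I')"
    for f :: "real \<Rightarrow> (real^'n) \<times> (real^'n)" and f'
    using that unfolding has_vector_derivative_def has_derivative_within Lim_within_Un by blast
  with assms show ?thesis
    unfolding solves_at_def continuous_within Lim_within_Un by blast
qed

lemma solves_at_subset:
  assumes "solves_at I \<Gamma> t" "I' \<subseteq> I"
  shows "solves_at I' \<Gamma> t"
  using assms has_vector_derivative_within_subset[OF _ assms(2)] continuous_within_subset[OF _ assms(2)]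
  unfolding solves_at_def by blast

lemma spray_solution_subset:
  assumes "spray_solution A H I \<Gamma>" "I' \<subseteq> I" "is_interval I'"
  shows "spray_solution A H I' \<Gamma>"
  using assms solves_at_subset unfolding spray_solution_iff by blast

text \<open>Two intervals with the common point \<open>\<tau>\<close> are considered at a time \<open>t\<close> that only belongs to \<open>I\<close>. On the side of
  \<open>\<tau>\<close> where \<open>t\<close> lies the interval \<open>I'\<close> ends before \<open>t\<close> and is contained in \<open>I\<close>. Hence the union looks
  like \<open>I\<close> on this side, even if \<open>t\<close> is an end point of \<open>I'\<close>.\<close>

lemma solves_at_glue_aux:
  assumes I: "is_interval I" "is_interval I'" and \<tau>: "\<tau> \<in> I" "\<tau> \<in> I'"
    and sol: "solves_at I \<Gamma> t" and t: "t \<in> I" "t \<notin> I'" and eq: "\<And>s. s \<in> I \<Longrightarrow> \<Gamma>' s = \<Gamma> s"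
  shows "solves_at (I \<union> I') \<Gamma>' t"
proof (cases "\<tau> < t")
  case True
  have "s \<in> I" if "s \<in> I'" "\<tau> < s" for s
  proof (cases "s \<le> t")
    case True
    then show ?thesis using I(1) \<tau>(1) t(1) that(2) unfolding is_interval_1 by (meson less_imp_le)
  next
    case False
    then show ?thesis using I(2) \<tau>(2) t(2) that(1) True unfolding is_interval_1 by (meson less_imp_le not_le)
  qed
  then show ?thesis
    by (intro solves_at_cong[OF sol, of "{\<tau><..}"]) (use True t eq in auto)
next
  case False
  then have less: "t < \<tau>" using t \<tau> by (metis linorder_neqE)
  have "s \<in> I" if "s \<in> I'" "s < \<tau>" for s
  proof (cases "t \<le> s")
    case True
    then show ?thesis using I(1) \<tau>(1) t(1) that(2) unfolding is_interval_1 by (meson less_imp_le)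
  next
    case False
    then show ?thesis using I(2) \<tau>(2) t(2) that(1) less unfolding is_interval_1 by (meson less_imp_le not_le)
  qed
  then show ?thesis
    by (intro solves_at_cong[OF sol, of "{..<\<tau>}"]) (use less t eq in auto)
qed

lemma spray_solution_glue:
  assumes \<Gamma>: "spray_solution A H I \<Gamma>" and \<Delta>: "spray_solution A H I' \<Delta>"
    and \<tau>: "\<tau> \<in> I" "\<tau> \<in> I'" and eq: "\<And>s. s \<in> I \<Longrightarrow> s \<in> I' \<Longrightarrow> \<Gamma> s = \<Delta> s"
  shows "spray_solution A H (I \<union> I') (\<lambda>t. if t \<in> I then \<Gamma> t else \<Delta> t)"
proof -
  let ?E = "\<lambda>t. if t \<in> I then \<Gamma> t else \<Delta> t"
  have I: "is_interval I" "is_interval I'" and sol: "\<And>t. t \<in> I \<Longrightarrow> solves_at I \<Gamma> t"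
    "\<And>t. t \<in> I' \<Longrightarrow> solves_at I' \<Delta> t"
    using \<Gamma> \<Delta> unfolding spray_solution_iff by blast+
  have eq': "\<And>s. s \<in> I' \<Longrightarrow> ?E s = \<Delta> s" using eq by simp
  have "is_interval (I \<union> I')"
    using I \<tau> unfolding is_interval_connected_1 by (intro connected_Un) auto
  moreover have "solves_at (I \<union> I') ?E t" if t: "t \<in> I \<union> I'" for t
  proof (cases "t \<in> I"; cases "t \<in> I'")
    assume tI: "t \<in> I" "t \<in> I'"
    have "solves_at I ?E t" by (rule solves_at_cong[OF sol(1)[OF tI(1)] open_UNIV _ _ tI(1)]) auto
    moreover have "solves_at I' ?E t"
      by (rule solves_at_cong[OF sol(2)[OF tI(2)] open_UNIV _ _ tI(2)]) (use eq in auto)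
    ultimately show ?thesis by (rule solves_at_Un)
  next
    assume "t \<in> I" "t \<notin> I'"
    then show ?thesis by (intro solves_at_glue_aux[OF I \<tau> sol(1)]) auto
  next
    assume "t \<notin> I" "t \<in> I'"
    then have "solves_at (I' \<union> I) ?E t"
      by (intro solves_at_glue_aux[OF I(2,1) \<tau>(2,1) sol(2)] eq')
    then show ?thesis by (simp add: Un_commute)
  next
    assume "t \<notin> I" "t \<notin> I'"
    then show ?thesis using t by blast
  qed
  ultimately show ?thesis unfolding spray_solution_iff by blast
qed

text \<open>If the two curves pass through different points at time \<open>t\<close>, they are kept apart by disjoint
  neighborhoods of these points. If the points agree but not the vectors, they are kept apart by
  continuity in a chart. If the vectors agree, both curves solve the same
  Lipschitz equation in one chart near \<open>t\<close>.\<close>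

lemma agreement_is_locally_constant:
  assumes \<Gamma>: "spray_solution A H I \<Gamma>" and \<Delta>: "spray_solution A H I \<Delta>" and t: "t \<in> I"
  obtains e where "e > 0" "\<And>x y. x \<in> I \<inter> ball t e \<Longrightarrow> y \<in> I \<inter> ball t e \<Longrightarrow> \<Gamma> x = \<Delta> x \<Longrightarrow> \<Gamma> y = \<Delta> y"
proof -
  have I: "is_interval I" and sol: "solves_at I \<Gamma> t" "solves_at I \<Delta> t" if "t \<in> I" for t
    using that \<Gamma> \<Delta> unfolding spray_solution_iff by blast+
  have contb: "continuous (at t within I) (\<lambda>s. base (\<Gamma> s))" "continuous (at t within I) (\<lambda>s. base (\<Delta> s))"
    using sol[OF t] unfolding solves_at_def by blast+
  show ?thesis
  proof (cases "base (\<Gamma> t) = base (\<Delta> t)")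
    case False
    then obtain U V where UV: "open U" "open V" "base (\<Gamma> t) \<in> U" "base (\<Delta> t) \<in> V" "U \<inter> V = {}"
      using hausdorff by metis
    obtain e where e: "e > 0" "\<And>s. s \<in> I \<Longrightarrow> s \<in> ball t e \<Longrightarrow> base (\<Gamma> s) \<in> U"
      using eventually_within_ball[OF contb(1) UV(1,3)] by blast
    obtain e' where e': "e' > 0" "\<And>s. s \<in> I \<Longrightarrow> s \<in> ball t e' \<Longrightarrow> base (\<Delta> s) \<in> V"
      using eventually_within_ball[OF contb(2) UV(2,4)] by blast
    show ?thesis
    proof (rule that[of "min e e'"])
      show "min e e' > 0" using e e' by simp
      fix x y assume "x \<in> I \<inter> ball t (min e e')" "\<Gamma> x = \<Delta> x"
      then have "base (\<Gamma> x) \<in> U \<inter> V" using e(2)[of x] e'(2)[of x] by auto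
      then show "\<Gamma> y = \<Delta> y" using UV(5) by simp
    qed
  next
    case b: True
    obtain c where c: "c \<in> A" "base (\<Gamma> t) \<in> cdom c" by (rule chart_at)
    have c': "base (\<Delta> t) \<in> cdom c" using c b by simp
    have contc: "continuous (at t within I) (\<lambda>s. tchart c (\<Gamma> s))" "continuous (at t within I) (\<lambda>s. tchart c (\<Delta> s))"
      using solves_at_continuous_tchart[OF sol(1)[OF t] c] solves_at_continuous_tchart[OF sol(2)[OF t] c(1) c'] .
    show ?thesis
    proof (cases "tchart c (\<Gamma> t) = tchart c (\<Delta> t)")
      case False
      have "continuous (at t within I) (\<lambda>s. tchart c (\<Gamma> s) - tchart c (\<Delta> s))"
        using contc by (rule continuous_diff)
      moreover have "open (- {0 :: (real^'n) \<times> (real^'n)})" by (intro open_Compl closed_singleton)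
      moreover have "tchart c (\<Gamma> t) - tchart c (\<Delta> t) \<in> - {0}" using False by simp
      ultimately obtain e where e: "e > 0"
        "\<And>s. s \<in> I \<Longrightarrow> s \<in> ball t e \<Longrightarrow> tchart c (\<Gamma> s) - tchart c (\<Delta> s) \<in> - {0}"
        by (rule eventually_within_ball) blast
      show ?thesis
      proof (rule that[OF e(1)])
        fix x y assume "x \<in> I \<inter> ball t e" "\<Gamma> x = \<Delta> x"
        then show "\<Gamma> y = \<Delta> y" using e(2)[of x] by simp
      qed
    next
      case True
      let ?y = "tchart c (\<Gamma> t)"
      have "fst ?y \<in> cmap c ` cdom c" using c by (simp add: tchart_def)
      from phase_field_lipschitz_near[OF c(1) this, of t] obtain r K where r: "r > 0"
        and K: "K-lipschitz_on (ball t r \<times> ball ?y r) (\<lambda>(t, y). phase_field c t y)" .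
      have K0: "0 \<le> K" by (rule lipschitz_on_nonneg[OF K])
      have y: "?y \<in> ball ?y r" "tchart c (\<Delta> t) \<in> ball ?y r" using r True by auto
      obtain e1 where e1: "e1 > 0" "\<And>s. s \<in> I \<Longrightarrow> s \<in> ball t e1 \<Longrightarrow> tchart c (\<Gamma> s) \<in> ball ?y r"
        using eventually_within_ball[OF contc(1) open_ball y(1)] by blast
      obtain e2 where e2: "e2 > 0" "\<And>s. s \<in> I \<Longrightarrow> s \<in> ball t e2 \<Longrightarrow> tchart c (\<Delta> s) \<in> ball ?y r"
        using eventually_within_ball[OF contc(2) open_ball y(2)] by blast
      obtain e3 where e3: "e3 > 0" "\<And>s. s \<in> I \<Longrightarrow> s \<in> ball t e3 \<Longrightarrow> base (\<Gamma> s) \<in> cdom c"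
        using eventually_within_ball[OF contb(1) chart_homeomorphism(1)[OF c(1)] c(2)] by blast
      obtain e4 where e4: "e4 > 0" "\<And>s. s \<in> I \<Longrightarrow> s \<in> ball t e4 \<Longrightarrow> base (\<Delta> s) \<in> cdom c"
        using eventually_within_ball[OF contb(2) chart_homeomorphism(1)[OF c(1)] c'] by blast
      \<comment> \<open>The last bound makes \<open>K \<bar>y - x\<bar> \<le> 1 / 2\<close> for times in the ball of radius \<open>e\<close>.\<close>
      define e where "e = Min {e1, e2, e3, e4, r, 1 / (4 * (K + 1))}"
      have "e > 0" using e1(1) e2(1) e3(1) e4(1) r K0 by (simp add: e_def)
      moreover have "e \<le> e1" "e \<le> e2" "e \<le> e3" "e \<le> e4" "e \<le> r" "e \<le> 1 / (4 * (K + 1))"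
        unfolding e_def by (intro Min_le; simp)+
      ultimately have e: "e > 0" "e \<le> e1" "e \<le> e2" "e \<le> e3" "e \<le> e4" "e \<le> r" "e \<le> 1 / (4 * (K + 1))"
        by this+
      have Ke: "K * (2 * e) \<le> 1 / 2"
      proof -
        have "K * (2 * e) \<le> (K + 1) * (2 * (1 / (4 * (K + 1))))"
          using e(1,7) K0 by (intro mult_mono) auto
        also have "\<dots> = 1 / 2" using K0 by (simp add: field_simps)
        finally show ?thesis .
      qed
      let ?J = "I \<inter> ball t e"
      have J: "is_interval ?J" by (rule is_interval_Int[OF I[OF t] is_interval_ball_real])
      have inball: "s \<in> ball t e'" if "s \<in> ?J" "e \<le> e'" for s e'
        using that by auto
      have over: "\<Gamma> s \<in> tangents_over c" "\<Delta> s \<in> tangents_over c" if "s \<in> ?J" for s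
        using sol[of s] that e3(2)[OF _ inball[OF that e(4)]] e4(2)[OF _ inball[OF that e(5)]]
        unfolding tangents_over_def solves_at_def by auto
      have d: "((\<lambda>s. tchart c (\<Gamma> s)) has_vector_derivative phase_field c s (tchart c (\<Gamma> s))) (at s within ?J)"
        "((\<lambda>s. tchart c (\<Delta> s)) has_vector_derivative phase_field c s (tchart c (\<Delta> s))) (at s within ?J)"
        if "s \<in> ?J" for s
      proof -
        have "s \<in> I" using that by blast
        then show "((\<lambda>s. tchart c (\<Gamma> s)) has_vector_derivative phase_field c s (tchart c (\<Gamma> s))) (at s within ?J)"
          "((\<lambda>s. tchart c (\<Delta> s)) has_vector_derivative phase_field c s (tchart c (\<Delta> s))) (at s within ?J)"
          using solves_at_subset[OF sol(1)[of s], of ?J] solves_at_subset[OF sol(2)[of s], of ?J] over[OF that] c(1)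
          unfolding solves_at_def tangents_over_def by blast+
      qed
      show ?thesis
      proof (rule that[OF e(1)])
        fix x y assume x: "x \<in> ?J" and y: "y \<in> ?J" and eq: "\<Gamma> x = \<Delta> x"
        have "tchart c (\<Gamma> y) = tchart c (\<Delta> y)"
        proof (rule ode_solutions_agree_nearby[where u = "\<lambda>s. tchart c (\<Gamma> s)" and v = "\<lambda>s. tchart c (\<Delta> s)"
              and f = "phase_field c", OF J x y _ d _ K0])
          show "tchart c (\<Gamma> x) = tchart c (\<Delta> x)" using eq by simp
          fix s assume s: "s \<in> ?J"
          have "(s, tchart c (\<Gamma> s)) \<in> ball t r \<times> ball ?y r" "(s, tchart c (\<Delta> s)) \<in> ball t r \<times> ball ?y r"
            using inball[OF s e(6)] e1(2)[OF _ inball[OF s e(2)]] e2(2)[OF _ inball[OF s e(3)]] s by auto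
          from lipschitz_onD[OF K this]
          show "norm (phase_field c s (tchart c (\<Gamma> s)) - phase_field c s (tchart c (\<Delta> s)))
              \<le> K * norm (tchart c (\<Gamma> s) - tchart c (\<Delta> s))"
            by (simp add: dist_Pair_Pair dist_norm)
        next
          have "\<bar>y - x\<bar> \<le> 2 * e" using x y by (auto simp: dist_real_def)
          then show "K * \<bar>y - x\<bar> \<le> 1 / 2" using mult_left_mono[OF _ K0] Ke order_trans by blast
        qed
        then show "\<Gamma> y = \<Delta> y" using tangent_eqI[OF over[OF y] c(1)] by blast
      qed
    qed
  qed
qed

lemma spray_solution_unique:
  assumes \<Gamma>: "spray_solution A H I \<Gamma>" and \<Delta>: "spray_solution A H I' \<Delta>"
    and a: "a \<in> I" "a \<in> I'" "\<Gamma> a = \<Delta> a" and b: "b \<in> I" "b \<in> I'"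
  shows "\<Gamma> b = \<Delta> b"
proof -
  let ?J = "I \<inter> I'"
  have J: "is_interval ?J"
    using \<Gamma> \<Delta> unfolding spray_solution_iff by (intro is_interval_Int) auto
  have sol: "spray_solution A H ?J \<Gamma>" "spray_solution A H ?J \<Delta>"
    using spray_solution_subset[OF \<Gamma> _ J] spray_solution_subset[OF \<Delta> _ J] by auto
  show ?thesis
  proof (rule connected_induction_simple[where S = ?J and a = a and b = b and P = "\<lambda>t. \<Gamma> t = \<Delta> t"])
    show "connected ?J" using J is_interval_connected_1 by blast
    fix t assume "t \<in> ?J"
    from agreement_is_locally_constant[OF sol this] obtain e where e: "e > 0"
      "\<And>x y. x \<in> ?J \<inter> ball t e \<Longrightarrow> y \<in> ?J \<inter> ball t e \<Longrightarrow> \<Gamma> x = \<Delta> x \<Longrightarrow> \<Gamma> y = \<Delta> y" by blast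
    show "\<exists>T. openin (top_of_set ?J) T \<and> t \<in> T \<and> (\<forall>x\<in>T. \<forall>y\<in>T. \<Gamma> x = \<Delta> x \<longrightarrow> \<Gamma> y = \<Delta> y)"
    proof (intro exI[of _ "?J \<inter> ball t e"] conjI ballI impI)
      show "openin (top_of_set ?J) (?J \<inter> ball t e)" by (rule openin_open_Int[OF open_ball])
      show "t \<in> ?J \<inter> ball t e" using \<open>t \<in> ?J\<close> e(1) by (rule IntI[OF _ iffD2[OF centre_in_ball]])
    qed (rule e(2))
  qed (use a b in auto)
qed

text \<open>The local flow in a chart, lifted to the tangent bundle with \<open>tangent_of\<close>. The same \<open>d\<close>
  serves all initial vectors and initial times near the given ones.\<close>

lemma local_flow:
  assumes c: "c \<in> A" and \<xi>: "\<xi> \<in> tangents_over c"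
  obtains d L \<Psi> where "0 < d" "0 \<le> L"
    "\<And>s0 \<eta>. s0 \<in> ball t0 d \<Longrightarrow> \<eta> \<in> tangents_over c \<Longrightarrow> tchart c \<eta> \<in> ball (tchart c \<xi>) d \<Longrightarrow>
       spray_solution A H (ball t0 d) (\<Psi> s0 \<eta>) \<and> \<Psi> s0 \<eta> s0 = \<eta> \<and>
       (\<forall>s\<in>ball t0 d. base (\<Psi> s0 \<eta> s) \<in> cdom c)"
    "\<And>s s' s0 s0' \<eta> \<eta>'. s \<in> ball t0 d \<Longrightarrow> s' \<in> ball t0 d \<Longrightarrow> s0 \<in> ball t0 d \<Longrightarrow> s0' \<in> ball t0 d \<Longrightarrow>
       \<eta> \<in> tangents_over c \<Longrightarrow> \<eta>' \<in> tangents_over c \<Longrightarrow>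
       tchart c \<eta> \<in> ball (tchart c \<xi>) d \<Longrightarrow> tchart c \<eta>' \<in> ball (tchart c \<xi>) d \<Longrightarrow>
       dist (tchart c (\<Psi> s0 \<eta> s)) (tchart c (\<Psi> s0' \<eta>' s')) \<le> L * dist (s, s0, tchart c \<eta>) (s', s0', tchart c \<eta>')"
proof -
  let ?y = "tchart c \<xi>"
  have "fst ?y \<in> cmap c ` cdom c" using \<xi> by (simp add: tchart_def tangents_over_def)
  from phase_field_lipschitz_near[OF c this, of t0] obtain r K where r: "r > 0"
    and K: "K-lipschitz_on (ball t0 r \<times> ball ?y r) (\<lambda>(t, y). phase_field c t y)"
    and sub: "ball ?y r \<subseteq> (cmap c ` cdom c) \<times> UNIV" .
  obtain d L \<phi> where d: "0 < d" and L: "0 \<le> L"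
    and sol: "\<And>s s0 y. s \<in> ball t0 d \<Longrightarrow> s0 \<in> ball t0 d \<Longrightarrow> y \<in> ball ?y d \<Longrightarrow>
       \<phi> s s0 y \<in> ball ?y r \<and> ((\<lambda>s. \<phi> s s0 y) has_vector_derivative phase_field c s (\<phi> s s0 y)) (at s)"
    and init: "\<And>s0 y. s0 \<in> ball t0 d \<Longrightarrow> y \<in> ball ?y d \<Longrightarrow> \<phi> s0 s0 y = y"
    and lip: "\<And>s s' s0 s0' y y'. s \<in> ball t0 d \<Longrightarrow> s' \<in> ball t0 d \<Longrightarrow> s0 \<in> ball t0 d \<Longrightarrow> s0' \<in> ball t0 d \<Longrightarrow>
       y \<in> ball ?y d \<Longrightarrow> y' \<in> ball ?y d \<Longrightarrow>
       dist (\<phi> s s0 y) (\<phi> s' s0' y') \<le> L * dist (s, s0, y) (s', s0', y')"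
    by (rule lipschitz_flow_of_ode[OF r K]) blast
  define \<Psi> where "\<Psi> s0 \<eta> s = tangent_of c (\<phi> s s0 (tchart c \<eta>))" for s0 \<eta> s
  have img: "fst (\<phi> s s0 y) \<in> cmap c ` cdom c" if "s \<in> ball t0 d" "s0 \<in> ball t0 d" "y \<in> ball ?y d" for s s0 y
    using sol[OF that] subsetD[OF sub] by (metis mem_Times_iff)
  have \<Psi>: "\<Psi> s0 \<eta> s \<in> tangents_over c" "tchart c (\<Psi> s0 \<eta> s) = \<phi> s s0 (tchart c \<eta>)"
    if "s \<in> ball t0 d" "s0 \<in> ball t0 d" "tchart c \<eta> \<in> ball ?y d" for s s0 \<eta>
    unfolding \<Psi>_def using tangent_of[OF c img[OF that]] .
  show ?thesis
  proof (rule that[OF d L, of \<Psi>])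
    fix s0 \<eta> assume s0: "s0 \<in> ball t0 d" and \<eta>: "\<eta> \<in> tangents_over c" "tchart c \<eta> \<in> ball ?y d"
    have "\<Psi> s0 \<eta> s0 = \<eta>"
      unfolding \<Psi>_def init[OF s0 \<eta>(2)] by (rule tangent_of_tchart[OF c \<eta>(1)])
    moreover have "solves_at (ball t0 d) (\<Psi> s0 \<eta>) s" if s: "s \<in> ball t0 d" for s
    proof (rule solves_at_of_one_chart[OF _ s _ c])
      show "\<Psi> s0 \<eta> s \<in> tangent_bundle A" if "s \<in> ball t0 d" for s
        using \<Psi>(1)[OF that s0 \<eta>(2)] unfolding tangents_over_def by blast
      show "base (\<Psi> s0 \<eta> s) \<in> cdom c"
        using \<Psi>(1)[OF s s0 \<eta>(2)] unfolding tangents_over_def by blast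
      have deriv: "((\<lambda>s. \<phi> s s0 (tchart c \<eta>)) has_vector_derivative phase_field c s (\<phi> s s0 (tchart c \<eta>))) (at s within ball t0 d)"
        if "s \<in> ball t0 d" for s
        using sol[OF that s0 \<eta>(2)] has_vector_derivative_at_within by blast
      show "((\<lambda>s. tchart c (\<Psi> s0 \<eta> s)) has_vector_derivative phase_field c s (tchart c (\<Psi> s0 \<eta> s)))
          (at s within ball t0 d)"
        unfolding \<Psi>(2)[OF s s0 \<eta>(2)]
        by (rule has_vector_derivative_transform[OF s _ deriv[OF s]]) (rule \<Psi>(2)[OF _ s0 \<eta>(2)])
      have "continuous_on (ball t0 d) (\<lambda>s. \<phi> s s0 (tchart c \<eta>))"
        using deriv has_vector_derivative_continuous continuous_on_eq_continuous_within by blast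
      then have fst: "continuous_on (ball t0 d) (\<lambda>s. fst (\<phi> s s0 (tchart c \<eta>)))" by (rule continuous_on_fst)
      have inv: "continuous_on (cmap c ` cdom c) (inv_into (cdom c) (cmap c))"
        using chart_homeomorphism(3)[OF c] unfolding homeomorphism_def by blast
      have "continuous_on (ball t0 d) (\<lambda>s. inv_into (cdom c) (cmap c) (fst (\<phi> s s0 (tchart c \<eta>))))"
        by (rule continuous_on_compose2[OF inv fst]) (rule image_subsetI, rule img[OF _ s0 \<eta>(2)])
      then show "continuous (at s within ball t0 d) (\<lambda>s. base (\<Psi> s0 \<eta> s))"
        using s unfolding \<Psi>_def tangent_of_def Let_def fst_conv continuous_on_eq_continuous_within by blast
    qed
    ultimately show "spray_solution A H (ball t0 d) (\<Psi> s0 \<eta>) \<and> \<Psi> s0 \<eta> s0 = \<eta> \<and>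
       (\<forall>s\<in>ball t0 d. base (\<Psi> s0 \<eta> s) \<in> cdom c)"
      using \<Psi>(1)[OF _ s0 \<eta>(2)] is_interval_ball_real
      unfolding spray_solution_iff tangents_over_def by blast
  next
    fix s s' s0 s0' \<eta> \<eta>'
    assume s: "s \<in> ball t0 d" "s' \<in> ball t0 d" "s0 \<in> ball t0 d" "s0' \<in> ball t0 d"
      and \<eta>: "tchart c \<eta> \<in> ball ?y d" "tchart c \<eta>' \<in> ball ?y d"
    show "dist (tchart c (\<Psi> s0 \<eta> s)) (tchart c (\<Psi> s0' \<eta>' s')) \<le> L * dist (s, s0, tchart c \<eta>) (s', s0', tchart c \<eta>')"
      unfolding \<Psi>(2)[OF s(1,3) \<eta>(1)] \<Psi>(2)[OF s(2,4) \<eta>(2)] by (rule lip[OF s \<eta>])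
  qed
qed

section \<open>Maximal solutions\<close>

text \<open>In a chart the second derivative of the curve is \<open>H(t, x, v)\<close>, a locally Lipschitz function of
  \<open>(t, x, v)\<close>, and \<open>x\<close> and \<open>v\<close> are locally Lipschitz as functions of \<open>t\<close> because they are continuously
  differentiable.\<close>

lemma spray_solution_c21_curve:
  assumes "open J" and \<Gamma>: "spray_solution A H J \<Gamma>"
  shows "c21_curve A J (\<lambda>t. base (\<Gamma> t))"
  unfolding c21_curve_def
proof (intro conjI ballI)
  have sol: "\<And>t. t \<in> J \<Longrightarrow> solves_at J \<Gamma> t" using \<Gamma> unfolding spray_solution_iff by blast
  show cont: "continuous_on J (\<lambda>t. base (\<Gamma> t))"
    using \<Gamma> unfolding spray_solution_def by blast
  fix c assume c: "c \<in> A"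
  define S where "S = {t \<in> J. base (\<Gamma> t) \<in> cdom c}"
  have "S = J \<inter> (\<lambda>t. base (\<Gamma> t)) -` cdom c" unfolding S_def by blast
  then have S: "open S"
    using continuous_open_preimage[OF cont assms(1) chart_homeomorphism(1)[OF c]] by simp
  let ?x = "\<lambda>t. cmap c (base (\<Gamma> t))" and ?v = "\<lambda>t. vcomp (\<Gamma> t) c"
  let ?h = "\<lambda>t. H c t (?x t) (?v t)"
  have xv: "(?x has_vector_derivative ?v t) (at t)" "(?v has_vector_derivative ?h t) (at t)"
    if t: "t \<in> S" for t
  proof -
    have "t \<in> J" "base (\<Gamma> t) \<in> cdom c" using t unfolding S_def by blast+
    then show "(?x has_vector_derivative ?v t) (at t)" "(?v has_vector_derivative ?h t) (at t)"
      using \<Gamma> c at_within_open[OF _ assms(1), of t] unfolding spray_solution_def by metis+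
  qed
  have cx: "continuous_on S ?x"
    by (intro continuous_at_imp_continuous_on ballI has_vector_derivative_continuous[OF xv(1)])
  have cv: "continuous_on S ?v"
    by (intro continuous_at_imp_continuous_on ballI has_vector_derivative_continuous[OF xv(2)])
  have img: "(\<lambda>t. (t, ?x t, ?v t)) ` S \<subseteq> UNIV \<times> (cmap c ` cdom c) \<times> UNIV"
    unfolding S_def by blast
  have ch: "continuous_on S (\<lambda>t. (\<lambda>(t, x, v). H c t x v) (t, ?x t, ?v t))"
    by (rule continuous_on_compose2[OF locally_lipschitz_on_continuous[OF spray_lipschitz[OF c]] _ img])
      (intro continuous_intros cx cv)
  have lx: "locally_lipschitz_on S ?x"
    by (rule locally_lipschitz_on_of_continuous_derivative[OF S xv(1) cv])
  have lv: "locally_lipschitz_on S ?v"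
    by (rule locally_lipschitz_on_of_continuous_derivative[OF S xv(2) ch[unfolded prod.case]])
  have "locally_lipschitz_on S (\<lambda>t. (\<lambda>(t, x, v). H c t x v) (t, ?x t, ?v t))"
    by (rule locally_lipschitz_on_compose[OF _ spray_lipschitz[OF c] img])
      (rule locally_lipschitz_on_Pair[OF locally_lipschitz_on_ident locally_lipschitz_on_Pair[OF lx lv]])
  then have "ck1_on 0 S ?h" by simp
  then have "ck1_on (Suc (Suc 0)) S ?x"
    using ck1_on_SucI_vector_derivative[OF S xv(1) ck1_on_SucI_vector_derivative[OF S xv(2)]] by blast
  then show "ck1_on 2 {t \<in> J. base (\<Gamma> t) \<in> cdom c} ?x"
    unfolding S_def numeral_2_eq_2 .
qed

lemma local_solution:
  assumes "\<xi> \<in> tangent_bundle A"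
  obtains d \<Gamma> where "d > 0" "spray_solution A H (ball t d) \<Gamma>" "\<Gamma> t = \<xi>"
proof -
  obtain c where c: "c \<in> A" "base \<xi> \<in> cdom c" by (rule chart_at)
  have \<xi>: "\<xi> \<in> tangents_over c" using c assms unfolding tangents_over_def by blast
  obtain d L \<Psi> where d: "0 < d"
    and sol: "\<And>s0 \<eta>. s0 \<in> ball t d \<Longrightarrow> \<eta> \<in> tangents_over c \<Longrightarrow> tchart c \<eta> \<in> ball (tchart c \<xi>) d \<Longrightarrow>
       spray_solution A H (ball t d) (\<Psi> s0 \<eta>) \<and> \<Psi> s0 \<eta> s0 = \<eta> \<and>
       (\<forall>s\<in>ball t d. base (\<Psi> s0 \<eta> s) \<in> cdom c)"
    by (rule local_flow[OF c(1) \<xi>, of t]) blast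
  show ?thesis using that[OF d, of "\<Psi> t \<xi>"] sol[OF _ \<xi>, of t] d by simp
qed

definition solution_through where
  "solution_through t0 \<xi> I \<Delta> \<longleftrightarrow> t0 \<in> I \<and> \<Delta> t0 = \<xi> \<and> spray_solution A H I \<Delta>"

definition max_domain where
  "max_domain t0 \<xi> = \<Union>{I. \<exists>\<Delta>. solution_through t0 \<xi> I \<Delta>}"

text \<open>All solutions through \<open>(t0, \<xi>)\<close> that are defined at \<open>t\<close> have the same value there, so the
  choice is immaterial for \<open>t\<close> in \<open>max_domain\<close>.\<close>

definition flow where
  "flow t0 \<xi> t = (SOME \<eta>. \<exists>I \<Delta>. solution_through t0 \<xi> I \<Delta> \<and> t \<in> I \<and> \<eta> = \<Delta> t)"

lemma flow_eq:
  assumes "solution_through t0 \<xi> I \<Delta>" "t \<in> I"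
  shows "flow t0 \<xi> t = \<Delta> t"
proof -
  have "\<exists>\<eta>. \<exists>I \<Delta>. solution_through t0 \<xi> I \<Delta> \<and> t \<in> I \<and> \<eta> = \<Delta> t" using assms by blast
  from someI_ex[OF this] obtain I' \<Delta>' where *: "solution_through t0 \<xi> I' \<Delta>'" "t \<in> I'" "flow t0 \<xi> t = \<Delta>' t"
    unfolding flow_def by blast
  have "\<Delta>' t = \<Delta> t"
    by (rule spray_solution_unique[of I' _ I _ t0]) (use * assms in \<open>auto simp: solution_through_def\<close>)
  then show ?thesis using *(3) by simp
qed

lemma solution_through_extend:
  assumes "solution_through t0 \<xi> I \<Delta>" "spray_solution A H I' \<Delta>'" "\<tau> \<in> I" "\<tau> \<in> I'" "\<Delta> \<tau> = \<Delta>' \<tau>"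
  shows "solution_through t0 \<xi> (I \<union> I') (\<lambda>t. if t \<in> I then \<Delta> t else \<Delta>' t)"
proof -
  have sol: "spray_solution A H I \<Delta>" and t0: "t0 \<in> I" "\<Delta> t0 = \<xi>"
    using assms(1) unfolding solution_through_def by blast+
  have "spray_solution A H (I \<union> I') (\<lambda>t. if t \<in> I then \<Delta> t else \<Delta>' t)"
    by (rule spray_solution_glue[OF sol assms(2-4)])
      (rule spray_solution_unique[OF sol assms(2-5)])
  then show ?thesis unfolding solution_through_def using t0 by simp
qed

text \<open>A solution that reaches \<open>t\<close> can be continued beyond \<open>t\<close> by the local solution there. So every
  time of the domain is interior to the domain of a single solution; this makes the
  domain open, and on a neighborhood of \<open>t\<close> it identifies \<open>flow\<close> with one solution.\<close>

lemma max_domain_nbhd: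
  assumes "t \<in> max_domain t0 \<xi>"
  obtains I \<Delta> e where "solution_through t0 \<xi> I \<Delta>" "e > 0" "ball t e \<subseteq> I"
proof -
  obtain I \<Delta> where I: "solution_through t0 \<xi> I \<Delta>" "t \<in> I"
    using assms unfolding max_domain_def by blast
  have "\<Delta> t \<in> tangent_bundle A"
    using I unfolding solution_through_def spray_solution_def by blast
  then obtain d \<Gamma> where d: "d > 0" "spray_solution A H (ball t d) \<Gamma>" "\<Gamma> t = \<Delta> t"
    by (rule local_solution)
  have "solution_through t0 \<xi> (I \<union> ball t d) (\<lambda>s. if s \<in> I then \<Delta> s else \<Gamma> s)"
    by (rule solution_through_extend[OF I(1) d(2) I(2) _ d(3)[symmetric]]) (use d(1) in simp)
  then show ?thesis using that d(1) Un_upper2 by blast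
qed

lemma maximal_solution_flow:
  assumes "\<xi> \<in> tangent_bundle A"
  shows "maximal_solution A H t0 \<xi> (max_domain t0 \<xi>) (flow t0 \<xi>)"
  unfolding maximal_solution_def
proof (intro conjI allI impI)
  let ?J = "max_domain t0 \<xi>"
  have sub: "I \<subseteq> ?J" if "solution_through t0 \<xi> I \<Delta>" for I \<Delta>
    using that unfolding max_domain_def by blast
  show "open ?J"
    unfolding open_contains_ball
  proof
    fix t assume "t \<in> ?J"
    then obtain I \<Delta> e where "solution_through t0 \<xi> I \<Delta>" "e > 0" "ball t e \<subseteq> I" by (rule max_domain_nbhd)
    then show "\<exists>e>0. ball t e \<subseteq> ?J" using sub by blast
  qed
  obtain d \<Gamma> where d: "d > 0" "spray_solution A H (ball t0 d) \<Gamma>" "\<Gamma> t0 = \<xi>"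
    using local_solution[OF assms] by blast
  then have start: "solution_through t0 \<xi> (ball t0 d) \<Gamma>" unfolding solution_through_def by simp
  show t0: "t0 \<in> ?J" using sub[OF start] d(1) by auto
  show "flow t0 \<xi> t0 = \<xi>" using flow_eq[OF start, of t0] d by simp
  have "connected ?J" unfolding max_domain_def
  proof (rule connected_Union)
    show "connected I" if "I \<in> {I. \<exists>\<Delta>. solution_through t0 \<xi> I \<Delta>}" for I
      using that unfolding solution_through_def spray_solution_def is_interval_connected_1 by blast
    have "t0 \<in> \<Inter>{I. \<exists>\<Delta>. solution_through t0 \<xi> I \<Delta>}" unfolding solution_through_def by blast
    then show "\<Inter>{I. \<exists>\<Delta>. solution_through t0 \<xi> I \<Delta>} \<noteq> {}" by blast
  qed
  moreover have "solves_at ?J (flow t0 \<xi>) t" if t: "t \<in> ?J" for t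
  proof -
    obtain I \<Delta> e where I: "solution_through t0 \<xi> I \<Delta>" "e > 0" "ball t e \<subseteq> I"
      using t by (rule max_domain_nbhd)
    have tI: "t \<in> ball t e" using I(2) by simp
    have "solves_at I \<Delta> t"
      using I(1) subsetD[OF I(3) tI] unfolding solution_through_def spray_solution_iff by blast
    then show ?thesis
    proof (rule solves_at_cong[OF _ open_ball tI _ subsetD[OF I(3) tI]])
      show "I \<inter> ball t e = ?J \<inter> ball t e" using I(3) sub[OF I(1)] by blast
    qed (rule flow_eq[OF I(1)])
  qed
  ultimately show "spray_solution A H ?J (flow t0 \<xi>)"
    unfolding spray_solution_iff is_interval_connected_1 by blast
  fix I \<Delta> assume "t0 \<in> I \<and> \<Delta> t0 = \<xi> \<and> spray_solution A H I \<Delta>"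
  then have *: "solution_through t0 \<xi> I \<Delta>" unfolding solution_through_def .
  show "I \<subseteq> ?J" by (rule sub[OF *])
  show "\<forall>t\<in>I. \<Delta> t = flow t0 \<xi> t" using flow_eq[OF *] by simp
qed

lemma flow_solution:
  assumes "\<xi> \<in> tangent_bundle A"
  shows "spray_solution A H (max_domain t0 \<xi>) (flow t0 \<xi>)" "solution_through t0 \<xi> (max_domain t0 \<xi>) (flow t0 \<xi>)"
  using maximal_solution_flow[OF assms, of t0] unfolding maximal_solution_def solution_through_def by blast+

lemma flow_tangent:
  assumes "\<xi> \<in> tangent_bundle A" "t \<in> max_domain t0 \<xi>"
  shows "flow t0 \<xi> t \<in> tangent_bundle A"
  using flow_solution(1)[OF assms(1), of t0] assms(2) unfolding spray_solution_def by blast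

text \<open>The group property of the flow: it can be restarted at any of its values.\<close>

lemma flow_continue:
  assumes \<xi>: "\<xi> \<in> tangent_bundle A" and \<tau>: "\<tau> \<in> max_domain t0 \<xi>"
    and \<Delta>: "spray_solution A H I \<Delta>" "\<tau> \<in> I" "\<Delta> \<tau> = flow t0 \<xi> \<tau>" and s: "s \<in> I"
  shows "s \<in> max_domain t0 \<xi>" "flow t0 \<xi> s = \<Delta> s"
proof -
  have "solution_through t0 \<xi> (max_domain t0 \<xi> \<union> I) (\<lambda>t. if t \<in> max_domain t0 \<xi> then flow t0 \<xi> t else \<Delta> t)"
    by (rule solution_through_extend[OF flow_solution(2)[OF \<xi>] \<Delta>(1) \<tau> \<Delta>(2) \<Delta>(3)[symmetric]])
  then show mem: "s \<in> max_domain t0 \<xi>" using s unfolding max_domain_def by blast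
  show "flow t0 \<xi> s = \<Delta> s"
    by (rule spray_solution_unique[OF flow_solution(1)[OF \<xi>] \<Delta>(1) \<tau> \<Delta>(2) \<Delta>(3)[symmetric] mem s])
qed

section \<open>Lipschitz dependence on time and initial data\<close>

text \<open>The flow is regarded as a function of triples \<open>(t, t0, \<xi>)\<close> of a time, an initial time and an initial
  vector. The initial vector is read in a chart \<open>c\<close> and the value of the flow in a chart \<open>d\<close>.\<close>

definition source_coord where
  "source_coord c q = (fst q, fst (snd q), tchart c (snd (snd q)))"

definition source_region where
  "source_region c = {q :: real \<times> real \<times> ('m, 'n) tangent. snd (snd q) \<in> tangents_over c}"

definition flow_coord where
  "flow_coord d q = tchart d (flow (fst (snd q)) (snd (snd q)) (fst q))"

definition flow_region where
  "flow_region d = {q. snd (snd q) \<in> tangent_bundle A \<and> fst q \<in> max_domain (fst (snd q)) (snd (snd q)) \<and>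
     base (flow (fst (snd q)) (snd (snd q)) (fst q)) \<in> cdom d}"

definition flow_lipschitz_at where
  "flow_lipschitz_at c d p \<longleftrightarrow>
     lipschitz_near (source_coord c) (source_region c) (flow_coord d) (flow_region d) p"

lemma flow_lipschitz_change_target:
  assumes p: "flow_lipschitz_at c d p" "p \<in> source_region c" "p \<in> flow_region d" "p \<in> flow_region d'"
    and d: "d \<in> A" "d' \<in> A"
  shows "flow_lipschitz_at c d' p"
  unfolding flow_lipschitz_at_def
proof (rule lipschitz_near_trans[OF p(1)[unfolded flow_lipschitz_at_def] _ p(2)])
  let ?g = "\<lambda>q. flow (fst (snd q)) (snd (snd q)) (fst q)"
  have g: "?g q \<in> tangents_over d" if "q \<in> flow_region d" for q d
    using that flow_tangent unfolding flow_region_def tangents_over_def by blast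
  have "base (?g p) \<in> cdom d'" using p(4) unfolding flow_region_def by blast
  from lipschitz_near_chart_change[OF d g[OF p(3)] this]
  have "lipschitz_near (flow_coord d) (flow_region d) (\<lambda>q. tchart d' (?g q)) {q. ?g q \<in> tangents_over d'} p"
    by (rule lipschitz_near_pullback[where g = ?g]) (auto simp: flow_coord_def g)
  then show "lipschitz_near (flow_coord d) (flow_region d) (flow_coord d') (flow_region d') p"
    unfolding flow_coord_def[of d', abs_def]
    by (rule lipschitz_near_weaken) (auto simp: flow_region_def tangents_over_def)
qed

lemma flow_lipschitz_initially:
  assumes c: "c \<in> A" and \<xi>: "\<xi> \<in> tangents_over c"
  shows "flow_lipschitz_at c c (t0, t0, \<xi>)"
proof -
  obtain d L \<Psi> where d: "0 < d" and L: "0 \<le> L"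
    and sol: "\<And>s0 \<eta>. s0 \<in> ball t0 d \<Longrightarrow> \<eta> \<in> tangents_over c \<Longrightarrow> tchart c \<eta> \<in> ball (tchart c \<xi>) d \<Longrightarrow>
       spray_solution A H (ball t0 d) (\<Psi> s0 \<eta>) \<and> \<Psi> s0 \<eta> s0 = \<eta> \<and>
       (\<forall>s\<in>ball t0 d. base (\<Psi> s0 \<eta> s) \<in> cdom c)"
    and lip: "\<And>s s' s0 s0' \<eta> \<eta>'. s \<in> ball t0 d \<Longrightarrow> s' \<in> ball t0 d \<Longrightarrow> s0 \<in> ball t0 d \<Longrightarrow> s0' \<in> ball t0 d \<Longrightarrow>
       \<eta> \<in> tangents_over c \<Longrightarrow> \<eta>' \<in> tangents_over c \<Longrightarrow>
       tchart c \<eta> \<in> ball (tchart c \<xi>) d \<Longrightarrow> tchart c \<eta>' \<in> ball (tchart c \<xi>) d \<Longrightarrow>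
       dist (tchart c (\<Psi> s0 \<eta> s)) (tchart c (\<Psi> s0' \<eta>' s')) \<le> L * dist (s, s0, tchart c \<eta>) (s', s0', tchart c \<eta>')"
    by (rule local_flow[OF c \<xi>, of t0]) blast
  have near: "s \<in> ball t0 d" "s0 \<in> ball t0 d" "tchart c \<eta> \<in> ball (tchart c \<xi>) d"
    if "dist (s, s0, tchart c \<eta>) (t0, t0, tchart c \<xi>) < d" for s s0 \<eta>
    using that dist_fst_le[of "(s, s0, tchart c \<eta>)" "(t0, t0, tchart c \<xi>)"]
      dist_snd_le[of "(s, s0, tchart c \<eta>)" "(t0, t0, tchart c \<xi>)"]
      dist_fst_le[of "(s0, tchart c \<eta>)" "(t0, tchart c \<xi>)"]
      dist_snd_le[of "(s0, tchart c \<eta>)" "(t0, tchart c \<xi>)"]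
    unfolding mem_ball dist_commute[of t0] dist_commute[of "tchart c \<xi>"] fst_conv snd_conv by linarith+
  have flow: "s \<in> max_domain s0 \<eta>" "flow s0 \<eta> s = \<Psi> s0 \<eta> s" "base (\<Psi> s0 \<eta> s) \<in> cdom c"
    if "\<eta> \<in> tangents_over c" "dist (s, s0, tchart c \<eta>) (t0, t0, tchart c \<xi>) < d" for s s0 \<eta>
  proof -
    note n = near[OF that(2)]
    note so = sol[OF n(2) that(1) n(3)]
    have st: "solution_through s0 \<eta> (ball t0 d) (\<Psi> s0 \<eta>)"
      using so n(2) unfolding solution_through_def by blast
    show "s \<in> max_domain s0 \<eta>" using st n(1) unfolding max_domain_def by blast
    show "flow s0 \<eta> s = \<Psi> s0 \<eta> s" by (rule flow_eq[OF st n(1)])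
    show "base (\<Psi> s0 \<eta> s) \<in> cdom c" using so n(1) by blast
  qed
  show ?thesis unfolding flow_lipschitz_at_def
  proof (rule lipschitz_nearI[OF d, where L = L])
    fix q assume q: "q \<in> source_region c" "dist (source_coord c q) (source_coord c (t0, t0, \<xi>)) < d"
    obtain s s0 \<eta> where [simp]: "q = (s, s0, \<eta>)" by (cases q)
    have \<eta>: "\<eta> \<in> tangents_over c" "dist (s, s0, tchart c \<eta>) (t0, t0, tchart c \<xi>) < d"
      using q by (simp_all add: source_region_def source_coord_def)
    show "q \<in> flow_region c"
      using flow[OF \<eta>] \<eta>(1) by (simp add: flow_region_def tangents_over_def)
  next
    fix q q' assume q: "q \<in> source_region c" "q' \<in> source_region c"
      "dist (source_coord c q) (source_coord c (t0, t0, \<xi>)) < d"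
      "dist (source_coord c q') (source_coord c (t0, t0, \<xi>)) < d"
    obtain s s0 \<eta> where [simp]: "q = (s, s0, \<eta>)" by (cases q)
    obtain s' s0' \<eta>' where [simp]: "q' = (s', s0', \<eta>')" by (cases q')
    have \<eta>: "\<eta> \<in> tangents_over c" "dist (s, s0, tchart c \<eta>) (t0, t0, tchart c \<xi>) < d"
      and \<eta>': "\<eta>' \<in> tangents_over c" "dist (s', s0', tchart c \<eta>') (t0, t0, tchart c \<xi>) < d"
      using q by (simp_all add: source_region_def source_coord_def)
    note n = near[OF \<eta>(2)] and n' = near[OF \<eta>'(2)]
    show "dist (flow_coord c q) (flow_coord c q') \<le> L * dist (source_coord c q) (source_coord c q')"
      using lip[OF n(1) n'(1) n(2) n'(2) \<eta>(1) \<eta>'(1) n(3) n'(3)] flow(2)[OF \<eta>] flow(2)[OF \<eta>']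
      by (simp add: flow_coord_def source_coord_def)
  qed
qed

text \<open>Let \<open>k\<close> be a chart around the point reached at time \<open>t\<close>. For \<open>\<tau>\<close> and \<open>\<sigma>\<close> close to \<open>t\<close> the flow until a time near \<open>\<sigma>\<close> is
  the flow until the fixed time \<open>\<tau>\<close>, followed by the local flow in the chart \<open>k\<close> started at time \<open>\<tau>\<close>. The first map is
  Lipschitz in the initial data by assumption, and the second one is Lipschitz in the
  final time and in its initial vector.\<close>

lemma flow_lipschitz_propagates:
  assumes c: "c \<in> A" and \<xi>: "\<xi> \<in> tangents_over c" and t: "t \<in> max_domain t0 \<xi>"
  obtains e where "e > 0"
    "\<And>\<tau> \<sigma> d. \<tau> \<in> max_domain t0 \<xi> \<Longrightarrow> \<sigma> \<in> max_domain t0 \<xi> \<Longrightarrow> \<tau> \<in> ball t e \<Longrightarrow> \<sigma> \<in> ball t e \<Longrightarrow>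
       d \<in> A \<Longrightarrow> base (flow t0 \<xi> \<tau>) \<in> cdom d \<Longrightarrow> flow_lipschitz_at c d (\<tau>, t0, \<xi>) \<Longrightarrow>
       \<exists>d'\<in>A. base (flow t0 \<xi> \<sigma>) \<in> cdom d' \<and> flow_lipschitz_at c d' (\<sigma>, t0, \<xi>)"
proof -
  let ?J = "max_domain t0 \<xi>"
  have \<xi>TM: "\<xi> \<in> tangent_bundle A" using \<xi> unfolding tangents_over_def by blast
  obtain k where k: "k \<in> A" "base (flow t0 \<xi> t) \<in> cdom k" by (rule chart_at)
  let ?\<zeta> = "flow t0 \<xi> t"
  have \<zeta>: "?\<zeta> \<in> tangents_over k" using flow_tangent[OF \<xi>TM t] k unfolding tangents_over_def by blast
  obtain r L \<Psi> where r: "0 < r" and L: "0 \<le> L"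
    and sol: "\<And>s0 \<eta>. s0 \<in> ball t r \<Longrightarrow> \<eta> \<in> tangents_over k \<Longrightarrow> tchart k \<eta> \<in> ball (tchart k ?\<zeta>) r \<Longrightarrow>
       spray_solution A H (ball t r) (\<Psi> s0 \<eta>) \<and> \<Psi> s0 \<eta> s0 = \<eta> \<and>
       (\<forall>s\<in>ball t r. base (\<Psi> s0 \<eta> s) \<in> cdom k)"
    and lip: "\<And>s s' s0 s0' \<eta> \<eta>'. s \<in> ball t r \<Longrightarrow> s' \<in> ball t r \<Longrightarrow> s0 \<in> ball t r \<Longrightarrow> s0' \<in> ball t r \<Longrightarrow>
       \<eta> \<in> tangents_over k \<Longrightarrow> \<eta>' \<in> tangents_over k \<Longrightarrow>
       tchart k \<eta> \<in> ball (tchart k ?\<zeta>) r \<Longrightarrow> tchart k \<eta>' \<in> ball (tchart k ?\<zeta>) r \<Longrightarrow>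
       dist (tchart k (\<Psi> s0 \<eta> s)) (tchart k (\<Psi> s0' \<eta>' s')) \<le> L * dist (s, s0, tchart k \<eta>) (s', s0', tchart k \<eta>')"
    by (rule local_flow[OF k(1) \<zeta>, of t]) blast
  have solJ: "solves_at ?J (flow t0 \<xi>) t"
    using flow_solution(1)[OF \<xi>TM] t unfolding spray_solution_iff by blast
  have contb: "continuous (at t within ?J) (\<lambda>s. base (flow t0 \<xi> s))"
    using solJ unfolding solves_at_def by blast
  obtain e1 where e1: "e1 > 0" "\<And>s. s \<in> ?J \<Longrightarrow> s \<in> ball t e1 \<Longrightarrow> base (flow t0 \<xi> s) \<in> cdom k"
    using eventually_within_ball[OF contb chart_homeomorphism(1)[OF k(1)] k(2)] by blast
  have "tchart k ?\<zeta> \<in> ball (tchart k ?\<zeta>) r" using r by simp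
  then obtain e2 where e2: "e2 > 0" "\<And>s. s \<in> ?J \<Longrightarrow> s \<in> ball t e2 \<Longrightarrow> tchart k (flow t0 \<xi> s) \<in> ball (tchart k ?\<zeta>) r"
    using eventually_within_ball[OF solves_at_continuous_tchart[OF solJ k] open_ball] by blast
  define e where "e = min r (min e1 e2)"
  show ?thesis
  proof (rule that[of e])
    show "e > 0" using r e1 e2 by (simp add: e_def)
    fix \<tau> \<sigma> d assume J: "\<tau> \<in> ?J" "\<sigma> \<in> ?J" and ball: "\<tau> \<in> ball t e" "\<sigma> \<in> ball t e"
      and d: "d \<in> A" "base (flow t0 \<xi> \<tau>) \<in> cdom d" and reg: "flow_lipschitz_at c d (\<tau>, t0, \<xi>)"
    have \<tau>: "\<tau> \<in> ball t r" "\<tau> \<in> ball t e1" "\<tau> \<in> ball t e2" and \<sigma>: "\<sigma> \<in> ball t r" "\<sigma> \<in> ball t e1"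
      using ball by (auto simp: e_def)
    \<comment> \<open>\<open>?g\<close> replaces the final time by \<open>\<tau>\<close>; the original final time is kept as a parameter.\<close>
    let ?g = "\<lambda>q :: real \<times> real \<times> ('m, 'n) tangent. (\<tau>, snd q)"
    let ?p = "(\<sigma>, t0, \<xi>)"
    have src: "(s, t0, \<xi>) \<in> source_region c" for s using \<xi> by (simp add: source_region_def)
    have reg': "flow_lipschitz_at c k (\<tau>, t0, \<xi>)"
    proof (rule flow_lipschitz_change_target[OF reg src _ _ d(1) k(1)])
      show "(\<tau>, t0, \<xi>) \<in> flow_region d" "(\<tau>, t0, \<xi>) \<in> flow_region k"
        using \<xi>TM J(1) d(2) e1(2)[OF J(1) \<tau>(2)] by (simp_all add: flow_region_def)
    qed
    have "lipschitz_near (\<lambda>q. snd (source_coord c q)) (source_region c)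
        (\<lambda>q. flow_coord k (?g q)) {q. ?g q \<in> flow_region k} ?p"
      by (rule lipschitz_near_pullback[where g = ?g])
        (use reg' in \<open>auto simp: flow_lipschitz_at_def source_region_def source_coord_def dist_Pair_Pair\<close>)
    from lipschitz_near_Pair[OF this, of fst]
    have 1: "lipschitz_near (source_coord c) (source_region c)
        (\<lambda>q. (fst q, flow_coord k (?g q))) {q. ?g q \<in> flow_region k} ?p"
      by (simp add: source_coord_def[abs_def])
    have Fp: "flow_coord k (?g ?p) \<in> ball (tchart k ?\<zeta>) r"
      using e2(2)[OF J(1) \<tau>(3)] by (simp add: flow_coord_def)
    obtain r1 where r1: "r1 > 0" "ball \<sigma> r1 \<subseteq> ball t r" using openE[OF open_ball \<sigma>(1)] .
    obtain r2 where r2: "r2 > 0" "ball (flow_coord k (?g ?p)) r2 \<subseteq> ball (tchart k ?\<zeta>) r"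
      using openE[OF open_ball Fp] .
    have near: "s \<in> ball t r" "flow_coord k (\<tau>, x) \<in> ball (tchart k ?\<zeta>) r"
      if "dist (s, flow_coord k (\<tau>, x)) (\<sigma>, flow_coord k (?g ?p)) < min r1 r2" for s x
    proof -
      have "dist s \<sigma> < r1" "dist (flow_coord k (\<tau>, x)) (flow_coord k (?g ?p)) < r2"
        using that dist_fst_le[of "(s, flow_coord k (\<tau>, x))" "(\<sigma>, flow_coord k (?g ?p))"]
          dist_snd_le[of "(s, flow_coord k (\<tau>, x))" "(\<sigma>, flow_coord k (?g ?p))"]
        unfolding fst_conv snd_conv by linarith+
      then have "s \<in> ball \<sigma> r1" "flow_coord k (\<tau>, x) \<in> ball (flow_coord k (?g ?p)) r2"
        unfolding mem_ball by (simp_all only: dist_commute)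
      then show "s \<in> ball t r" "flow_coord k (\<tau>, x) \<in> ball (tchart k ?\<zeta>) r"
        using subsetD[OF r1(2)] subsetD[OF r2(2)] by blast+
    qed
    have cont: "flow s0 \<eta> \<tau> \<in> tangents_over k" "s \<in> max_domain s0 \<eta>"
        "flow s0 \<eta> s = \<Psi> \<tau> (flow s0 \<eta> \<tau>) s" "base (\<Psi> \<tau> (flow s0 \<eta> \<tau>) s) \<in> cdom k"
      if q: "(\<tau>, s0, \<eta>) \<in> flow_region k" and s: "s \<in> ball t r"
        and F: "flow_coord k (\<tau>, s0, \<eta>) \<in> ball (tchart k ?\<zeta>) r" for s s0 \<eta>
    proof -
      have \<eta>: "\<eta> \<in> tangent_bundle A" "\<tau> \<in> max_domain s0 \<eta>" "base (flow s0 \<eta> \<tau>) \<in> cdom k"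
        using q by (simp_all add: flow_region_def)
      show over: "flow s0 \<eta> \<tau> \<in> tangents_over k"
        using flow_tangent[OF \<eta>(1,2)] \<eta>(3) unfolding tangents_over_def by blast
      have "tchart k (flow s0 \<eta> \<tau>) \<in> ball (tchart k ?\<zeta>) r" using F by (simp add: flow_coord_def)
      note so = sol[OF \<tau>(1) over this]
      show "s \<in> max_domain s0 \<eta>" "flow s0 \<eta> s = \<Psi> \<tau> (flow s0 \<eta> \<tau>) s"
        using flow_continue[OF \<eta>(1,2) conjunct1[OF so] \<tau>(1) _ s] so by blast+
      show "base (\<Psi> \<tau> (flow s0 \<eta> \<tau>) s) \<in> cdom k" using so s by blast
    qed
    have 2: "lipschitz_near (\<lambda>q. (fst q, flow_coord k (?g q))) {q. ?g q \<in> flow_region k}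
        (flow_coord k) (flow_region k) ?p"
    proof (rule lipschitz_nearI[where r = "min r1 r2" and L = L])
      show "min r1 r2 > 0" using r1 r2 by simp
      fix q assume q: "q \<in> {q. ?g q \<in> flow_region k}"
        "dist (fst q, flow_coord k (?g q)) (fst ?p, flow_coord k (?g ?p)) < min r1 r2"
      obtain s s0 \<eta> where [simp]: "q = (s, s0, \<eta>)" by (cases q)
      have q': "(\<tau>, s0, \<eta>) \<in> flow_region k" using q(1) by simp
      have n: "s \<in> ball t r" "flow_coord k (\<tau>, s0, \<eta>) \<in> ball (tchart k ?\<zeta>) r"
        using near[of s "(s0, \<eta>)"] q(2) by auto
      show "q \<in> flow_region k"
        using cont[OF q' n] q' by (simp add: flow_region_def)
    next
      fix q q' assume q: "q \<in> {q. ?g q \<in> flow_region k}" "q' \<in> {q. ?g q \<in> flow_region k}"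
        "dist (fst q, flow_coord k (?g q)) (fst ?p, flow_coord k (?g ?p)) < min r1 r2"
        "dist (fst q', flow_coord k (?g q')) (fst ?p, flow_coord k (?g ?p)) < min r1 r2"
      obtain s s0 \<eta> where [simp]: "q = (s, s0, \<eta>)" by (cases q)
      obtain s' s0' \<eta>' where [simp]: "q' = (s', s0', \<eta>')" by (cases q')
      have qk: "(\<tau>, s0, \<eta>) \<in> flow_region k" "(\<tau>, s0', \<eta>') \<in> flow_region k" using q(1,2) by simp_all
      have n: "s \<in> ball t r" "flow_coord k (\<tau>, s0, \<eta>) \<in> ball (tchart k ?\<zeta>) r"
        using near[of s "(s0, \<eta>)"] q(3) by auto
      have n': "s' \<in> ball t r" "flow_coord k (\<tau>, s0', \<eta>') \<in> ball (tchart k ?\<zeta>) r"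
        using near[of s' "(s0', \<eta>')"] q(4) by auto
      note c1 = cont[OF qk(1) n] and c2 = cont[OF qk(2) n']
      have "dist (tchart k (\<Psi> \<tau> (flow s0 \<eta> \<tau>) s)) (tchart k (\<Psi> \<tau> (flow s0' \<eta>' \<tau>) s'))
          \<le> L * dist (s, \<tau>, tchart k (flow s0 \<eta> \<tau>)) (s', \<tau>, tchart k (flow s0' \<eta>' \<tau>))"
        by (rule lip[OF n(1) n'(1) \<tau>(1) \<tau>(1) c1(1) c2(1)])
          (use n(2) n'(2) in \<open>simp_all add: flow_coord_def\<close>)
      then show "dist (flow_coord k q) (flow_coord k q')
          \<le> L * dist (fst q, flow_coord k (?g q)) (fst q', flow_coord k (?g q'))"
        unfolding flow_coord_def \<open>q = _\<close> \<open>q' = _\<close> fst_conv snd_conv c1(3) c2(3)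
        by (simp add: dist_Pair_Pair)
    qed
    have "flow_lipschitz_at c k ?p"
      unfolding flow_lipschitz_at_def by (rule lipschitz_near_trans[OF 1 2 src])
    then show "\<exists>d'\<in>A. base (flow t0 \<xi> \<sigma>) \<in> cdom d' \<and> flow_lipschitz_at c d' ?p"
      using k(1) e1(2)[OF J(2) \<sigma>(2)] by blast
  qed
qed

lemma flow_lipschitz_everywhere:
  assumes c: "c \<in> A" and \<xi>: "\<xi> \<in> tangents_over c" and t: "t \<in> max_domain t0 \<xi>"
    and d: "d \<in> A" "base (flow t0 \<xi> t) \<in> cdom d"
  shows "flow_lipschitz_at c d (t, t0, \<xi>)"
proof -
  let ?J = "max_domain t0 \<xi>"
  let ?P = "\<lambda>t. \<exists>d\<in>A. base (flow t0 \<xi> t) \<in> cdom d \<and> flow_lipschitz_at c d (t, t0, \<xi>)"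
  have \<xi>TM: "\<xi> \<in> tangent_bundle A" "base \<xi> \<in> cdom c" using \<xi> unfolding tangents_over_def by blast+
  have t0: "t0 \<in> ?J" "flow t0 \<xi> t0 = \<xi>"
    using flow_solution(2)[OF \<xi>TM(1), of t0] unfolding solution_through_def by blast+
  have "?P t"
  proof (rule connected_induction_simple[where S = ?J and a = t0 and b = t])
    show "connected ?J"
      using flow_solution(1)[OF \<xi>TM(1)] unfolding spray_solution_def is_interval_connected_1 by blast
    show "?P t0" using flow_lipschitz_initially[OF c \<xi>] c \<xi>TM(2) t0(2) by metis
    fix t assume t: "t \<in> ?J"
    obtain e where e: "e > 0"
      "\<And>\<tau> \<sigma> d. \<tau> \<in> ?J \<Longrightarrow> \<sigma> \<in> ?J \<Longrightarrow> \<tau> \<in> ball t e \<Longrightarrow> \<sigma> \<in> ball t e \<Longrightarrow>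
       d \<in> A \<Longrightarrow> base (flow t0 \<xi> \<tau>) \<in> cdom d \<Longrightarrow> flow_lipschitz_at c d (\<tau>, t0, \<xi>) \<Longrightarrow> ?P \<sigma>"
      by (rule flow_lipschitz_propagates[OF c \<xi> t]) blast
    show "\<exists>T. openin (top_of_set ?J) T \<and> t \<in> T \<and> (\<forall>x\<in>T. \<forall>y\<in>T. ?P x \<longrightarrow> ?P y)"
    proof (intro exI[of _ "?J \<inter> ball t e"] conjI)
      show "openin (top_of_set ?J) (?J \<inter> ball t e)" by (rule openin_open_Int[OF open_ball])
      show "t \<in> ?J \<inter> ball t e" using t e(1) by (rule IntI[OF _ iffD2[OF centre_in_ball]])
      show "\<forall>x\<in>?J \<inter> ball t e. \<forall>y\<in>?J \<inter> ball t e. ?P x \<longrightarrow> ?P y" using e(2) by blast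
    qed
  qed (rule t0(1), rule t)
  then obtain d' where d': "d' \<in> A" "base (flow t0 \<xi> t) \<in> cdom d'" "flow_lipschitz_at c d' (t, t0, \<xi>)"
    by blast
  show ?thesis
  proof (rule flow_lipschitz_change_target[OF d'(3) _ _ _ d'(1) d(1)])
    show "(t, t0, \<xi>) \<in> source_region c" using \<xi> by (simp add: source_region_def)
    show "(t, t0, \<xi>) \<in> flow_region d'" "(t, t0, \<xi>) \<in> flow_region d"
      using \<xi>TM(1) t d'(2) d(2) by (simp_all add: flow_region_def)
  qed
qed

lemma locally_lipschitz_flow: "locally_lipschitz_flow A max_domain flow"
  unfolding locally_lipschitz_flow_def
proof (intro allI ballI impI)
  fix t0 \<xi> t c d
  assume \<xi>: "\<xi> \<in> tangent_bundle A" and t: "t \<in> max_domain t0 \<xi>" and cd: "c \<in> A" "d \<in> A"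
    and base: "base \<xi> \<in> cdom c \<and> base (flow t0 \<xi> t) \<in> cdom d"
  have "\<xi> \<in> tangents_over c" using \<xi> base unfolding tangents_over_def by blast
  from flow_lipschitz_everywhere[OF cd(1) this t cd(2) conjunct2[OF base]]
  have reg: "flow_lipschitz_at c d (t, t0, \<xi>)" .
  obtain r L where r: "r > 0"
    and D: "\<And>q. q \<in> source_region c \<Longrightarrow> dist (source_coord c q) (source_coord c (t, t0, \<xi>)) < r \<Longrightarrow>
        q \<in> flow_region d"
    and F: "\<And>q q'. q \<in> source_region c \<Longrightarrow> q' \<in> source_region c \<Longrightarrow>
        dist (source_coord c q) (source_coord c (t, t0, \<xi>)) < r \<Longrightarrow>
        dist (source_coord c q') (source_coord c (t, t0, \<xi>)) < r \<Longrightarrow>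
        dist (flow_coord d q) (flow_coord d q') \<le> L * dist (source_coord c q) (source_coord c q')"
    by (rule lipschitz_nearE[OF reg[unfolded flow_lipschitz_at_def]]) (rule that)
  let ?N = "{(s, s0, \<eta>). \<eta> \<in> tangent_bundle A \<and> base \<eta> \<in> cdom c \<and>
               dist (s, s0, tchart c \<eta>) (t, t0, tchart c \<xi>) < r}"
  have N: "q \<in> source_region c" "dist (source_coord c q) (source_coord c (t, t0, \<xi>)) < r" if "q \<in> ?N" for q
    using that by (auto simp: source_region_def source_coord_def tangents_over_def)
  have 1: "\<forall>(s, s0, \<eta>)\<in>?N. s \<in> max_domain s0 \<eta> \<and> base (flow s0 \<eta> s) \<in> cdom d"
  proof
    fix q assume q: "q \<in> ?N"
    show "case q of (s, s0, \<eta>) \<Rightarrow> s \<in> max_domain s0 \<eta> \<and> base (flow s0 \<eta> s) \<in> cdom d"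
      using D[OF N[OF q]] by (simp add: flow_region_def case_prod_unfold)
  qed
  have 2: "\<forall>(s, s0, \<eta>)\<in>?N. \<forall>(s', s0', \<eta>')\<in>?N.
      dist (tchart d (flow s0 \<eta> s)) (tchart d (flow s0' \<eta>' s')) \<le> L * dist (s, s0, tchart c \<eta>) (s', s0', tchart c \<eta>')"
  proof (intro ballI)
    fix q assume q: "q \<in> ?N"
    have "dist (flow_coord d q) (flow_coord d q') \<le> L * dist (source_coord c q) (source_coord c q')"
      if "q' \<in> ?N" for q'
      by (rule F[OF N(1)[OF q] N(1)[OF that] N(2)[OF q] N(2)[OF that]])
    then show "case q of (s, s0, \<eta>) \<Rightarrow> \<forall>(s', s0', \<eta>')\<in>?N.
        dist (tchart d (flow s0 \<eta> s)) (tchart d (flow s0' \<eta>' s')) \<le> L * dist (s, s0, tchart c \<eta>) (s', s0', tchart c \<eta>')"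
      unfolding case_prod_unfold flow_coord_def source_coord_def by blast
  qed
  show "\<exists>r>0. \<exists>L. let N = {(s, s0, \<eta>). \<eta> \<in> tangent_bundle A \<and> base \<eta> \<in> cdom c \<and>
                             dist (s, s0, tchart c \<eta>) (t, t0, tchart c \<xi>) < r} in
           (\<forall>(s, s0, \<eta>) \<in> N. s \<in> max_domain s0 \<eta> \<and> base (flow s0 \<eta> s) \<in> cdom d) \<and>
           (\<forall>(s, s0, \<eta>) \<in> N. \<forall>(s', s0', \<eta>') \<in> N.
              dist (tchart d (flow s0 \<eta> s)) (tchart d (flow s0' \<eta>' s'))
                \<le> L * dist (s, s0, tchart c \<eta>) (s', s0', tchart c \<eta>'))"
    unfolding Let_def by (intro exI[of _ r] exI[of _ L] conjI r 1 2)
qed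

section \<open>Convex neighborhoods\<close>

text \<open>Being Lipschitz with uniform constants on a fixed product of balls is a property of time intervals
  that holds for short intervals around each time and passes to the union of two adjacent intervals,
  with the smaller radius and the larger constant. By bisection it holds on every compact
  interval.\<close>

lemma spray_lipschitz_near_zero_section:
  assumes c: "c \<in> A" and x0: "x0 \<in> cmap c ` cdom c" and ab: "a \<le> b"
  shows "\<exists>r>0. \<exists>K. \<forall>t\<in>{a..b}. K-lipschitz_on (ball x0 r \<times> ball 0 r) (\<lambda>(x, v). H c t x v)"
  using ab
proof (induction a b rule: Bolzano)
  case (trans a b d)
  obtain r K where r: "r > 0"
    and K: "\<And>t. t \<in> {a..b} \<Longrightarrow> K-lipschitz_on (ball x0 r \<times> ball 0 r) (\<lambda>(x, v). H c t x v)"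
    using trans(1) by blast
  obtain r' K' where r': "r' > 0"
    and K': "\<And>t. t \<in> {b..d} \<Longrightarrow> K'-lipschitz_on (ball x0 r' \<times> ball 0 r') (\<lambda>(x, v). H c t x v)"
    using trans(2) by blast
  have *: "\<forall>t\<in>{a..d}. (max K K')-lipschitz_on (ball x0 (min r r') \<times> ball 0 (min r r')) (\<lambda>(x, v). H c t x v)"
  proof
    fix t assume t: "t \<in> {a..d}"
    show "(max K K')-lipschitz_on (ball x0 (min r r') \<times> ball 0 (min r r')) (\<lambda>(x, v). H c t x v)"
    proof (cases "t \<le> b")
      case True
      then show ?thesis
        by (intro lipschitz_on_mono[OF K] Sigma_mono subset_ball) (use t in auto)
    next
      case False
      then show ?thesis
        by (intro lipschitz_on_mono[OF K'] Sigma_mono subset_ball) (use t in auto)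
    qed
  qed
  have "min r r' > 0" using r r' by simp
  with * show ?case by blast
next
  case (local t)
  have mem: "(t, x0, 0) \<in> UNIV \<times> (cmap c ` cdom c) \<times> UNIV" using x0 by simp
  from bspec[OF spray_lipschitz[OF c, unfolded locally_lipschitz_on_def] mem]
  obtain r K where r: "r > 0" and K: "K-lipschitz_on (ball (t, x0, 0) r \<inter> UNIV \<times> (cmap c ` cdom c) \<times> UNIV)
      (\<lambda>(t, x, v). H c t x v)"
    by (elim exE conjE) (rule that)
  obtain e where e: "e > 0" "ball x0 e \<subseteq> cmap c ` cdom c"
    using openE[OF chart_homeomorphism(2)[OF c] x0] .
  define d where "d = min (r / 4) e"
  have d: "d > 0" using r e by (simp add: d_def)
  have d4: "d \<le> r / 2 / 2" and de: "d \<le> e" unfolding d_def by simp_all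
  have lip: "K-lipschitz_on (ball x0 d \<times> ball 0 d) (\<lambda>(x, v). H c t' x v)" if t': "t' \<in> ball t d" for t'
  proof (rule lipschitz_onI)
    have in_dom: "(t', p) \<in> ball (t, x0, 0) r \<inter> UNIV \<times> (cmap c ` cdom c) \<times> UNIV"
      if p: "p \<in> ball x0 d \<times> ball 0 d" for p :: "(real^'n) \<times> (real^'n)"
    proof (intro IntI)
      have "p \<in> ball x0 (r / 2 / 2) \<times> ball 0 (r / 2 / 2)"
        by (rule subsetD[OF Sigma_mono[OF subset_ball[OF d4] subset_ball[OF d4]] p])
      then have "p \<in> ball (x0, 0) (r / 2)" by (rule subsetD[OF ball_Times_subset_ball])
      moreover have "t' \<in> ball t (r / 2)" using t' d4 r by simp
      ultimately have "(t', p) \<in> ball t (r / 2) \<times> ball (x0, 0) (r / 2)" by (rule SigmaI[rotated])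
      then show "(t', p) \<in> ball (t, x0, 0) r" by (rule subsetD[OF ball_Times_subset_ball])
      have "fst p \<in> ball x0 e" using p de by (auto simp: mem_Times_iff)
      then show "(t', p) \<in> UNIV \<times> (cmap c ` cdom c) \<times> UNIV"
        using e(2) by (simp add: mem_Times_iff subset_iff)
    qed
    fix p q :: "(real^'n) \<times> (real^'n)"
    assume pq: "p \<in> ball x0 d \<times> ball 0 d" "q \<in> ball x0 d \<times> ball 0 d"
    show "dist (case p of (x, v) \<Rightarrow> H c t' x v) (case q of (x, v) \<Rightarrow> H c t' x v) \<le> K * dist p q"
      using lipschitz_onD[OF K in_dom[OF pq(1)] in_dom[OF pq(2)]]
      by (simp add: case_prod_unfold dist_Pair_Pair)
  qed (rule lipschitz_on_nonneg[OF K])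
  have "\<exists>r>0. \<exists>K. \<forall>t\<in>{a..b}. K-lipschitz_on (ball x0 r \<times> ball 0 r) (\<lambda>(x, v). H c t x v)"
    if ab: "a \<le> t" "t \<le> b" "b - a < d" for a b
  proof -
    have "t' \<in> ball t d" if "t' \<in> {a..b}" for t'
      using that ab unfolding mem_ball dist_real_def atLeastAtMost_iff by linarith
    then show ?thesis using lip d by blast
  qed
  then show ?case using d by blast
qed

text \<open>Velocities of norm at most \<open>\<rho>\<close> are scaled down to norm at most \<open>r / 2\<close>, where the Lipschitz bound near the zero
  section applies, and scaled up again by homogeneity. The two factors of the scaling give
  \<open>\<rho>\<^sup>2\<close> in front of the difference of the points, and one of them is absorbed by the
  difference of the velocities.\<close>

lemma spray_quadratic_estimate:
  assumes c: "c \<in> A" and x0: "x0 \<in> cmap c ` cdom c" and ab: "a \<le> b"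
  obtains R K where "R > 0" "K \<ge> 1" "ball x0 R \<subseteq> cmap c ` cdom c"
    "\<And>t x x' v v' \<rho>. t \<in> {a..b} \<Longrightarrow> x \<in> ball x0 R \<Longrightarrow> x' \<in> ball x0 R \<Longrightarrow> norm v \<le> \<rho> \<Longrightarrow> norm v' \<le> \<rho> \<Longrightarrow>
       norm (H c t x v - H c t x' v') \<le> K * (\<rho>\<^sup>2 * norm (x - x') + \<rho> * norm (v - v'))"
proof -
  obtain r K where r: "r > 0"
    and K: "\<And>t. t \<in> {a..b} \<Longrightarrow> K-lipschitz_on (ball x0 r \<times> ball 0 r) (\<lambda>(x, v). H c t x v)"
    using spray_lipschitz_near_zero_section[OF assms] by blast
  obtain e where e: "e > 0" "ball x0 e \<subseteq> cmap c ` cdom c"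
    using openE[OF chart_homeomorphism(2)[OF c] x0] .
  have K0: "0 \<le> K" using lipschitz_on_nonneg[OF K[of a]] ab by simp
  define m where "m = 2 / r"
  have m: "m > 0" using r by (simp add: m_def)
  define K' where "K' = 1 + K * (m\<^sup>2 + m)"
  define R where "R = min r e"
  have K'_le: "1 \<le> K'" "K * m\<^sup>2 \<le> K'" "K * m \<le> K'"
    using K0 m by (simp_all add: K'_def algebra_simps)
  have sub: "ball x0 R \<subseteq> cmap c ` cdom c" "ball x0 R \<subseteq> ball x0 r"
    using subset_trans[OF subset_ball e(2), of R] by (auto simp: R_def)
  show ?thesis
  proof (rule that[OF _ K'_le(1) sub(1)])
    show "R > 0" using r e by (simp add: R_def)
    fix t \<rho> and x x' v v' :: "real^'n"
    assume t: "t \<in> {a..b}" and x: "x \<in> ball x0 R" "x' \<in> ball x0 R" and v: "norm v \<le> \<rho>" "norm v' \<le> \<rho>"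
    have \<rho>: "0 \<le> \<rho>" using v(1) norm_ge_zero order_trans by blast
    have img: "x \<in> cmap c ` cdom c" "x' \<in> cmap c ` cdom c" using sub(1) x by blast+
    show "norm (H c t x v - H c t x' v') \<le> K' * (\<rho>\<^sup>2 * norm (x - x') + \<rho> * norm (v - v'))"
    proof (cases "\<rho> = 0")
      case True
      then have "v = 0" "v' = 0" using v by simp_all
      then show ?thesis using True spray_zero[OF c img(1)] spray_zero[OF c img(2)] by simp
    next
      case False
      define s where "s = \<rho> * m"
      have s: "s > 0" using False \<rho> m by (simp add: s_def)
      define u u' where "u = (1 / s) *\<^sub>R v" and "u' = (1 / s) *\<^sub>R v'"
      have vu: "v = s *\<^sub>R u" "v' = s *\<^sub>R u'" using s by (simp_all add: u_def u'_def)
      have small: "(1 / s) *\<^sub>R w \<in> ball 0 r" if "norm w \<le> \<rho>" for w :: "real^'n"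
      proof -
        have "norm ((1 / s) *\<^sub>R w) \<le> \<rho> / s" using that s by (simp add: divide_right_mono)
        also have "\<dots> = r / 2" using False r by (simp add: s_def m_def)
        finally have "norm ((1 / s) *\<^sub>R w) < r" using r by linarith
        then show ?thesis unfolding mem_ball_0 .
      qed
      have xu: "(x, u) \<in> ball x0 r \<times> ball 0 r" "(x', u') \<in> ball x0 r \<times> ball 0 r"
        using sub(2) x small v unfolding u_def u'_def by blast+
      have "norm (H c t x u - H c t x' u') \<le> K * dist (x, u) (x', u')"
        using lipschitz_onD[OF K[OF t] xu] by (simp add: dist_norm)
      also have "\<dots> \<le> K * (norm (x - x') + norm (u - u'))"
        unfolding dist_Pair_Pair unfolding dist_norm
        by (intro mult_left_mono K0 sqrt_sum_squares_le_sum) auto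
      finally have le: "norm (H c t x u - H c t x' u') \<le> K * (norm (x - x') + norm (u - u'))" .
      have "H c t x v - H c t x' v' = s\<^sup>2 *\<^sub>R (H c t x u - H c t x' u')"
        unfolding vu spray_homogeneous[OF c img(1) s] spray_homogeneous[OF c img(2) s]
        by (simp add: scaleR_diff_right)
      then have "norm (H c t x v - H c t x' v') = s\<^sup>2 * norm (H c t x u - H c t x' u')" by simp
      also have "\<dots> \<le> s\<^sup>2 * (K * (norm (x - x') + norm (u - u')))"
        by (rule mult_left_mono[OF le]) simp
      also have "\<dots> = K * (s\<^sup>2 * norm (x - x') + s * (s * norm (u - u')))"
        by (simp add: power2_eq_square algebra_simps)
      also have "s * norm (u - u') = norm (v - v')"
        unfolding vu scaleR_diff_right[symmetric] using s by simp
      also have "K * (s\<^sup>2 * norm (x - x') + s * norm (v - v')) =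
          (K * m\<^sup>2) * (\<rho>\<^sup>2 * norm (x - x')) + (K * m) * (\<rho> * norm (v - v'))"
        by (simp add: s_def power_mult_distrib algebra_simps)
      also have "\<dots> \<le> K' * (\<rho>\<^sup>2 * norm (x - x')) + K' * (\<rho> * norm (v - v'))"
        using \<rho> K'_le by (intro add_mono mult_right_mono) auto
      finally show ?thesis by (simp add: distrib_left)
    qed
  qed
qed

text \<open>Speeding up by the factor \<open>t2 - t1\<close> multiplies the velocity by this factor and the acceleration by its
  square, which homogeneity moves into the velocity argument of the spray.\<close>

lemma rescaled_solution:
  assumes c: "c \<in> A" and T: "t1 < t2"
    and \<Gamma>: "spray_solution A H {t1..t2} \<Gamma>" "\<And>t. t \<in> {t1..t2} \<Longrightarrow> base (\<Gamma> t) \<in> cdom c" and s: "s \<in> {0..1}"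
  shows "((\<lambda>s. cmap c (base (\<Gamma> (t1 + s * (t2 - t1))))) has_vector_derivative
            (t2 - t1) *\<^sub>R vcomp (\<Gamma> (t1 + s * (t2 - t1))) c) (at s within {0..1})"
    and "((\<lambda>s. (t2 - t1) *\<^sub>R vcomp (\<Gamma> (t1 + s * (t2 - t1))) c) has_vector_derivative
            H c (t1 + s * (t2 - t1)) (cmap c (base (\<Gamma> (t1 + s * (t2 - t1)))))
              ((t2 - t1) *\<^sub>R vcomp (\<Gamma> (t1 + s * (t2 - t1))) c)) (at s within {0..1})"
proof -
  define T where "T = t2 - t1"
  have T0: "T > 0" using assms(2) by (simp add: T_def)
  have img: "(\<lambda>s. t1 + s * T) ` {0..1} \<subseteq> {t1..t2}"
  proof (rule image_subsetI)
    fix s :: real assume "s \<in> {0..1}"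
    then have "0 \<le> s * T" "s * T \<le> 1 * T" using T0 by (auto intro: mult_right_mono)
    then show "t1 + s * T \<in> {t1..t2}" by (simp add: T_def)
  qed
  let ?t = "t1 + s * T"
  have t: "?t \<in> {t1..t2}" using img s by blast
  have lin: "((\<lambda>s. t1 + s * T) has_vector_derivative T) (at s within {0..1})"
    by (auto intro!: derivative_eq_intros)
  have chain: "((\<lambda>s. g (t1 + s * T)) has_vector_derivative T *\<^sub>R g') (at s within {0..1})"
    if "(g has_vector_derivative g') (at ?t within {t1..t2})" for g :: "real \<Rightarrow> real^'n" and g'
    using vector_diff_chain_within[OF lin has_vector_derivative_within_subset[OF that img]]
    by (simp add: o_def)
  have d: "((\<lambda>t. cmap c (base (\<Gamma> t))) has_vector_derivative vcomp (\<Gamma> ?t) c) (at ?t within {t1..t2})"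
    "((\<lambda>t. vcomp (\<Gamma> t) c) has_vector_derivative H c ?t (cmap c (base (\<Gamma> ?t))) (vcomp (\<Gamma> ?t) c))
       (at ?t within {t1..t2})"
    using \<Gamma>(1) \<Gamma>(2)[OF t] t c unfolding spray_solution_def by blast+
  show "((\<lambda>s. cmap c (base (\<Gamma> (t1 + s * (t2 - t1))))) has_vector_derivative
            (t2 - t1) *\<^sub>R vcomp (\<Gamma> (t1 + s * (t2 - t1))) c) (at s within {0..1})"
    using chain[OF d(1)] unfolding T_def .
  have x: "cmap c (base (\<Gamma> ?t)) \<in> cmap c ` cdom c" using \<Gamma>(2)[OF t] by blast
  have eq: "T *\<^sub>R (T *\<^sub>R H c ?t (cmap c (base (\<Gamma> ?t))) (vcomp (\<Gamma> ?t) c)) =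
      H c ?t (cmap c (base (\<Gamma> ?t))) (T *\<^sub>R vcomp (\<Gamma> ?t) c)"
    unfolding spray_homogeneous[OF c x T0] by (simp add: power2_eq_square)
  show "((\<lambda>s. (t2 - t1) *\<^sub>R vcomp (\<Gamma> (t1 + s * (t2 - t1))) c) has_vector_derivative
            H c (t1 + s * (t2 - t1)) (cmap c (base (\<Gamma> (t1 + s * (t2 - t1)))))
              ((t2 - t1) *\<^sub>R vcomp (\<Gamma> (t1 + s * (t2 - t1))) c)) (at s within {0..1})"
    using bounded_linear.has_vector_derivative[OF bounded_linear_scaleR_right chain[OF d(2)], of T]
    unfolding eq unfolding T_def .
qed

lemma solution_of_rescaled:
  assumes c: "c \<in> A" and T: "t1 < t2"
    and X: "\<And>s. s \<in> {0..1} \<Longrightarrow> (X has_vector_derivative W s) (at s within {0..1})"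
    and W: "\<And>s. s \<in> {0..1} \<Longrightarrow> (W has_vector_derivative H c (t1 + s * (t2 - t1)) (X s) (W s)) (at s within {0..1})"
    and img: "\<And>s. s \<in> {0..1} \<Longrightarrow> X s \<in> cmap c ` cdom c"
  obtains \<Gamma> where "spray_solution A H {t1..t2} \<Gamma>"
    "\<And>t. t \<in> {t1..t2} \<Longrightarrow> base (\<Gamma> t) \<in> cdom c"
    "\<And>t. t \<in> {t1..t2} \<Longrightarrow> cmap c (base (\<Gamma> t)) = X ((t - t1) / (t2 - t1))"
proof -
  define T where "T = t2 - t1"
  have T0: "T > 0" using assms(2) by (simp add: T_def)
  define \<sigma> where "\<sigma> t = (t - t1) / T" for t
  have \<sigma>: "\<sigma> ` {t1..t2} \<subseteq> {0..1}"
    using T0 by (auto simp: \<sigma>_def T_def field_simps)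
  have \<sigma>_inv: "t1 + \<sigma> t * (t2 - t1) = t" for t using T0 by (simp add: \<sigma>_def T_def)
  define y where "y t = (X (\<sigma> t), (1 / T) *\<^sub>R W (\<sigma> t))" for t
  define \<Gamma> where "\<Gamma> t = tangent_of c (y t)" for t
  have yimg: "fst (y t) \<in> cmap c ` cdom c" if "t \<in> {t1..t2}" for t
    unfolding y_def fst_conv by (rule img[OF subsetD[OF \<sigma> imageI[OF that]]])
  note \<Gamma> = tangent_of[OF c yimg, folded \<Gamma>_def]
  have y': "(y has_vector_derivative phase_field c t (y t)) (at t within {t1..t2})" if t: "t \<in> {t1..t2}" for t
  proof -
    have \<sigma>t: "\<sigma> t \<in> {0..1}" using \<sigma> t by blast
    have lin: "(\<sigma> has_vector_derivative 1 / T) (at t within {t1..t2})"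
    proof -
      have "((\<lambda>t. (t - t1) / T) has_real_derivative 1 / T) (at t within {t1..t2})"
        using T0 by (auto intro!: derivative_eq_intros)
      then show ?thesis unfolding \<sigma>_def[abs_def] has_real_derivative_iff_has_vector_derivative .
    qed
    have chain: "((\<lambda>t. g (\<sigma> t)) has_vector_derivative (1 / T) *\<^sub>R g') (at t within {t1..t2})"
      if "(g has_vector_derivative g') (at (\<sigma> t) within {0..1})" for g :: "real \<Rightarrow> real^'n" and g'
      using vector_diff_chain_within[OF lin has_vector_derivative_within_subset[OF that \<sigma>]]
      by (simp only: o_def)
    have T1: "1 / T > 0" using T0 by simp
    have "(y has_vector_derivative ((1 / T) *\<^sub>R W (\<sigma> t), (1 / T) *\<^sub>R (1 / T) *\<^sub>R H c t (X (\<sigma> t)) (W (\<sigma> t))))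
        (at t within {t1..t2})"
      unfolding y_def[abs_def] has_vector_derivative_pair_iff
      using chain[OF X[OF \<sigma>t]]
        bounded_linear.has_vector_derivative[OF bounded_linear_scaleR_right chain[OF W[OF \<sigma>t]], of "1 / T"]
      unfolding \<sigma>_inv by blast
    moreover have "(1 / T) *\<^sub>R (1 / T) *\<^sub>R H c t (X (\<sigma> t)) (W (\<sigma> t)) = H c t (X (\<sigma> t)) ((1 / T) *\<^sub>R W (\<sigma> t))"
      unfolding spray_homogeneous[OF c img[OF \<sigma>t] T1] by (simp add: power2_eq_square)
    ultimately show ?thesis by (simp add: phase_field_def y_def)
  qed
  have conty: "continuous_on {t1..t2} y"
    using y' has_vector_derivative_continuous continuous_on_eq_continuous_within by blast
  have contb: "continuous_on {t1..t2} (\<lambda>t. base (\<Gamma> t))"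
  proof -
    have inv: "continuous_on (cmap c ` cdom c) (inv_into (cdom c) (cmap c))"
      using chart_homeomorphism(3)[OF c] unfolding homeomorphism_def by blast
    have "continuous_on {t1..t2} (\<lambda>t. inv_into (cdom c) (cmap c) (fst (y t)))"
      by (rule continuous_on_compose2[OF inv continuous_on_fst[OF conty]]) (rule image_subsetI, rule yimg)
    then show ?thesis unfolding \<Gamma>_def tangent_of_def Let_def fst_conv .
  qed
  have TM: "\<Gamma> t \<in> tangent_bundle A" "base (\<Gamma> t) \<in> cdom c" if "t \<in> {t1..t2}" for t
    using \<Gamma>(1)[OF that] unfolding tangents_over_def by blast+
  have "solves_at {t1..t2} \<Gamma> t" if t: "t \<in> {t1..t2}" for t
  proof (rule solves_at_of_one_chart[where \<Gamma> = \<Gamma>, OF TM(1) t _ c TM(2)[OF t]])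
    show "continuous (at t within {t1..t2}) (\<lambda>s. base (\<Gamma> s))"
      using contb t unfolding continuous_on_eq_continuous_within by blast
    show "((\<lambda>s. tchart c (\<Gamma> s)) has_vector_derivative phase_field c t (tchart c (\<Gamma> t))) (at t within {t1..t2})"
      unfolding \<Gamma>(2)[OF t] by (rule has_vector_derivative_transform[OF t \<Gamma>(2) y'[OF t]])
  qed
  then have "spray_solution A H {t1..t2} \<Gamma>"
    unfolding spray_solution_iff using is_interval_cc by blast
  moreover have "cmap c (base (\<Gamma> t)) = X ((t - t1) / (t2 - t1))" if t: "t \<in> {t1..t2}" for t
    using arg_cong[OF \<Gamma>(2)[OF t], of fst] unfolding tchart_def y_def \<sigma>_def T_def fst_conv .
  ultimately show ?thesis using that[of \<Gamma>] TM(2) by blast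
qed

text \<open>The neighborhood is a coordinate ball of radius \<open>r\<close> around the point. Neither \<open>r\<close> nor the estimate for the rescaled
  boundary value problem depends on the length of the time interval, so one neighborhood serves arbitrarily
  short times. Solutions that stay in the neighborhood stay in the domain of the
  chart, so they are solutions of the problem in coordinates and conversely.\<close>

lemma convex_neighborhood:
  assumes "\<epsilon> > 0"
  shows "\<exists>C. open C \<and> p_hat \<in> C \<and>
    (\<forall>p1\<in>C. \<forall>p2\<in>C. \<forall>t1 \<in> {t_hat - \<epsilon><..<t_hat + \<epsilon>}. \<forall>t2 \<in> {t_hat - \<epsilon><..<t_hat + \<epsilon>}.
       t1 < t2 \<longrightarrow>
       (\<exists>\<Gamma>. joining_solution A H C t1 p1 t2 p2 \<Gamma>) \<and>
       (\<forall>\<Gamma> \<Delta>. joining_solution A H C t1 p1 t2 p2 \<Gamma> \<and> joining_solution A H C t1 p1 t2 p2 \<Delta>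
          \<longrightarrow> (\<forall>t\<in>{t1..t2}. \<Gamma> t = \<Delta> t)))"
proof -
  obtain c where c: "c \<in> A" "p_hat \<in> cdom c" by (rule chart_at)
  let ?z = "cmap c p_hat"
  have z: "?z \<in> cmap c ` cdom c" using c by blast
  have "t_hat - \<epsilon> \<le> t_hat + \<epsilon>" using assms by simp
  then obtain R K where R: "R > 0" and K: "K \<ge> 1" and sub: "ball ?z R \<subseteq> cmap c ` cdom c"
    and est: "\<And>t x x' v v' \<rho>. t \<in> {t_hat - \<epsilon>..t_hat + \<epsilon>} \<Longrightarrow> x \<in> ball ?z R \<Longrightarrow> x' \<in> ball ?z R \<Longrightarrow>
       norm v \<le> \<rho> \<Longrightarrow> norm v' \<le> \<rho> \<Longrightarrow>
       norm (H c t x v - H c t x' v') \<le> K * (\<rho>\<^sup>2 * norm (x - x') + \<rho> * norm (v - v'))"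
    by (rule spray_quadratic_estimate[OF c(1) z]) blast
  \<comment> \<open>This gives \<open>5 r \<le> R\<close> and \<open>144 K r \<le> 1\<close>.\<close>
  define r where "r = min (R / 5) (1 / (144 * K))"
  have r: "r > 0" using R K by (simp add: r_def)
  have "r \<le> R / 5" "r \<le> 1 / (144 * K)" unfolding r_def by simp_all
  then have r5: "5 * r \<le> R" and rK: "144 * K * r \<le> 1" using K by (simp_all add: field_simps)
  have sub5: "ball ?z (5 * r) \<subseteq> ball ?z R" using r5 by (rule subset_ball)
  have sub1: "ball ?z r \<subseteq> ball ?z (5 * r)" using r by (intro subset_ball) simp
  define C where "C = {p \<in> cdom c. cmap c p \<in> ball ?z r}"
  have C: "p \<in> C \<longleftrightarrow> p \<in> cdom c \<and> cmap c p \<in> ball ?z r" for p by (simp add: C_def)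
  have contc: "continuous_on (cdom c) (cmap c)"
    using chart_homeomorphism(3)[OF c(1)] unfolding homeomorphism_def by blast
  have openC: "open C"
  proof -
    have "C = cdom c \<inter> cmap c -` ball ?z r" unfolding C_def by blast
    then show ?thesis
      using continuous_open_preimage[OF contc chart_homeomorphism(1)[OF c(1)] open_ball] by simp
  qed
  have main: "(\<exists>\<Gamma>. joining_solution A H C t1 p1 t2 p2 \<Gamma>) \<and>
       (\<forall>\<Gamma> \<Delta>. joining_solution A H C t1 p1 t2 p2 \<Gamma> \<and> joining_solution A H C t1 p1 t2 p2 \<Delta>
          \<longrightarrow> (\<forall>t\<in>{t1..t2}. \<Gamma> t = \<Delta> t))"
    if p: "p1 \<in> C" "p2 \<in> C" and t12: "t1 \<in> {t_hat - \<epsilon><..<t_hat + \<epsilon>}" "t2 \<in> {t_hat - \<epsilon><..<t_hat + \<epsilon>}" "t1 < t2"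
    for p1 p2 t1 t2
  proof -
    define h where "h s x w = H c (t1 + s * (t2 - t1)) x w" for s x w
    have time: "t1 + s * (t2 - t1) \<in> {t1..t2}" "t1 + s * (t2 - t1) \<in> {t_hat - \<epsilon>..t_hat + \<epsilon>}"
      if "s \<in> {0..1}" for s
    proof -
      have "0 \<le> s * (t2 - t1)" by (rule mult_nonneg_nonneg) (use that t12(3) in auto)
      then have lo: "t1 \<le> t1 + s * (t2 - t1)" by linarith
      have "s * (t2 - t1) \<le> 1 * (t2 - t1)" by (rule mult_right_mono) (use that t12(3) in auto)
      from add_left_mono[OF this, of t1] have hi: "t1 + s * (t2 - t1) \<le> t2"
        unfolding mult_1 add_diff_cancel_left' by (simp only: add.commute diff_add_cancel)
      show "t1 + s * (t2 - t1) \<in> {t1..t2}" unfolding atLeastAtMost_iff using lo hi by blast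
      have "t_hat - \<epsilon> \<le> t1" "t2 \<le> t_hat + \<epsilon>" using t12 by simp_all
      then show "t1 + s * (t2 - t1) \<in> {t_hat - \<epsilon>..t_hat + \<epsilon>}"
        unfolding atLeastAtMost_iff using lo hi by (meson order_trans)
    qed
    interpret ode: quadratic_second_order_ode h ?z r K
    proof
      show "0 < r" "1 \<le> K" "144 * K * r \<le> 1" by fact+
      have "continuous_on ({0..1} \<times> ball ?z (5 * r) \<times> UNIV)
          (\<lambda>q. (\<lambda>(t, x, v). H c t x v) (t1 + fst q * (t2 - t1), snd q))"
      proof (rule continuous_on_compose2[OF locally_lipschitz_on_continuous[OF spray_lipschitz[OF c(1)]]])
        show "continuous_on ({0..1} \<times> ball ?z (5 * r) \<times> (UNIV :: (real^'n) set)) (\<lambda>q. (t1 + fst q * (t2 - t1), snd q))"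
          by (intro continuous_intros)
        show "(\<lambda>q. (t1 + fst q * (t2 - t1), snd q)) ` ({0..1} \<times> ball ?z (5 * r) \<times> (UNIV :: (real^'n) set))
            \<subseteq> UNIV \<times> (cmap c ` cdom c) \<times> UNIV"
        proof (rule image_subsetI)
          fix q :: "real \<times> (real^'n) \<times> (real^'n)"
          assume "q \<in> {0..1} \<times> ball ?z (5 * r) \<times> UNIV"
          then have "fst (snd q) \<in> ball ?z (5 * r)" unfolding mem_Times_iff by blast
          then have "fst (snd q) \<in> cmap c ` cdom c" by (rule subsetD[OF subset_trans[OF sub5 sub]])
          then show "(t1 + fst q * (t2 - t1), snd q) \<in> UNIV \<times> (cmap c ` cdom c) \<times> UNIV"
            unfolding mem_Times_iff snd_conv fst_conv by blast
        qed
      qed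
      then show "continuous_on ({0..1} \<times> ball ?z (5 * r) \<times> UNIV) (\<lambda>(s, x, v). h s x v)"
        unfolding h_def case_prod_unfold fst_conv snd_conv .
      show "h s x 0 = 0" if "s \<in> {0..1}" "x \<in> ball ?z (5 * r)" for s x
        unfolding h_def by (rule spray_zero[OF c(1)]) (use sub5 sub that in blast)
      show "norm (h s x v - h s x' v') \<le> K * (\<rho>\<^sup>2 * norm (x - x') + \<rho> * norm (v - v'))"
        if "s \<in> {0..1}" "x \<in> ball ?z (5 * r)" "x' \<in> ball ?z (5 * r)" "norm v \<le> \<rho>" "norm v' \<le> \<rho>"
        for s x x' v v' \<rho>
        unfolding h_def
        by (rule est[OF time(2)[OF that(1)] subsetD[OF sub5 that(2)] subsetD[OF sub5 that(3)] that(4,5)])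
    qed
    have pz: "cmap c p1 \<in> ball ?z r" "cmap c p2 \<in> ball ?z r" "p1 \<in> cdom c" "p2 \<in> cdom c"
      using p unfolding C by blast+
    have ex: "\<exists>\<Gamma>. joining_solution A H C t1 p1 t2 p2 \<Gamma>"
    proof -
      obtain X W where XW: "ode.solves X W" "X 0 = cmap c p1" "X 1 = cmap c p2"
        and Xz: "\<And>s. s \<in> {0..1} \<Longrightarrow> X s \<in> ball ?z r"
        by (rule ode.solution_exists[OF pz(1,2)]) blast
      have "X s \<in> cmap c ` cdom c" if "s \<in> {0..1}" for s
        using Xz[OF that] sub1 sub5 sub by blast
      then obtain \<Gamma> where \<Gamma>: "spray_solution A H {t1..t2} \<Gamma>"
        "\<And>t. t \<in> {t1..t2} \<Longrightarrow> base (\<Gamma> t) \<in> cdom c"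
        "\<And>t. t \<in> {t1..t2} \<Longrightarrow> cmap c (base (\<Gamma> t)) = X ((t - t1) / (t2 - t1))"
        using solution_of_rescaled[OF c(1) t12(3), of X W] XW(1)
        unfolding ode.solves_def h_def by blast
      have unit: "(t - t1) / (t2 - t1) \<in> {0..1}" if "t \<in> {t1..t2}" for t
        using that t12(3) by (simp add: field_simps)
      have base_eq: "base (\<Gamma> t) = p" if "t \<in> {t1..t2}" "p \<in> cdom c" "cmap c (base (\<Gamma> t)) = cmap c p" for t p
        using inv_chart[OF c(1) \<Gamma>(2)[OF that(1)]] inv_chart[OF c(1) that(2)] that(3) by metis
      have ends: "t1 \<in> {t1..t2}" "t2 \<in> {t1..t2}" using t12(3) by simp_all
      have "base (\<Gamma> t1) = p1"
        by (rule base_eq[OF ends(1) pz(3)]) (use \<Gamma>(3)[OF ends(1)] XW(2) in simp)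
      moreover have "base (\<Gamma> t2) = p2"
        by (rule base_eq[OF ends(2) pz(4)]) (use \<Gamma>(3)[OF ends(2)] XW(3) t12(3) in simp)
      moreover have "base (\<Gamma> t) \<in> C" if "t \<in> {t1..t2}" for t
        unfolding C \<Gamma>(3)[OF that] using \<Gamma>(2)[OF that] Xz[OF unit[OF that]] by blast
      ultimately show ?thesis using \<Gamma>(1) unfolding joining_solution_def by blast
    qed
    have uniq: "\<Gamma> t = \<Delta> t"
      if \<Gamma>: "joining_solution A H C t1 p1 t2 p2 \<Gamma>" and \<Delta>: "joining_solution A H C t1 p1 t2 p2 \<Delta>"
        and t: "t \<in> {t1..t2}" for \<Gamma> \<Delta> t
    proof -
      define x where "x \<Gamma> s = cmap c (base (\<Gamma> (t1 + s * (t2 - t1))))" for \<Gamma> :: "real \<Rightarrow> ('m, 'n) tangent" and s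
      define w where "w \<Gamma> s = (t2 - t1) *\<^sub>R vcomp (\<Gamma> (t1 + s * (t2 - t1))) c" for \<Gamma> :: "real \<Rightarrow> ('m, 'n) tangent" and s
      have sol: "ode.solves (x \<Gamma>) (w \<Gamma>)" "x \<Gamma> s \<in> ball ?z r" "x \<Gamma> 0 = cmap c p1" "x \<Gamma> 1 = cmap c p2"
        if \<Gamma>: "joining_solution A H C t1 p1 t2 p2 \<Gamma>" and "s \<in> {0..1}" for \<Gamma> s
      proof -
        have inC: "base (\<Gamma> t) \<in> C" if "t \<in> {t1..t2}" for t
          using \<Gamma> that unfolding joining_solution_def by blast
        have spr: "spray_solution A H {t1..t2} \<Gamma>" using \<Gamma> unfolding joining_solution_def by blast
        have over: "base (\<Gamma> t) \<in> cdom c" if "t \<in> {t1..t2}" for t using inC[OF that] unfolding C by blast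
        show "ode.solves (x \<Gamma>) (w \<Gamma>)"
          unfolding ode.solves_def h_def x_def[abs_def] w_def[abs_def]
          by (intro ballI conjI rescaled_solution[OF c(1) t12(3) spr over])
        show "x \<Gamma> s \<in> ball ?z r" using inC[OF time(1)[OF that(2)]] unfolding C x_def by blast
        show "x \<Gamma> 0 = cmap c p1" "x \<Gamma> 1 = cmap c p2"
          using \<Gamma> unfolding joining_solution_def x_def by simp_all
      qed
      define s where "s = (t - t1) / (t2 - t1)"
      have s: "s \<in> {0..1}" using t t12(3) by (simp add: s_def field_simps)
      have ts: "t1 + s * (t2 - t1) = t" using t12(3) by (simp add: s_def)
      have zero: "(0::real) \<in> {0..1}" by simp
      have ends: "x \<Gamma> 0 = x \<Delta> 0" "x \<Gamma> 1 = x \<Delta> 1"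
        using sol(3,4)[OF \<Gamma> zero] sol(3,4)[OF \<Delta> zero] by simp_all
      have "x \<Gamma> s = x \<Delta> s" "w \<Gamma> s = w \<Delta> s"
        using ode.solution_unique[OF sol(1)[OF \<Gamma> zero] sol(2)[OF \<Gamma>] sol(1)[OF \<Delta> zero] sol(2)[OF \<Delta>] ends s]
        by simp_all
      then have "tchart c (\<Gamma> t) = tchart c (\<Delta> t)"
        unfolding x_def w_def ts tchart_def using t12(3) by simp
      moreover have "\<Theta> t \<in> tangents_over c" if "joining_solution A H C t1 p1 t2 p2 \<Theta>" for \<Theta>
        using that t unfolding joining_solution_def spray_solution_def tangents_over_def C by blast
      ultimately show ?thesis using tangent_eqI[OF _ _ c(1)] \<Gamma> \<Delta> by blast
    qed
    show ?thesis using ex uniq by blast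
  qed
  have "p_hat \<in> C" unfolding C using c(2) r by simp
  then show ?thesis using openC main by (intro exI[of _ C] conjI ballI impI) blast+
qed

end

theorem theorem14:
  fixes A :: "('m::t2_space, 'n::finite) chart set"
    and H :: "('m, 'n) spray"
  assumes "c21_manifold A" and "lipschitz_spray A H"
  shows "(\<exists>J \<gamma>. (\<forall>t0. \<forall>\<xi> \<in> tangent_bundle A.
                   maximal_solution A H t0 \<xi> (J t0 \<xi>) (\<gamma> t0 \<xi>) \<and>
                   c21_curve A (J t0 \<xi>) (\<lambda>t. base (\<gamma> t0 \<xi> t))) \<and>
                locally_lipschitz_flow A J \<gamma>) \<and>
         (\<forall>t_hat p_hat. \<forall>\<epsilon>>0. \<exists>C. open C \<and> p_hat \<in> C \<and>
            (\<forall>p1\<in>C. \<forall>p2\<in>C. \<forall>t1 \<in> {t_hat - \<epsilon><..<t_hat + \<epsilon>}. \<forall>t2 \<in> {t_hat - \<epsilon><..<t_hat + \<epsilon>}.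
               t1 < t2 \<longrightarrow>
               (\<exists>\<Gamma>. joining_solution A H C t1 p1 t2 p2 \<Gamma>) \<and>
               (\<forall>\<Gamma> \<Delta>. joining_solution A H C t1 p1 t2 p2 \<Gamma> \<and> joining_solution A H C t1 p1 t2 p2 \<Delta>
                  \<longrightarrow> (\<forall>t\<in>{t1..t2}. \<Gamma> t = \<Delta> t))))"
proof -
  interpret spray_atlas A H
    using assms by unfold_locales (simp_all add: c21_manifold_def)
  have curve: "c21_curve A (max_domain t0 \<xi>) (\<lambda>t. base (flow t0 \<xi> t))" if "\<xi> \<in> tangent_bundle A" for t0 \<xi>
    using maximal_solution_flow[OF that, of t0] unfolding maximal_solution_def
    by (intro spray_solution_c21_curve) blast+
  show ?thesis
  proof (intro conjI allI impI convex_neighborhood)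
    show "\<exists>J \<gamma>. (\<forall>t0. \<forall>\<xi> \<in> tangent_bundle A.
             maximal_solution A H t0 \<xi> (J t0 \<xi>) (\<gamma> t0 \<xi>) \<and>
             c21_curve A (J t0 \<xi>) (\<lambda>t. base (\<gamma> t0 \<xi> t))) \<and>
          locally_lipschitz_flow A J \<gamma>"
      by (rule exI[of _ max_domain], rule exI[of _ flow])
        (intro conjI allI ballI maximal_solution_flow curve locally_lipschitz_flow)
  qed
qed

end
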